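(* Consider the episodic finite-horizon time-inhomogeneous MDP and the tabular RLSVI agent described in the context, under the independent Dirichlet prior with common pseudocount $\beta \geq 2$. Suppose RLSVI is applied with planning horizon $H$ and parameters $v = H^2$, $\bar{\theta} = H\mathbf{1}$ (every entry equal to $H$) and $v/\lambda = \beta$. Then for all $L \in \mathbb{N}$, \[ {\rm BayesRegret}({\rm RLSVI}_{\bar{\theta}, v, \lambda}, L) \leq 4H^2 \sqrt{\beta |\mathcal{X}||\mathcal{A}| L \log_{+}(1+|\mathcal{X}||\mathcal{A}|HL)}\,\log_{+}\!\left(1+ \frac{L}{|\mathcal{X}||\mathcal{A}|}\right), \] and \[ {\rm BayesRegret}({\rm RLSVI}_{\bar{\theta}, v, \lambda}, L) \leq 4\beta H^3 |\mathcal{X}||\mathcal{A}| \sqrt{\log_{+}(1+|\mathcal{X}| |\mathcal{A}| HL) }\,\log_+\!\left(1+ \frac{L}{|\mathcal{X}||\mathcal{A}|}\right) + 2 H^2 \sqrt{2|\mathcal{X}| |\mathcal{A}|L \log(|\mathcal{X}||\mathcal{A}|) }, \] where $\log_{+}(x) = \max\{1,\log(x)\}$.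
   Context: Setting. $\mathcal{X}$ is a finite set of states, $\mathcal{A}$ a finite set of actions, $H \in \mathbb{N}$ the horizon. An MDP $\mathcal{M}$ specifies an initial-state distribution $\rho$ on $\mathcal{X}$ and, for each $(t,x,a) \in \{0,\dots,H-1\}\times\mathcal{X}\times\mathcal{A}$, an outcome distribution $\mathcal{P}^O_{t,x,a}$ on the outcome space $\{0,1\}\times\mathcal{X}$ (of cardinality $2|\mathcal{X}|$). In each episode $\ell = 1,2,\dots$: $x_0^\ell \sim \rho$; for $t = 0,\dots,H-1$ the agent observes $x_t^\ell$, chooses $a_t^\ell$ and observes an outcome $(r_{t+1}^\ell, x_{t+1}^\ell) \sim \mathcal{P}^O_{t,x_t^\ell,a_t^\ell}$; the episode ends after period $H-1$. A policy is $\pi = (\pi_0,\dots,\pi_{H-1})$ with $\pi_t : \mathcal{X}\to\mathcal{A}$; $V^\pi_{\mathcal{M},t}(x) = \mathbb{E}_{\mathcal{M},\pi}[\sum_{s=t}^{H-1} r_{s+1} \mid x_t = x]$ and $V^*_{\mathcal{M},t}(x) = \max_\pi V^\pi_{\mathcal{M},t}(x)$. Prior. For each $(t,x,a)$, $\mathcal{P}^O_{t,x,a} \sim \mathrm{Dirichlet}(\alpha_{0,t,x,a})$ with $\alpha_{0,t,x,a} \in \mathbb{R}_+^{2|\mathcal{X}|}$ and $\mathbf{1}^T\alpha_{0,t,x,a} = \beta$, independently across $(t,x,a)$. RLSVI (tabular, infinite buffer, greedy actions, Gaussian noise) with parameters $\bar{\theta} \in \mathbb{R}^{\{0,\dots,H-1\}\times\mathcal{X}\times\mathcal{A}}$,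 $v>0$, $\lambda>0$. Let $D_{\ell-1}(t,x,a)$ be the multiset of outcomes $(r^k_{t+1}, x^k_{t+1})$ over episodes $k<\ell$ with $x^k_t = x$, $a^k_t = a$, and $n_\ell(t,x,a) = |D_{\ell-1}(t,x,a)|$. Let $\sigma^2_\ell(t,x,a) = (1/\lambda + n_\ell(t,x,a)/v)^{-1}$ and $w_\ell(t,x,a) = \sigma_\ell(t,x,a)\xi_{\ell,t,x,a}$ where the $\xi$'s are i.i.d. standard normal, independent of everything else. For $Q \in \mathbb{R}^{\mathcal{X}\times\mathcal{A}}$ define \[F_{\ell,t}Q(x,a) = \sigma^2_\ell(t,x,a)\Big(\frac{\bar\theta_{t,x,a}}{\lambda} + \frac{1}{v}\sum_{(r,x')\in D_{\ell-1}(t,x,a)} \big(r + \max_{a'\in\mathcal{A}} Q(x',a')\big)\Big) + w_\ell(t,x,a).\] In episode $\ell$, RLSVI sets $Q_{\ell,H} = 0$, $Q_{\ell,t} = F_{\ell,t}Q_{\ell,t+1}$ for $t<H$, and plays $\pi_\ell$ with $\pi_{\ell,t}(x) \in \arg\max_a Q_{\ell,t}(x,a)$. ${\rm BayesRegret}({\rm RLSVI}_{\bar\theta,v,\lambda}, L) = \mathbb{E}\big[\sum_{\ell=1}^L \big(V^*_{\mathcal{M},0}(x_0^\ell) - V^{\pi_\ell}_{\mathcal{M},0}(x_0^\ell)\big)\big]$, the expectation being over the prior on $\mathcal{M}$, the episode randomness and the RLSVI noise. *)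

theory Defs
  imports "HOL-Probability.Probability"
begin

text \<open>Gamma(k,1) distribution on the reals; Gamma(0) is the point mass at 0
  (Ferguson's convention, which allows zero pseudocounts).\<close>
definition gamma_dist :: "real \<Rightarrow> real measure" where
  "gamma_dist k = (if k = 0 then return borel 0
     else density lborel (\<lambda>y. ennreal (if 0 < y then y powr (k - 1) * exp (- y) / Gamma k else 0)))"

text \<open>Dirichlet(alpha) on a finite outcome type, as the law of normalised
  independent Gamma(alpha_o,1) variables (Ferguson 1973).\<close>
definition dirichlet :: "('o::finite \<Rightarrow> real) \<Rightarrow> ('o \<Rightarrow> real) measure" where
  "dirichlet \<alpha> = distr (PiM UNIV (\<lambda>w. gamma_dist (\<alpha> w))) (PiM UNIV (\<lambda>_. borel))
      (\<lambda>g w. g w / (\<Sum>w'\<in>UNIV. g w'))"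

text \<open>An MDP (for fixed initial distribution) is given by the outcome
  probability vectors P(t,x,a)(r,x').  The prior: independent Dirichlet
  vectors for (t,x,a) with t < H.\<close>
type_synonym ('x,'a) model = "nat \<times> 'x \<times> 'a \<Rightarrow> bool \<times> 'x \<Rightarrow> real"
type_synonym ('x,'a) policy = "nat \<Rightarrow> 'x \<Rightarrow> 'a"

definition mdp_prior :: "nat \<Rightarrow> (nat \<times> 'x::finite \<times> 'a::finite \<Rightarrow> bool \<times> 'x \<Rightarrow> real)
    \<Rightarrow> ('x,'a) model measure" where
  "mdp_prior H \<alpha> = PiM ({..<H} \<times> UNIV \<times> UNIV) (\<lambda>txa. dirichlet (\<alpha> txa))"

primrec Vrem :: "('x::finite,'a) model \<Rightarrow> ('x,'a) policy \<Rightarrow> nat \<Rightarrow> nat \<Rightarrow> 'x \<Rightarrow> real" where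
  "Vrem P \<pi> H 0 x = 0"
| "Vrem P \<pi> H (Suc k) x = (let t = H - Suc k in
     (\<Sum>w\<in>UNIV. P (t, x, \<pi> t x) w * (of_bool (fst w) + Vrem P \<pi> H k (snd w))))"

definition Vpi :: "('x::finite,'a) model \<Rightarrow> nat \<Rightarrow> ('x,'a) policy \<Rightarrow> nat \<Rightarrow> 'x \<Rightarrow> real" where
  "Vpi P H \<pi> t x = Vrem P \<pi> H (H - t) x"

definition Vstar :: "('x::finite,'a) model \<Rightarrow> nat \<Rightarrow> nat \<Rightarrow> 'x \<Rightarrow> real" where
  "Vstar P H t x = Max (range (\<lambda>\<pi>. Vpi P H \<pi> t x))"

text \<open>An episode: initial state x_0 and the list of (a_t, r_{t+1}, x_{t+1}), t < H.\<close>
type_synonym ('x,'a) episode = "'x \<times> ('a \<times> bool \<times> 'x) list"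

definition ep_state :: "('x,'a) episode \<Rightarrow> nat \<Rightarrow> 'x" where
  "ep_state e t = (if t = 0 then fst e else snd (snd (snd e ! (t - 1))))"

definition ep_action :: "('x,'a) episode \<Rightarrow> nat \<Rightarrow> 'a" where
  "ep_action e t = fst (snd e ! t)"

definition ep_outcome :: "('x,'a) episode \<Rightarrow> nat \<Rightarrow> bool \<times> 'x" where
  "ep_outcome e t = snd (snd e ! t)"

definition episodes :: "nat \<Rightarrow> ('x,'a) episode set" where
  "episodes H = {e. length (snd e) = H}"

definition ep_prob :: "'x pmf \<Rightarrow> ('x,'a) model \<Rightarrow> nat \<Rightarrow> ('x,'a) policy \<Rightarrow> ('x,'a) episode \<Rightarrow> real" where
  "ep_prob \<rho> P H \<pi> e = pmf \<rho> (fst e) *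
     (\<Prod>t<H. (if ep_action e t = \<pi> t (ep_state e t)
               then P (t, ep_state e t, ep_action e t) (ep_outcome e t) else 0))"

definition data :: "('x,'a) episode list \<Rightarrow> nat \<Rightarrow> 'x \<Rightarrow> 'a \<Rightarrow> (bool \<times> 'x) list" where
  "data hs t x a = map (\<lambda>e. ep_outcome e t) (filter (\<lambda>e. ep_state e t = x \<and> ep_action e t = a) hs)"

definition rlsvi_var :: "real \<Rightarrow> real \<Rightarrow> ('x,'a) episode list \<Rightarrow> nat \<Rightarrow> 'x \<Rightarrow> 'a \<Rightarrow> real" where
  "rlsvi_var v lam hs t x a = inverse (1 / lam + real (length (data hs t x a)) / v)"

definition rlsvi_F :: "(nat \<times> 'x \<times> 'a \<Rightarrow> real) \<Rightarrow> real \<Rightarrow> real \<Rightarrow> ('x::finite,'a::finite) episode list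
    \<Rightarrow> (nat \<times> 'x \<times> 'a \<Rightarrow> real) \<Rightarrow> nat \<Rightarrow> ('x \<Rightarrow> 'a \<Rightarrow> real) \<Rightarrow> 'x \<Rightarrow> 'a \<Rightarrow> real" where
  "rlsvi_F \<theta> v lam hs \<xi> t Q x a =
     rlsvi_var v lam hs t x a * (\<theta> (t, x, a) / lam +
        (1 / v) * (\<Sum>w\<leftarrow>data hs t x a. of_bool (fst w) + Max (range (Q (snd w)))))
     + sqrt (rlsvi_var v lam hs t x a) * \<xi> (t, x, a)"

primrec rlsvi_Qrem :: "(nat \<times> 'x \<times> 'a \<Rightarrow> real) \<Rightarrow> real \<Rightarrow> real \<Rightarrow> nat \<Rightarrow> ('x::finite,'a::finite) episode list
    \<Rightarrow> (nat \<times> 'x \<times> 'a \<Rightarrow> real) \<Rightarrow> nat \<Rightarrow> 'x \<Rightarrow> 'a \<Rightarrow> real" where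
  "rlsvi_Qrem \<theta> v lam H hs \<xi> 0 = (\<lambda>x a. 0)"
| "rlsvi_Qrem \<theta> v lam H hs \<xi> (Suc k) = rlsvi_F \<theta> v lam hs \<xi> (H - Suc k) (rlsvi_Qrem \<theta> v lam H hs \<xi> k)"

definition rlsvi_Q :: "(nat \<times> 'x \<times> 'a \<Rightarrow> real) \<Rightarrow> real \<Rightarrow> real \<Rightarrow> nat \<Rightarrow> ('x::finite,'a::finite) episode list
    \<Rightarrow> (nat \<times> 'x \<times> 'a \<Rightarrow> real) \<Rightarrow> nat \<Rightarrow> 'x \<Rightarrow> 'a \<Rightarrow> real" where
  "rlsvi_Q \<theta> v lam H hs \<xi> t = rlsvi_Qrem \<theta> v lam H hs \<xi> (H - t)"

text \<open>Greedy policy (a fixed, arbitrary choice among maximisers; ties have probability zero).\<close>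
definition rlsvi_policy :: "(nat \<times> 'x \<times> 'a \<Rightarrow> real) \<Rightarrow> real \<Rightarrow> real \<Rightarrow> nat \<Rightarrow> ('x::finite,'a::finite) episode list
    \<Rightarrow> (nat \<times> 'x \<times> 'a \<Rightarrow> real) \<Rightarrow> ('x,'a) policy" where
  "rlsvi_policy \<theta> v lam H hs \<xi> t x = (SOME a. \<forall>a'. rlsvi_Q \<theta> v lam H hs \<xi> t x a' \<le> rlsvi_Q \<theta> v lam H hs \<xi> t x a)"

definition noise :: "nat \<Rightarrow> (nat \<times> 'x::finite \<times> 'a::finite \<Rightarrow> real) measure" where
  "noise H = PiM ({..<H} \<times> UNIV \<times> UNIV) (\<lambda>_. density lborel std_normal_density)"

text \<open>Given the model P and the noise sequence Xi (Xi l is the noise of episode l+1),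
  the joint probability of the first L episodes es, and the regret realised on them.\<close>
definition hist_prob :: "(nat \<times> 'x \<times> 'a \<Rightarrow> real) \<Rightarrow> real \<Rightarrow> real \<Rightarrow> nat \<Rightarrow> 'x pmf
    \<Rightarrow> ('x::finite,'a::finite) model \<Rightarrow> (nat \<Rightarrow> nat \<times> 'x \<times> 'a \<Rightarrow> real) \<Rightarrow> ('x,'a) episode list \<Rightarrow> real" where
  "hist_prob \<theta> v lam H \<rho> P \<Xi> es =
     (\<Prod>l<length es. ep_prob \<rho> P H (rlsvi_policy \<theta> v lam H (take l es) (\<Xi> l)) (es ! l))"

definition hist_regret :: "(nat \<times> 'x \<times> 'a \<Rightarrow> real) \<Rightarrow> real \<Rightarrow> real \<Rightarrow> nat
    \<Rightarrow> ('x::finite,'a::finite) model \<Rightarrow> (nat \<Rightarrow> nat \<times> 'x \<times> 'a \<Rightarrow> real) \<Rightarrow> ('x,'a) episode list \<Rightarrow> real" where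
  "hist_regret \<theta> v lam H P \<Xi> es =
     (\<Sum>l<length es. Vstar P H 0 (fst (es ! l))
                     - Vpi P H (rlsvi_policy \<theta> v lam H (take l es) (\<Xi> l)) 0 (fst (es ! l)))"

definition bayes_regret_rlsvi :: "(nat \<times> 'x \<times> 'a \<Rightarrow> real) \<Rightarrow> real \<Rightarrow> real \<Rightarrow> nat \<Rightarrow> 'x pmf
    \<Rightarrow> (nat \<times> 'x::finite \<times> 'a::finite \<Rightarrow> bool \<times> 'x \<Rightarrow> real) \<Rightarrow> nat \<Rightarrow> real" where
  "bayes_regret_rlsvi \<theta> v lam H \<rho> \<alpha> L =
     (\<integral>P. (\<integral>\<Xi>. (\<Sum>es\<in>{es. length es = L \<and> set es \<subseteq> episodes H}.
                  hist_prob \<theta> v lam H \<rho> P \<Xi> es * hist_regret \<theta> v lam H P \<Xi> es)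
            \<partial>PiM {..<L} (\<lambda>_. noise H))
        \<partial>mdp_prior H \<alpha>)"

definition log_plus :: "real \<Rightarrow> real" where
  "log_plus y = max 1 (ln y)"

end

theory Submission
  imports Defs "HOL-Real_Asymp.Real_Asymp"
begin

text \<open>Given a history, the Bellman backup of a fixed value function with range in \<open>[0,H]\<close> is a Dirichlet average
  under the posterior and a Gaussian with standard deviation \<open>H / sqrt (\<beta> + n)\<close> and no smaller mean under RLSVI.
  The Gaussian dominates in the increasing convex order, which is seen from the Polya urn representation of the
  Dirichlet law. Replacing the backups one coordinate \<open>(t, x, a)\<close> at a time, in order of time, shows that the
  randomized value functions are optimistic in expectation. Because the transitions of different periods are
  independent, the regret of an episode is then at most the expected on-policy sum of the Bellman errors of the
  randomized value functions in the posterior mean model. Such an error consists of the pull of the prior, of order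
  \<open>\<beta> / (\<beta> + n)\<close>, which sums to a logarithm, and of the noise \<open>H \<xi> / sqrt (\<beta> + n)\<close> at the chosen action.

  Bounding all noise by one maximum would cost a factor \<open>sqrt (log (N H L))\<close>, \<open>N = |X| |A|\<close>, in the second bound.
  Instead \<open>\<xi> / sqrt (\<beta> + n)\<close> is compared with a threshold \<open>g n\<close> that is chosen such that the expected excess over
  it does not depend on \<open>n\<close>; the thresholds met along any path sum to at most \<open>2 sqrt (2 N L log N)\<close> per period,
  including the excess.

  The first bound follows from the second one and the trivial bound \<open>H L\<close>, since the first one exceeds \<open>H L\<close>
  whenever \<open>L\<close> is too small for its square root term to absorb the \<open>H^3\<close> term.\<close>

subsection \<open>Gamma and Dirichlet distributions\<close>

text \<open>Given the history, the model and the fresh noise are independent, so the optimal value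
  and its randomized counterpart are compared through their laws alone, without confining the model
  to a confidence set. The tuning serves this comparison: a true backup lies in
  \<open>[0, H]\<close>, so the prior mean \<open>H\<close> only raises the Gaussian mean, and
  \<open>v / \<lambda> = \<beta>\<close> gives the regression the same effective sample size
  \<open>\<beta> + n\<close> as the Dirichlet posterior.

  The randomized values have no deterministic lower bound: each of up to \<open>H\<close> backups
  can lower them by \<open>H / sqrt \<beta>\<close> times the largest negative noise. Their distance
  from \<open>H\<close> multiplies the pull of the prior, which is the origin of
  \<open>H^3 sqrt (log (N H L))\<close> in the second bound. The noise at the chosen action decays
  only like \<open>1 / sqrt n\<close> and is biased upwards, since the action is selected by that
  very noise. Thresholds that depend on the visit count alone separate the two effects: they can be
  summed along any path, while the excess over them is summed over all coordinates, whichever of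
  them are visited.\<close>

lemma sets_gamma_dist [simp, measurable_cong]: "sets (gamma_dist k) = sets borel"
  by (simp add: gamma_dist_def)

lemma space_gamma_dist [simp]: "space (gamma_dist k) = UNIV"
  by (simp add: gamma_dist_def)

lemma nn_integral_gamma_dist:
  assumes "0 < k" and [measurable]: "f \<in> borel_measurable borel"
  shows "(\<integral>\<^sup>+ y. f y \<partial>gamma_dist k)
    = (\<integral>\<^sup>+ y. ennreal (if 0 < y then y powr (k - 1) * exp (- y) / Gamma k else 0) * f y \<partial>lborel)"
  using assms(1) by (simp add: gamma_dist_def nn_integral_density)

lemma nn_integral_gamma_dist_0:
  assumes "f \<in> borel_measurable borel"
  shows "(\<integral>\<^sup>+ y. f y \<partial>gamma_dist 0) = f 0"
  using assms by (simp add: gamma_dist_def nn_integral_return)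

lemma prob_space_gamma_dist:
  assumes "0 \<le> k"
  shows "prob_space (gamma_dist k)"
proof (cases "k = 0")
  case True
  then show ?thesis by (simp add: gamma_dist_def prob_space_return)
next
  case False
  with assms have k: "0 < k" by simp
  have "emeasure (gamma_dist k) UNIV = (\<integral>\<^sup>+ y. 1 \<partial>gamma_dist k)"
    by (simp add: nn_integral_const[where c=1, simplified])
  also have "\<dots> = (\<integral>\<^sup>+ y. ennreal (if 0 < y then y powr (k - 1) * exp (- y) / Gamma k else 0) \<partial>lborel)"
    by (subst nn_integral_gamma_dist[OF k]) auto
  also have "\<dots> = (\<integral>\<^sup>+ y. ennreal (1 / Gamma k) * ennreal (indicator {0..} y * y powr (k - 1) / exp y) \<partial>lborel)"
    by (rule nn_integral_cong, subst ennreal_mult[symmetric])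
       (use k in \<open>auto simp: exp_minus field_simps Gamma_real_pos indicator_def intro!: arg_cong[where f=ennreal]\<close>)
  also have "\<dots> = ennreal (1 / Gamma k) * ennreal (Gamma k)"
    by (subst nn_integral_cmult) (use k in \<open>auto simp: Gamma_conv_nn_integral_real\<close>)
  also have "\<dots> = 1"
    using Gamma_real_pos[OF k] by (subst ennreal_mult[symmetric]) auto
  finally show ?thesis
    by (intro prob_spaceI) simp
qed

text \<open>The factor \<open>y\<close> raises the exponent of the density by one, and
  \<open>Gamma (k + 1) = k * Gamma k\<close> restores the normalization. At \<open>k = 0\<close> the
  point mass at 0 makes both sides vanish, so zero pseudocounts are covered.\<close>

lemma gamma_dist_size_bias:
  assumes k: "0 \<le> k" and [measurable]: "f \<in> borel_measurable borel"
  shows "(\<integral>\<^sup>+ y. ennreal y * f y \<partial>gamma_dist k) = ennreal k * (\<integral>\<^sup>+ y. f y \<partial>gamma_dist (k + 1))"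
proof (cases "k = 0")
  case True
  then show ?thesis by (simp add: nn_integral_gamma_dist_0)
next
  case False
  with k have k: "0 < k" by simp
  let ?d = "\<lambda>k y. if 0 < y then y powr (k - 1) * exp (- y) / Gamma k else 0 :: real"
  have "Gamma k > 0" "Gamma (k + 1) > 0" "Gamma (k + 1) = k * Gamma k"
    using k by (auto simp: Gamma_real_pos intro!: Gamma_plus1 dest: nonpos_Ints_nonpos)
  then have eq: "ennreal (?d k y) * ennreal y = ennreal k * ennreal (?d (k + 1) y)" for y
    using k by (cases "0 < y")
      (auto simp: ennreal_mult[symmetric] field_simps powr_diff intro!: arg_cong[where f=ennreal])
  have "(\<integral>\<^sup>+ y. ennreal y * f y \<partial>gamma_dist k)
    = (\<integral>\<^sup>+ y. ennreal (?d k y) * (ennreal y * f y) \<partial>lborel)"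
    by (rule nn_integral_gamma_dist[OF k]) measurable
  also have "\<dots> = (\<integral>\<^sup>+ y. ennreal k * (ennreal (?d (k + 1) y) * f y) \<partial>lborel)"
    by (simp only: eq flip: mult.assoc)
  also have "\<dots> = ennreal k * (\<integral>\<^sup>+ y. f y \<partial>gamma_dist (k + 1))"
    using k by (subst nn_integral_cmult) (auto simp: nn_integral_gamma_dist)
  finally show ?thesis .
qed

text \<open>Tilting by \<open>exp (- s y)\<close> only changes the scale of a Gamma variable. With
  the same \<open>s\<close> in all coordinates it leaves normalized proportions alone, which is what
  makes it usable for the Dirichlet law.\<close>

lemma gamma_dist_exp_tilt:
  assumes k: "0 \<le> k" and s: "0 \<le> s" and [measurable]: "f \<in> borel_measurable borel"
  shows "(\<integral>\<^sup>+ y. ennreal (exp (- (s * y))) * f y \<partial>gamma_dist k)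
    = ennreal ((1 + s) powr (- k)) * (\<integral>\<^sup>+ y. f (y / (1 + s)) \<partial>gamma_dist k)"
proof (cases "k = 0")
  case True
  with s show ?thesis by (simp add: nn_integral_gamma_dist_0)
next
  case False
  with k have k: "0 < k" by simp
  let ?d = "\<lambda>y. ennreal (if 0 < y then y powr (k - 1) * exp (- y) / Gamma k else 0)"
  have tilt_cancel: "(1 + s) * z / (1 + s) = z" for z using s by simp
  have "(\<integral>\<^sup>+ y. f (y / (1 + s)) \<partial>gamma_dist k) = (\<integral>\<^sup>+ y. ?d y * f (y / (1 + s)) \<partial>lborel)"
    by (rule nn_integral_gamma_dist[OF k]) measurable
  also have "\<dots> = ennreal (1 + s) * (\<integral>\<^sup>+ z. ?d ((1 + s) * z) * f z \<partial>lborel)"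
    by (subst nn_integral_real_affine[where c="1 + s" and t=0]) (use s in \<open>simp_all only: add_0 abs_of_nonneg add_nonneg_nonneg zero_le_one tilt_cancel, measurable\<close>)
  finally have "ennreal ((1 + s) powr (- k)) * (\<integral>\<^sup>+ y. f (y / (1 + s)) \<partial>gamma_dist k)
     = (\<integral>\<^sup>+ z. ennreal ((1 + s) powr (- k)) * (ennreal (1 + s) * (?d ((1 + s) * z) * f z)) \<partial>lborel)"
    by (simp add: nn_integral_cmult)
  also have "\<dots> = (\<integral>\<^sup>+ z. ?d z * (ennreal (exp (- (s * z))) * f z) \<partial>lborel)"
  proof (rule nn_integral_cong)
    fix z :: real
    show "ennreal ((1 + s) powr (- k)) * (ennreal (1 + s) * (?d ((1 + s) * z) * f z))
        = ?d z * (ennreal (exp (- (s * z))) * f z)"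
    proof (cases "0 < z")
      case True
      have G: "Gamma k > 0" using k by (rule Gamma_real_pos)
      have "(1 + s) powr - k * ((1 + s) * ((1 + s) * z) powr (k - 1)) = z powr (k - 1)"
      proof -
        have "(1 + s) powr - k * ((1 + s) * ((1 + s) * z) powr (k - 1))
          = (1 + s) powr - k * ((1 + s) * (1 + s) powr (k - 1)) * z powr (k - 1)"
          using True s by (simp add: powr_mult mult_ac)
        also have "(1 + s) * (1 + s) powr (k - 1) = (1 + s) powr k"
          using s by (subst powr_mult_base) auto
        finally show ?thesis using s by (simp flip: powr_add)
      qed
      moreover have "exp (- ((1 + s) * z)) = exp (- z) * exp (- (s * z))"
        by (simp add: field_simps flip: exp_add)
      moreover have "(1 + s) powr - k * ((1 + s) * (((1 + s) * z) powr (k - 1) * exp (- ((1 + s) * z)) / Gamma k))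
        = (1 + s) powr - k * ((1 + s) * ((1 + s) * z) powr (k - 1)) * (exp (- ((1 + s) * z)) / Gamma k)"
        by (simp only: mult.assoc times_divide_eq_right)
      ultimately have eq: "(1 + s) powr - k * ((1 + s) * (((1 + s) * z) powr (k - 1) * exp (- ((1 + s) * z)) / Gamma k))
        = z powr (k - 1) * exp (- z) / Gamma k * exp (- (s * z))"
        by simp
      have "ennreal ((1 + s) powr (- k)) * (ennreal (1 + s) * ennreal (((1 + s) * z) powr (k - 1) * exp (- ((1 + s) * z)) / Gamma k))
        = ennreal (z powr (k - 1) * exp (- z) / Gamma k) * ennreal (exp (- (s * z)))"
      proof -
        have "ennreal a * (ennreal b * ennreal c) = ennreal d * ennreal e"
          if "a * (b * c) = d * e" "0 \<le> a" "0 \<le> b" "0 \<le> c" "0 \<le> d" "0 \<le> e" for a b c d e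
          using that by (simp flip: ennreal_mult)
        from this[OF eq] show ?thesis using G s by simp
      qed
      moreover have "0 < (1 + s) * z" using True s by simp
      ultimately show ?thesis using True by (simp only: if_True flip: mult.assoc)
    next
      case False
      with s have "\<not> 0 < (1 + s) * z" by (simp add: zero_less_mult_iff)
      with False show ?thesis by simp
    qed
  qed
  also have "\<dots> = (\<integral>\<^sup>+ y. ennreal (exp (- (s * y))) * f y \<partial>gamma_dist k)"
    by (rule nn_integral_gamma_dist[OF k, symmetric]) measurable
  finally show ?thesis by simp
qed

lemma nn_integral_exp_lborel:
  assumes "0 < S"
  shows "(\<integral>\<^sup>+ s. ennreal (exp (- (s * S))) * indicator {0..} s \<partial>lborel) = ennreal (1 / S)"
proof -
  have "(\<integral>\<^sup>+ s. ennreal (exp (- (s * S))) * indicator {0..} s \<partial>lborel) = ennreal (0 - (- exp (- (0 * S)) / S))"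
  proof (rule nn_integral_FTC_atLeast)
    show "((\<lambda>x. - exp (- (x * S)) / S) \<longlongrightarrow> 0) at_top"
      using assms by real_asymp
  qed (use assms in \<open>auto intro!: derivative_eq_intros\<close>)
  then show ?thesis by simp
qed

text \<open>Produces the normalization \<open>1 / sum \<alpha> UNIV\<close> of the size-biased
  Dirichlet law: size biasing raises the total parameter to \<open>b + 1\<close>, and tilting then
  contributes \<open>(1 + s) powr (- (b + 1))\<close>.\<close>

lemma nn_integral_powr_lborel:
  assumes "0 < b"
  shows "(\<integral>\<^sup>+ s. ennreal ((1 + s) powr (- (b + 1))) * indicator {0..} s \<partial>lborel) = ennreal (1 / b)"
proof -
  have "(\<integral>\<^sup>+ s. ennreal ((1 + s) powr (- (b + 1))) * indicator {0..} s \<partial>lborel)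
    = ennreal (0 - (- ((1 + 0) powr (- b)) / b))"
  proof (rule nn_integral_FTC_atLeast)
    show "((\<lambda>x. - ((1 + x) powr (- b)) / b) \<longlongrightarrow> 0) at_top"
      using assms by real_asymp
    show "((\<lambda>x. - ((1 + x) powr (- b)) / b) has_real_derivative (1 + x) powr (- (b + 1))) (at x)"
      if "0 \<le> x" for x
      using assms that
      by (auto intro!: derivative_eq_intros arg_cong[where f="\<lambda>p. (1 + x) powr p"])
  qed auto
  then show ?thesis using assms by simp
qed

section \<open>Products of Gamma laws\<close>

abbreviation gamma_prod :: "('o::finite \<Rightarrow> real) \<Rightarrow> ('o \<Rightarrow> real) measure" where
  "gamma_prod \<alpha> \<equiv> PiM UNIV (\<lambda>w. gamma_dist (\<alpha> w))"

lemma product_sigma_finite_gamma: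
  assumes "\<And>w. 0 \<le> \<alpha> w"
  shows "product_sigma_finite (\<lambda>w. gamma_dist (\<alpha> w))"
  by (intro product_sigma_finite.intro prob_space_imp_sigma_finite prob_space_gamma_dist assms)

lemma sets_gamma_prod [measurable_cong]:
  "sets (PiM I (\<lambda>w. gamma_dist (\<alpha> w))) = sets (PiM I (\<lambda>_. borel))"
  by (intro sets_PiM_cong) auto

lemma gamma_prod_tilt:
  assumes "\<And>w. 0 \<le> \<alpha> w" "0 \<le> s" "finite I" and f: "f \<in> borel_measurable (PiM I (\<lambda>_. borel))"
  shows "(\<integral>\<^sup>+ g. ennreal (exp (- (s * (\<Sum>w\<in>I. g w)))) * f g \<partial>PiM I (\<lambda>w. gamma_dist (\<alpha> w)))
    = ennreal ((1 + s) powr (- (\<Sum>w\<in>I. \<alpha> w)))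
      * (\<integral>\<^sup>+ g. f (\<lambda>w\<in>I. g w / (1 + s)) \<partial>PiM I (\<lambda>w. gamma_dist (\<alpha> w)))"
  using assms(3) f
proof (induction I arbitrary: f)
  case empty
  show ?case using assms(2) by (simp add: PiM_empty nn_integral_count_space_finite)
next
  case (insert i I)
  interpret product_sigma_finite "\<lambda>w. gamma_dist (\<alpha> w)"
    by (rule product_sigma_finite_gamma[OF assms(1)])
  note [measurable] = insert.prems
  let ?M = "\<lambda>I. PiM I (\<lambda>w. gamma_dist (\<alpha> w))"
  have m: "(\<lambda>y. f (x(i := y))) \<in> borel_measurable borel" if "x \<in> space (?M I)" for x
    using that insert.prems
    by (intro measurable_compose[OF _ insert.prems]) (rule measurable_fun_upd[where J=I], use that in \<open>auto simp: space_PiM intro!: measurable_const\<close>)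
  have m2: "(\<lambda>x. \<integral>\<^sup>+ y. f (x(i := y / (1 + s))) \<partial>gamma_dist (\<alpha> i)) \<in> borel_measurable (PiM I (\<lambda>_. borel))"
  proof -
    interpret sigma_finite_measure "gamma_dist (\<alpha> i)" by (rule sigma_finite_measures)
    have [measurable]: "(\<lambda>(x, y). x(i := y / (1 + s))) \<in> measurable (PiM I (\<lambda>_. borel) \<Otimes>\<^sub>M gamma_dist (\<alpha> i)) (PiM (insert i I) (\<lambda>_. borel))"
      unfolding split_beta by (rule measurable_fun_upd[where J=I]) auto
    show ?thesis by measurable
  qed
  have ext: "(\<lambda>w\<in>insert i I. (x(i := y)) w / (1 + s)) = (\<lambda>w\<in>I. x w / (1 + s))(i := y / (1 + s))" for x y
    using insert.hyps by (auto simp: fun_eq_iff)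
  have "(\<integral>\<^sup>+ g. ennreal (exp (- (s * (\<Sum>w\<in>insert i I. g w)))) * f g \<partial>?M (insert i I))
    = (\<integral>\<^sup>+ x. \<integral>\<^sup>+ y. ennreal (exp (- (s * (\<Sum>w\<in>insert i I. (x(i := y)) w)))) * f (x(i := y)) \<partial>gamma_dist (\<alpha> i) \<partial>?M I)"
    using insert.hyps by (intro product_nn_integral_insert) auto
  also have "\<dots> = (\<integral>\<^sup>+ x. ennreal (exp (- (s * (\<Sum>w\<in>I. x w)))) *
      (\<integral>\<^sup>+ y. ennreal (exp (- (s * y))) * f (x(i := y)) \<partial>gamma_dist (\<alpha> i)) \<partial>?M I)"
  proof (rule nn_integral_cong)
    fix x assume x: "x \<in> space (?M I)"
    have "(\<Sum>w\<in>insert i I. (x(i := y)) w) = y + (\<Sum>w\<in>I. x w)" for y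
      using insert.hyps by (auto intro!: sum.cong)
    then have e: "ennreal (exp (- (s * (\<Sum>w\<in>insert i I. (x(i := y)) w))))
        = ennreal (exp (- (s * (\<Sum>w\<in>I. x w)))) * ennreal (exp (- (s * y)))" for y
      by (simp add: ennreal_mult[symmetric] algebra_simps flip: exp_add)
    show "(\<integral>\<^sup>+ y. ennreal (exp (- (s * (\<Sum>w\<in>insert i I. (x(i := y)) w)))) * f (x(i := y)) \<partial>gamma_dist (\<alpha> i))
       = ennreal (exp (- (s * (\<Sum>w\<in>I. x w)))) *
      (\<integral>\<^sup>+ y. ennreal (exp (- (s * y))) * f (x(i := y)) \<partial>gamma_dist (\<alpha> i))"
      unfolding e mult.assoc using m[OF x] by (intro nn_integral_cmult) auto
  qed
  also have "\<dots> = (\<integral>\<^sup>+ x. ennreal (exp (- (s * (\<Sum>w\<in>I. x w)))) *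
      (ennreal ((1 + s) powr (- \<alpha> i)) * (\<integral>\<^sup>+ y. f (x(i := y / (1 + s))) \<partial>gamma_dist (\<alpha> i))) \<partial>?M I)"
    using m by (intro nn_integral_cong, subst gamma_dist_exp_tilt) (use assms in auto)
  also have "\<dots> = ennreal ((1 + s) powr (- \<alpha> i)) * (\<integral>\<^sup>+ x. ennreal (exp (- (s * (\<Sum>w\<in>I. x w)))) *
      (\<integral>\<^sup>+ y. f (x(i := y / (1 + s))) \<partial>gamma_dist (\<alpha> i)) \<partial>?M I)"
    using m2 by (subst nn_integral_cmult[symmetric]) (auto simp: mult_ac)
  also have "\<dots> = ennreal ((1 + s) powr (- \<alpha> i)) * (ennreal ((1 + s) powr (- (\<Sum>w\<in>I. \<alpha> w))) *
      (\<integral>\<^sup>+ x. (\<integral>\<^sup>+ y. f ((\<lambda>w\<in>I. x w / (1 + s))(i := y / (1 + s))) \<partial>gamma_dist (\<alpha> i)) \<partial>?M I))"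
    using m2 by (subst insert.IH) auto
  also have "(\<integral>\<^sup>+ x. (\<integral>\<^sup>+ y. f ((\<lambda>w\<in>I. x w / (1 + s))(i := y / (1 + s))) \<partial>gamma_dist (\<alpha> i)) \<partial>?M I)
     = (\<integral>\<^sup>+ x. (\<integral>\<^sup>+ y. f (\<lambda>w\<in>insert i I. (x(i := y)) w / (1 + s)) \<partial>gamma_dist (\<alpha> i)) \<partial>?M I)"
    by (simp only: ext)
  also have "\<dots> = (\<integral>\<^sup>+ g. f (\<lambda>w\<in>insert i I. g w / (1 + s)) \<partial>?M (insert i I))"
    using insert.hyps by (intro product_nn_integral_insert[symmetric]) auto
  also have "ennreal ((1 + s) powr (- \<alpha> i)) * (ennreal ((1 + s) powr (- (\<Sum>w\<in>I. \<alpha> w))) * Z)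
    = ennreal ((1 + s) powr (- (\<Sum>w\<in>insert i I. \<alpha> w))) * Z" for Z
    using insert.hyps by (simp add: ennreal_mult[symmetric] flip: mult.assoc powr_add)
  finally show ?case .
qed

lemma gamma_prod_size_bias:
  fixes \<alpha> :: "'o::finite \<Rightarrow> real"
  assumes "\<And>w. 0 \<le> \<alpha> w" and f [measurable]: "f \<in> borel_measurable (PiM UNIV (\<lambda>_. borel))"
  shows "(\<integral>\<^sup>+ g. ennreal (g w) * f g \<partial>gamma_prod \<alpha>)
    = ennreal (\<alpha> w) * (\<integral>\<^sup>+ g. f g \<partial>gamma_prod (\<alpha>(w := \<alpha> w + 1)))"
proof -
  interpret A: product_sigma_finite "\<lambda>w. gamma_dist (\<alpha> w)"
    by (rule product_sigma_finite_gamma[OF assms(1)])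
  interpret B: product_sigma_finite "\<lambda>v. gamma_dist ((\<alpha>(w := \<alpha> w + 1)) v)"
    by (rule product_sigma_finite_gamma) (use assms(1) in \<open>auto simp: add_nonneg_nonneg\<close>)
  define I where "I = - {w}"
  have I: "insert w I = UNIV" "w \<notin> I" "finite I" by (auto simp: I_def)
  have f': "f \<in> borel_measurable (PiM (insert w I) (\<lambda>_. borel))" using f by (simp add: I)
  have m: "(\<lambda>y. f (x(w := y))) \<in> borel_measurable borel" if "x \<in> space (PiM I (\<lambda>w. gamma_dist (\<alpha> w)))" for x
    using that by (intro measurable_compose[OF _ f']) (rule measurable_fun_upd[where J=I], use that in \<open>auto simp: space_PiM intro!: measurable_const\<close>)
  have eqI: "PiM I (\<lambda>v. gamma_dist ((\<alpha>(w := \<alpha> w + 1)) v)) = PiM I (\<lambda>w. gamma_dist (\<alpha> w))"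
    by (intro PiM_cong) (auto simp: I_def)
  have m2: "(\<lambda>x. \<integral>\<^sup>+ y. f (x(w := y)) \<partial>gamma_dist (\<alpha> w + 1)) \<in> borel_measurable (PiM I (\<lambda>w. gamma_dist (\<alpha> w)))"
  proof -
    interpret sigma_finite_measure "gamma_dist (\<alpha> w + 1)"
      by (intro prob_space_imp_sigma_finite prob_space_gamma_dist) (use assms(1)[of w] in simp)
    have "(\<lambda>(x, y). f (x(w := y))) \<in> borel_measurable (PiM I (\<lambda>w. gamma_dist (\<alpha> w)) \<Otimes>\<^sub>M gamma_dist (\<alpha> w + 1))"
      unfolding split_beta
      by (rule measurable_compose[OF _ f'], rule measurable_fun_upd[where J=I]) auto
    then show ?thesis by measurable
  qed
  have "(\<integral>\<^sup>+ g. ennreal (g w) * f g \<partial>gamma_prod \<alpha>)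
      = (\<integral>\<^sup>+ x. \<integral>\<^sup>+ y. ennreal ((x(w := y)) w) * f (x(w := y)) \<partial>gamma_dist (\<alpha> w) \<partial>PiM I (\<lambda>w. gamma_dist (\<alpha> w)))"
    using A.product_nn_integral_insert[OF I(3,2), of "\<lambda>g. ennreal (g w) * f g"] by (simp add: I)
  also have "\<dots> = (\<integral>\<^sup>+ x. ennreal (\<alpha> w) * (\<integral>\<^sup>+ y. f (x(w := y)) \<partial>gamma_dist (\<alpha> w + 1)) \<partial>PiM I (\<lambda>w. gamma_dist (\<alpha> w)))"
    using m assms(1) by (intro nn_integral_cong) (simp add: gamma_dist_size_bias)
  also have "\<dots> = ennreal (\<alpha> w) * (\<integral>\<^sup>+ x. (\<integral>\<^sup>+ y. f (x(w := y)) \<partial>gamma_dist (\<alpha> w + 1)) \<partial>PiM I (\<lambda>w. gamma_dist (\<alpha> w)))"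
    using m2 by (rule nn_integral_cmult)
  also have "(\<integral>\<^sup>+ x. (\<integral>\<^sup>+ y. f (x(w := y)) \<partial>gamma_dist (\<alpha> w + 1)) \<partial>PiM I (\<lambda>w. gamma_dist (\<alpha> w)))
     = (\<integral>\<^sup>+ g. f g \<partial>gamma_prod (\<alpha>(w := \<alpha> w + 1)))"
    using B.product_nn_integral_insert[OF I(3,2), of f] by (simp add: I eqI[simplified] cong: measurable_cong_sets)
  finally show ?thesis .
qed

lemma AE_gamma_dist_nonneg: "AE y in gamma_dist k. 0 \<le> y"
proof (cases "k = 0")
  case False
  then have "gamma_dist k = density lborel (\<lambda>y. ennreal (if 0 < y then y powr (k - 1) * exp (- y) / Gamma k else 0))"
    by (simp add: gamma_dist_def)
  then show ?thesis by (simp only:) (subst AE_density, auto)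
next
  case True
  then have "gamma_dist k = return borel 0" by (simp add: gamma_dist_def)
  then show ?thesis by (simp only:) (subst AE_return, auto)
qed

lemma prob_space_gamma_prod:
  assumes "\<And>w. 0 \<le> \<alpha> w"
  shows "prob_space (gamma_prod \<alpha>)"
  by (intro prob_space_PiM prob_space_gamma_dist assms)

lemma AE_gamma_prod_nonneg:
  fixes \<alpha> :: "'o::finite \<Rightarrow> real"
  assumes "\<And>w. 0 \<le> \<alpha> w"
  shows "AE g in gamma_prod \<alpha>. \<forall>w. 0 \<le> g w"
proof -
  have "AE g in gamma_prod \<alpha>. 0 \<le> g w" for w
    by (intro AE_PiM_component[where P="\<lambda>y. 0 \<le> y"] prob_space_gamma_dist assms AE_gamma_dist_nonneg) auto
  then show ?thesis by (simp add: AE_all_countable)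
qed

section \<open>Size bias and support of the Dirichlet law\<close>

lemma sets_dirichlet [simp, measurable_cong]:
  "sets (dirichlet (\<alpha> :: 'o::finite \<Rightarrow> real)) = sets (PiM UNIV (\<lambda>_::'o. borel))"
  by (simp add: dirichlet_def)

lemma space_dirichlet [simp]: "space (dirichlet \<alpha>) = UNIV"
  by (simp add: dirichlet_def space_PiM)

definition normalize_sum :: "('o::finite \<Rightarrow> real) \<Rightarrow> 'o \<Rightarrow> real" where
  "normalize_sum g = (\<lambda>w. g w / (\<Sum>w'\<in>UNIV. g w'))"

lemma measurable_normalize_sum [measurable]:
  "normalize_sum \<in> measurable (PiM UNIV (\<lambda>_::'o::finite. borel)) (PiM UNIV (\<lambda>_. borel))"
  unfolding normalize_sum_def by (rule measurable_PiM_single') auto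

lemma normalize_sum_scale: "c \<noteq> 0 \<Longrightarrow> normalize_sum (\<lambda>w. g w / c) = normalize_sum g"
  by (auto simp: normalize_sum_def fun_eq_iff simp flip: sum_divide_distrib)

lemma dirichlet_eq_distr: "dirichlet \<alpha> = distr (gamma_prod \<alpha>) (PiM UNIV (\<lambda>_. borel)) normalize_sum"
  by (simp add: dirichlet_def normalize_sum_def[abs_def])

lemma nn_integral_dirichlet:
  assumes [measurable]: "f \<in> borel_measurable (PiM UNIV (\<lambda>_. borel))"
  shows "(\<integral>\<^sup>+ p. f p \<partial>dirichlet \<alpha>) = (\<integral>\<^sup>+ g. f (normalize_sum g) \<partial>gamma_prod \<alpha>)"
  by (simp add: dirichlet_eq_distr nn_integral_distr)

lemma prob_space_dirichlet:
  assumes "\<And>w. 0 \<le> \<alpha> w"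
  shows "prob_space (dirichlet \<alpha>)"
  unfolding dirichlet_eq_distr
  by (intro prob_space.prob_space_distr prob_space_gamma_prod assms) measurable

text \<open>Writing \<open>1 / S\<close> as \<open>\<integral> exp (- s S) ds\<close> decouples the total mass \<open>S\<close> of the Gamma variables from
  their proportions, so no change of variables on the simplex is needed.\<close>
lemma dirichlet_size_bias:
  fixes \<alpha> :: "'o::finite \<Rightarrow> real"
  assumes \<alpha>: "\<And>w. 0 \<le> \<alpha> w" and b: "0 < sum \<alpha> UNIV"
    and [measurable]: "f \<in> borel_measurable (PiM UNIV (\<lambda>_. borel))"
  shows "(\<integral>\<^sup>+ p. ennreal (p w) * f p \<partial>dirichlet \<alpha>)
    = ennreal (\<alpha> w / sum \<alpha> UNIV) * (\<integral>\<^sup>+ p. f p \<partial>dirichlet (\<alpha>(w := \<alpha> w + 1)))"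
proof -
  let ?\<alpha>' = "\<alpha>(w := \<alpha> w + 1)"
  let ?S = "\<lambda>g. \<Sum>v\<in>UNIV. g v :: real"
  have \<alpha>': "0 \<le> ?\<alpha>' v" for v using \<alpha> by (simp add: add_nonneg_nonneg)
  have sum\<alpha>': "sum ?\<alpha>' UNIV = sum \<alpha> UNIV + 1"
    by (simp add: sum.remove[of UNIV w])
  interpret G: prob_space "gamma_prod \<alpha>" by (rule prob_space_gamma_prod[OF \<alpha>])
  interpret pair_sigma_finite "gamma_prod \<alpha>" lborel by unfold_locales
  have "(\<integral>\<^sup>+ p. ennreal (p w) * f p \<partial>dirichlet \<alpha>)
      = (\<integral>\<^sup>+ g. ennreal (normalize_sum g w) * f (normalize_sum g) \<partial>gamma_prod \<alpha>)"
    by (rule nn_integral_dirichlet) measurable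
  also have "\<dots> = (\<integral>\<^sup>+ g. (\<integral>\<^sup>+ s. indicator {0..} s * (ennreal (g w) * (ennreal (exp (- (s * ?S g))) * f (normalize_sum g))) \<partial>lborel) \<partial>gamma_prod \<alpha>)"
  proof (rule nn_integral_cong_AE, rule AE_mp[OF AE_gamma_prod_nonneg[OF \<alpha>]], rule AE_I2, rule impI)
    fix g :: "'o \<Rightarrow> real" assume g: "\<forall>v. 0 \<le> g v"
    have "(\<integral>\<^sup>+ s. indicator {0..} s * (ennreal (g w) * (ennreal (exp (- (s * ?S g))) * f (normalize_sum g))) \<partial>lborel)
      = (\<integral>\<^sup>+ s. (ennreal (g w) * f (normalize_sum g)) * (ennreal (exp (- (s * ?S g))) * indicator {0..} s) \<partial>lborel)"
      by (simp add: mult_ac)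
    also have "\<dots> = (ennreal (g w) * f (normalize_sum g)) * (\<integral>\<^sup>+ s. ennreal (exp (- (s * ?S g))) * indicator {0..} s \<partial>lborel)"
      by (rule nn_integral_cmult) measurable
    also have "\<dots> = ennreal (normalize_sum g w) * f (normalize_sum g)"
    proof (cases "?S g = 0")
      \<comment> \<open>Here the integral over \<open>s\<close> is infinite, but it is multiplied by
        \<open>g w = 0\<close>; this agrees with the convention \<open>x / 0 = 0\<close> in
        \<open>normalize_sum\<close>.\<close>
      case True
      with g have "g w = 0" by (simp add: sum_nonneg_eq_0_iff)
      then show ?thesis by (simp add: normalize_sum_def)
    next
      case False
      with g have "0 < ?S g" by (simp add: order_less_le sum_nonneg)
      then have "(\<integral>\<^sup>+ s. ennreal (exp (- (s * ?S g))) * indicator {0..} s \<partial>lborel) = ennreal (1 / ?S g)"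
        by (rule nn_integral_exp_lborel)
      moreover have "ennreal (normalize_sum g w) = ennreal (g w) * ennreal (1 / ?S g)"
        using g \<open>0 < ?S g\<close> by (simp add: normalize_sum_def flip: ennreal_mult)
      ultimately show ?thesis by (simp only: mult_ac)
    qed
    finally show "ennreal (normalize_sum g w) * f (normalize_sum g)
      = (\<integral>\<^sup>+ s. indicator {0..} s * (ennreal (g w) * (ennreal (exp (- (s * ?S g))) * f (normalize_sum g))) \<partial>lborel)" ..
  qed
  also have "\<dots> = (\<integral>\<^sup>+ s. (\<integral>\<^sup>+ g. indicator {0..} s * (ennreal (g w) * (ennreal (exp (- (s * ?S g))) * f (normalize_sum g))) \<partial>gamma_prod \<alpha>) \<partial>lborel)"
    by (rule Fubini'[symmetric]) measurable
  also have "\<dots> = (\<integral>\<^sup>+ s. (ennreal (\<alpha> w) * (\<integral>\<^sup>+ p. f p \<partial>dirichlet ?\<alpha>')) *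
      (ennreal ((1 + s) powr (- (sum \<alpha> UNIV + 1))) * indicator {0..} s) \<partial>lborel)"
  proof (rule nn_integral_cong)
    fix s :: real
    show "(\<integral>\<^sup>+ g. indicator {0..} s * (ennreal (g w) * (ennreal (exp (- (s * ?S g))) * f (normalize_sum g))) \<partial>gamma_prod \<alpha>)
      = (ennreal (\<alpha> w) * (\<integral>\<^sup>+ p. f p \<partial>dirichlet ?\<alpha>')) *
      (ennreal ((1 + s) powr (- (sum \<alpha> UNIV + 1))) * indicator {0..} s)"
    proof (cases "0 \<le> s")
      case True
      have "(\<integral>\<^sup>+ g. ennreal (g w) * (ennreal (exp (- (s * ?S g))) * f (normalize_sum g)) \<partial>gamma_prod \<alpha>)
        = ennreal (\<alpha> w) * (\<integral>\<^sup>+ g. ennreal (exp (- (s * ?S g))) * f (normalize_sum g) \<partial>gamma_prod ?\<alpha>')"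
        by (rule gamma_prod_size_bias[OF \<alpha>]) measurable
      also have "(\<integral>\<^sup>+ g. ennreal (exp (- (s * ?S g))) * f (normalize_sum g) \<partial>gamma_prod ?\<alpha>')
        = ennreal ((1 + s) powr (- sum ?\<alpha>' UNIV)) * (\<integral>\<^sup>+ g. f (normalize_sum (\<lambda>w\<in>UNIV. g w / (1 + s))) \<partial>gamma_prod ?\<alpha>')"
        by (rule gamma_prod_tilt[OF \<alpha>' True]) (simp, measurable)
      also have "(\<integral>\<^sup>+ g. f (normalize_sum (\<lambda>w\<in>UNIV. g w / (1 + s))) \<partial>gamma_prod ?\<alpha>') = (\<integral>\<^sup>+ p. f p \<partial>dirichlet ?\<alpha>')"
        using True by (subst nn_integral_dirichlet) (simp_all add: normalize_sum_scale restrict_UNIV)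
      finally show ?thesis using True by (simp add: sum\<alpha>' mult_ac del: fun_upd_apply)
    next
      case False
      then show ?thesis by simp
    qed
  qed
  also have "\<dots> = (ennreal (\<alpha> w) * (\<integral>\<^sup>+ p. f p \<partial>dirichlet ?\<alpha>')) * ennreal (1 / sum \<alpha> UNIV)"
    using b by (subst nn_integral_cmult) (simp_all only: nn_integral_powr_lborel, measurable)
  also have "\<dots> = ennreal (\<alpha> w / sum \<alpha> UNIV) * (\<integral>\<^sup>+ p. f p \<partial>dirichlet ?\<alpha>')"
    using \<alpha> b by (simp add: divide_inverse ennreal_mult mult_ac)
  finally show ?thesis .
qed

text \<open>That the total Gamma mass is almost surely nonzero follows from size bias itself: the
  proportions sum to the indicator of a nonzero total, while their expectations
  \<open>\<alpha> w / sum \<alpha> UNIV\<close> sum to one.\<close>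

lemma AE_dirichlet_simplex:
  fixes \<alpha> :: "'o::finite \<Rightarrow> real"
  assumes \<alpha>: "\<And>w. 0 \<le> \<alpha> w" and b: "0 < sum \<alpha> UNIV"
  shows "AE p in dirichlet \<alpha>. (\<forall>w. 0 \<le> p w) \<and> sum p UNIV = 1"
proof -
  interpret G: prob_space "gamma_prod \<alpha>" by (rule prob_space_gamma_prod[OF \<alpha>])
  have sum_eq: "sum (normalize_sum g) UNIV = of_bool (sum g UNIV \<noteq> 0)" for g :: "'o \<Rightarrow> real"
    by (auto simp: normalize_sum_def simp flip: sum_divide_distrib)
  have nonneg: "AE g in gamma_prod \<alpha>. \<forall>w. 0 \<le> normalize_sum g w"
    using AE_gamma_prod_nonneg[OF \<alpha>] by eventually_elim (auto simp: normalize_sum_def sum_nonneg)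
  have "emeasure (gamma_prod \<alpha>) {g \<in> space (gamma_prod \<alpha>). sum g UNIV \<noteq> 0}
      = (\<integral>\<^sup>+ g. indicator {g \<in> space (gamma_prod \<alpha>). sum g UNIV \<noteq> 0} g \<partial>gamma_prod \<alpha>)"
    by (rule nn_integral_indicator[symmetric]) measurable
  also have "\<dots> = (\<integral>\<^sup>+ g. (\<Sum>w\<in>UNIV. ennreal (normalize_sum g w)) \<partial>gamma_prod \<alpha>)"
    using nonneg by (intro nn_integral_cong_AE, eventually_elim) (simp add: sum_ennreal sum_eq indicator_def space_PiM)
  also have "\<dots> = (\<Sum>w\<in>UNIV. \<integral>\<^sup>+ g. ennreal (normalize_sum g w) \<partial>gamma_prod \<alpha>)"
    by (rule nn_integral_sum) measurable
  also have "\<dots> = (\<Sum>w\<in>UNIV. ennreal (\<alpha> w / sum \<alpha> UNIV))"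
  proof (rule sum.cong[OF refl])
    fix w
    interpret D: prob_space "dirichlet (\<alpha>(w := \<alpha> w + 1))"
      by (rule prob_space_dirichlet) (use \<alpha> in \<open>simp add: add_nonneg_nonneg\<close>)
    have "(\<integral>\<^sup>+ g. ennreal (normalize_sum g w) \<partial>gamma_prod \<alpha>) = (\<integral>\<^sup>+ p. ennreal (p w) * 1 \<partial>dirichlet \<alpha>)"
      by (subst nn_integral_dirichlet) auto
    also have "\<dots> = ennreal (\<alpha> w / sum \<alpha> UNIV)"
      by (subst dirichlet_size_bias[OF assms]) (auto simp: D.emeasure_space_1[simplified])
    finally show "(\<integral>\<^sup>+ g. ennreal (normalize_sum g w) \<partial>gamma_prod \<alpha>) = ennreal (\<alpha> w / sum \<alpha> UNIV)" .
  qed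
  also have "\<dots> = 1"
    using \<alpha> b by (simp add: sum_ennreal less_imp_le flip: sum_divide_distrib)
  finally have "AE g in gamma_prod \<alpha>. sum g UNIV \<noteq> 0"
    by (intro G.AE_I_eq_1) measurable
  with nonneg have "AE g in gamma_prod \<alpha>. (\<forall>w. 0 \<le> normalize_sum g w) \<and> sum (normalize_sum g) UNIV = 1"
    by eventually_elim (simp add: sum_eq)
  then show ?thesis
    unfolding dirichlet_eq_distr by (subst AE_distr_iff) (auto simp: measurable_cong_sets[OF sets_gamma_prod refl])
qed

text \<open>Size bias as a change of density, which carries it from nonnegative to real integrands.
  If \<open>\<alpha> w = 0\<close> there is no such density; then \<open>p w\<close> vanishes almost
  surely and the integral version treats the case directly.\<close>

lemma dirichlet_eq_density:
  fixes \<alpha> :: "'o::finite \<Rightarrow> real"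
  assumes \<alpha>: "\<And>w. 0 \<le> \<alpha> w" and w: "0 < \<alpha> w"
  shows "dirichlet (\<alpha>(w := \<alpha> w + 1)) = density (dirichlet \<alpha>) (\<lambda>p. ennreal (sum \<alpha> UNIV / \<alpha> w * p w))"
proof (rule measure_eqI)
  have b: "0 < sum \<alpha> UNIV" using \<alpha> w by (meson UNIV_I finite_class.finite_UNIV sum_pos2)
  fix A assume "A \<in> sets (dirichlet (\<alpha>(w := \<alpha> w + 1)))"
  then have [measurable]: "A \<in> sets (PiM UNIV (\<lambda>_. borel))" by simp
  have "emeasure (density (dirichlet \<alpha>) (\<lambda>p. ennreal (sum \<alpha> UNIV / \<alpha> w * p w))) A
    = (\<integral>\<^sup>+ p. ennreal (sum \<alpha> UNIV / \<alpha> w) * (ennreal (p w) * indicator A p) \<partial>dirichlet \<alpha>)"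
  proof -
    have "0 \<le> sum \<alpha> UNIV / \<alpha> w" using b w by simp
    note e = ennreal_mult'[OF this]
    show ?thesis by (subst emeasure_density) (auto simp only: e mult.assoc sets_dirichlet cong: nn_integral_cong, measurable)
  qed
  also have "\<dots> = ennreal (sum \<alpha> UNIV / \<alpha> w) * (\<integral>\<^sup>+ p. ennreal (p w) * indicator A p \<partial>dirichlet \<alpha>)"
    by (rule nn_integral_cmult) measurable
  also have "\<dots> = (ennreal (sum \<alpha> UNIV / \<alpha> w) * ennreal (\<alpha> w / sum \<alpha> UNIV)) * emeasure (dirichlet (\<alpha>(w := \<alpha> w + 1))) A"
    by (subst dirichlet_size_bias[OF \<alpha> b]) (auto simp: mult.assoc)
  also have "ennreal (sum \<alpha> UNIV / \<alpha> w) * ennreal (\<alpha> w / sum \<alpha> UNIV) = 1"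
    using b w by (simp flip: ennreal_mult)
  finally show "emeasure (dirichlet (\<alpha>(w := \<alpha> w + 1))) A
     = emeasure (density (dirichlet \<alpha>) (\<lambda>p. ennreal (sum \<alpha> UNIV / \<alpha> w * p w))) A"
    unfolding mult_1 by (rule sym)
qed simp

lemma integral_dirichlet_size_bias:
  fixes \<alpha> :: "'o::finite \<Rightarrow> real" and f :: "('o \<Rightarrow> real) \<Rightarrow> real"
  assumes \<alpha>: "\<And>w. 0 \<le> \<alpha> w" and b: "0 < sum \<alpha> UNIV"
    and [measurable]: "f \<in> borel_measurable (PiM UNIV (\<lambda>_. borel))"
  shows "(\<integral>p. p w * f p \<partial>dirichlet \<alpha>) = \<alpha> w / sum \<alpha> UNIV * (\<integral>p. f p \<partial>dirichlet (\<alpha>(w := \<alpha> w + 1)))"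
proof (cases "\<alpha> w = 0")
  case True
  have "(\<integral>\<^sup>+ p. ennreal (p w) * 1 \<partial>dirichlet \<alpha>) = 0"
    by (subst dirichlet_size_bias[OF \<alpha> b]) (auto simp: True)
  then have "AE p in dirichlet \<alpha>. ennreal (p w) = 0"
    by (subst (asm) nn_integral_0_iff_AE) auto
  with AE_dirichlet_simplex[OF \<alpha> b] have "AE p in dirichlet \<alpha>. p w * f p = 0"
    by eventually_elim (auto simp: ennreal_eq_0_iff intro: antisym)
  then show ?thesis using True by (simp add: integral_eq_zero_AE)
next
  case False
  then have w: "0 < \<alpha> w" using \<alpha>[of w] by simp
  have "(\<integral>p. f p \<partial>dirichlet (\<alpha>(w := \<alpha> w + 1))) = (\<integral>p. (sum \<alpha> UNIV / \<alpha> w * p w) *\<^sub>R f p \<partial>dirichlet \<alpha>)"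
    unfolding dirichlet_eq_density[of \<alpha> w, OF \<alpha> w] using AE_dirichlet_simplex[OF \<alpha> b]
    by (intro integral_density) (auto elim!: eventually_mono intro!: mult_nonneg_nonneg divide_nonneg_pos simp: b w less_imp_le)
  also have "\<dots> = (\<integral>p. (sum \<alpha> UNIV / \<alpha> w) * (p w * f p) \<partial>dirichlet \<alpha>)"
    by (simp add: mult.assoc)
  also have "\<dots> = (sum \<alpha> UNIV / \<alpha> w) * (\<integral>p. p w * f p \<partial>dirichlet \<alpha>)"
    by (rule integral_mult_right_zero)
  finally show ?thesis using b w by simp
qed

subsection \<open>Convex functions of Gaussian variables\<close>

abbreviation std_normal :: "real measure" where
  "std_normal \<equiv> density lborel (\<lambda>x. ennreal (std_normal_density x))"

interpretation std_normal: prob_space std_normal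
  by (rule prob_space_normal_density) simp

lemma integrable_std_normal_abs: "integrable std_normal (\<lambda>x. \<bar>x\<bar>)"
  using integrable_std_normal_moment_abs[of 1]
  by (subst integrable_density) (auto simp: normal_density_nonneg)

lemma integrable_std_normal_id: "integrable std_normal (\<lambda>x. x)"
  using integrable_std_normal_moment[of 1]
  by (subst integrable_density) (auto simp: normal_density_nonneg)

lemma integral_std_normal_abs: "(\<integral>x. \<bar>x\<bar> \<partial>std_normal) = sqrt (2 / pi)"
  using integral_std_normal_moment_abs_odd[of 0]
  by (subst integral_density) (auto simp: normal_density_nonneg)

lemma std_normal_uminus: "distr std_normal borel uminus = std_normal"
proof -
  have "distributed std_normal lborel (\<lambda>x. x) (normal_density 0 1)"
    by (auto simp: distributed_def distr_id2)
  from std_normal.normal_density_affine[OF this, of "-1" 0]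
  have "distr std_normal lborel (\<lambda>x. 0 + -1 * x) = density lborel (normal_density (0 + -1 * 0) (\<bar>-1\<bar> * 1))"
    by (intro distributed_distr_eq_density) auto
  moreover have "distr std_normal lborel (\<lambda>x. 0 + -1 * x) = distr std_normal borel uminus"
    by (intro distr_cong) auto
  ultimately show ?thesis by simp
qed

lemma integral_std_normal_uminus:
  fixes f :: "real \<Rightarrow> real"
  assumes "f \<in> borel_measurable borel"
  shows "(\<integral>x. f (- x) \<partial>std_normal) = (\<integral>x. f x \<partial>std_normal)"
  by (subst (2) std_normal_uminus[symmetric], subst integral_distr) (use assms in auto)

text \<open>The test functions of the convex order. The Lipschitz bound keeps all Gaussian integrals
  finite and controls the error of stopping the urn after finitely many draws.\<close>

definition cvx_lip :: "real \<Rightarrow> (real \<Rightarrow> real) \<Rightarrow> bool" where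
  "cvx_lip K u \<longleftrightarrow> convex_on UNIV u \<and> (\<forall>x y. \<bar>u x - u y\<bar> \<le> K * \<bar>x - y\<bar>)"

lemma cvx_lipD: "cvx_lip K u \<Longrightarrow> \<bar>u x - u y\<bar> \<le> K * \<bar>x - y\<bar>"
  by (simp add: cvx_lip_def)

lemma cvx_lip_convex: "cvx_lip K u \<Longrightarrow> 0 \<le> t \<Longrightarrow> t \<le> 1 \<Longrightarrow> u ((1 - t) * x + t * y) \<le> (1 - t) * u x + t * u y"
  unfolding cvx_lip_def using convex_onD[of UNIV u t x y] by simp

lemma cvx_lip_midpoint: "cvx_lip K u \<Longrightarrow> u x \<le> (u (x + d) + u (x - d)) / 2"
  using cvx_lip_convex[of K u "1/2" "x + d" "x - d"] by (simp add: field_simps)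

lemma cvx_lip_measurable:
  assumes "cvx_lip K u"
  shows "u \<in> borel_measurable borel"
proof -
  have "\<bar>u x - u y\<bar> \<le> \<bar>K\<bar> * \<bar>x - y\<bar>" for x y
    by (rule order_trans[OF cvx_lipD[OF assms]]) (intro mult_right_mono, auto)
  then have "\<bar>K\<bar>-lipschitz_on UNIV u"
    by (intro lipschitz_onI) (auto simp: dist_real_def)
  then show ?thesis
    by (intro borel_measurable_continuous_onI lipschitz_on_continuous_on)
qed

lemma cvx_lip_integrable:
  assumes "cvx_lip K u"
  shows "integrable std_normal (\<lambda>z. u (x + s * z))"
proof (rule Bochner_Integration.integrable_bound)
  show "integrable std_normal (\<lambda>z. \<bar>u x\<bar> + K * \<bar>s\<bar> * \<bar>z\<bar>)"
    by (intro Bochner_Integration.integrable_add integrable_mult_right integrable_std_normal_abs) auto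
  show "(\<lambda>z. u (x + s * z)) \<in> borel_measurable std_normal"
    using cvx_lip_measurable[OF assms] by measurable
  have "\<bar>u (x + s * z)\<bar> \<le> \<bar>u x\<bar> + K * \<bar>s\<bar> * \<bar>z\<bar>" for z
    using cvx_lipD[OF assms, of "x + s * z" x] by (simp add: abs_mult mult.assoc)
  then show "AE z in std_normal. norm (u (x + s * z)) \<le> norm (\<bar>u x\<bar> + K * \<bar>s\<bar> * \<bar>z\<bar>)"
    by (auto intro: order_trans[OF _ abs_ge_self])
qed

text \<open>The heat semigroup, parametrized by the standard deviation instead of time.\<close>

definition gauss_smooth :: "(real \<Rightarrow> real) \<Rightarrow> real \<Rightarrow> real \<Rightarrow> real" where
  "gauss_smooth u s x = (\<integral>z. u (x + s * z) \<partial>std_normal)"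

lemma gauss_smooth_0 [simp]: "gauss_smooth u 0 x = u x"
  by (simp add: gauss_smooth_def std_normal.prob_space[simplified])

lemma cvx_lip_gauss_smooth:
  assumes u: "cvx_lip K u"
  shows "cvx_lip K (gauss_smooth u s)"
  unfolding cvx_lip_def
proof (intro conjI allI)
  note int = cvx_lip_integrable[OF u]
  show "convex_on UNIV (gauss_smooth u s)"
  proof (rule convex_onI)
    fix t x y :: real assume t: "0 < t" "t < 1"
    have "gauss_smooth u s ((1 - t) *\<^sub>R x + t *\<^sub>R y)
        \<le> (\<integral>z. (1 - t) * u (x + s * z) + t * u (y + s * z) \<partial>std_normal)"
      unfolding gauss_smooth_def
    proof (rule integral_mono)
      fix z
      have "((1 - t) *\<^sub>R x + t *\<^sub>R y) + s * z = (1 - t) * (x + s * z) + t * (y + s * z)"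
        by (simp add: algebra_simps)
      then show "u (((1 - t) *\<^sub>R x + t *\<^sub>R y) + s * z) \<le> (1 - t) * u (x + s * z) + t * u (y + s * z)"
        using cvx_lip_convex[OF u, of t] t by simp
    qed (intro int Bochner_Integration.integrable_add integrable_mult_right)+
    also have "\<dots> = (1 - t) * gauss_smooth u s x + t * gauss_smooth u s y"
      unfolding gauss_smooth_def using int by (subst Bochner_Integration.integral_add) auto
    finally show "gauss_smooth u s ((1 - t) *\<^sub>R x + t *\<^sub>R y) \<le> (1 - t) * gauss_smooth u s x + t * gauss_smooth u s y" .
  qed simp
  fix x y
  have "\<bar>gauss_smooth u s x - gauss_smooth u s y\<bar> = \<bar>\<integral>z. u (x + s * z) - u (y + s * z) \<partial>std_normal\<bar>"
    unfolding gauss_smooth_def using int by (subst Bochner_Integration.integral_diff) auto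
  also have "\<dots> \<le> (\<integral>z. \<bar>u (x + s * z) - u (y + s * z)\<bar> \<partial>std_normal)"
    by (rule integral_abs_bound)
  also have "\<dots> \<le> (\<integral>z. K * \<bar>x - y\<bar> \<partial>std_normal)"
    using int cvx_lipD[OF u] by (intro integral_mono) (auto intro!: order_trans[OF cvx_lipD[OF u]])
  also have "\<dots> = K * \<bar>x - y\<bar>"
    using std_normal.prob_space by simp
  finally show "\<bar>gauss_smooth u s x - gauss_smooth u s y\<bar> \<le> K * \<bar>x - y\<bar>" .
qed

lemma distr_std_normal_scale:
  assumes "0 < a"
  shows "distr std_normal borel (\<lambda>z. a * z) = density lborel (normal_density 0 a)"
proof -
  have "distributed std_normal lborel (\<lambda>x. x) (normal_density 0 1)"
    by (auto simp: distributed_def distr_id2)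
  from std_normal.normal_density_affine[OF this, of a 0]
  have "distr std_normal lborel (\<lambda>x. 0 + a * x) = density lborel (normal_density (0 + a * 0) (\<bar>a\<bar> * 1))"
    using assms by (intro distributed_distr_eq_density) auto
  moreover have "distr std_normal lborel (\<lambda>x. 0 + a * x) = distr std_normal borel (\<lambda>z. a * z)"
    by (intro distr_cong) auto
  ultimately show ?thesis using assms by simp
qed

lemma gauss_smooth_eq_normal:
  assumes "0 < a" and u: "u \<in> borel_measurable borel"
  shows "gauss_smooth u a x = (\<integral>z. u (x + z) \<partial>density lborel (normal_density 0 a))"
  unfolding distr_std_normal_scale[OF assms(1), symmetric] gauss_smooth_def
  using u by (subst integral_distr) auto

lemma gauss_smooth_semigroup:
  assumes ab: "0 < a" "0 < b" and u: "cvx_lip K u"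
  shows "gauss_smooth (gauss_smooth u a) b x = gauss_smooth u (sqrt (a\<^sup>2 + b\<^sup>2)) x"
proof -
  define c where "c = sqrt (a\<^sup>2 + b\<^sup>2)"
  have c: "0 < c" using ab by (auto simp: c_def intro!: add_pos_pos)
  let ?N = "\<lambda>a. density lborel (\<lambda>x. ennreal (normal_density 0 a x))"
  interpret A: prob_space "?N a" by (rule prob_space_normal_density[OF ab(1)])
  interpret B: prob_space "?N b" by (rule prob_space_normal_density[OF ab(2)])
  interpret pair_sigma_finite "?N b" "?N a" by unfold_locales
  have um [measurable]: "u \<in> borel_measurable borel" by (rule cvx_lip_measurable[OF u])
  have conv: "distr (?N b \<Otimes>\<^sub>M ?N a) borel (\<lambda>(x, y). x + y) = ?N c"
  proof -
    have "?N b \<star> ?N a = density lborel (\<lambda>x. \<integral>\<^sup>+y. ennreal (normal_density 0 b (x - y)) * ennreal (normal_density 0 a y) \<partial>lborel)"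
      by (rule convolution_density) (auto intro: A.finite_measure_axioms B.finite_measure_axioms)
    also have "(\<lambda>x. \<integral>\<^sup>+y. ennreal (normal_density 0 b (x - y)) * ennreal (normal_density 0 a y) \<partial>lborel)
      = (\<lambda>x. \<integral>\<^sup>+y. ennreal (normal_density 0 b (x - y) * normal_density 0 a y) \<partial>lborel)"
      by (simp add: ennreal_mult normal_density_nonneg)
    also have "\<dots> = (\<lambda>x. ennreal (normal_density 0 c x))"
      using conv_normal_density_zero_mean[OF ab(2,1)] by (simp add: c_def add.commute)
    finally show ?thesis by (simp add: convolution_def)
  qed
  have "integrable (?N c) (\<lambda>z. u (x + z))"
    unfolding distr_std_normal_scale[OF c, symmetric]
    using cvx_lip_integrable[OF u, of x c] by (subst integrable_distr_eq) auto
  then have int: "integrable (?N b \<Otimes>\<^sub>M ?N a) (\<lambda>p. u (x + (fst p + snd p)))"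
    unfolding conv[symmetric] by (subst (asm) integrable_distr_eq) (auto simp: split_beta')
  have "gauss_smooth (gauss_smooth u a) b x = (\<integral>z. (\<integral>w. u (x + (z + w)) \<partial>?N a) \<partial>?N b)"
    using cvx_lip_measurable[OF cvx_lip_gauss_smooth[OF u]]
    by (simp add: gauss_smooth_eq_normal ab um add.assoc)
  also have "\<dots> = (\<integral>p. u (x + (fst p + snd p)) \<partial>(?N b \<Otimes>\<^sub>M ?N a))"
    using integral_fst'[OF int] by simp
  also have "\<dots> = (\<integral>z. u (x + z) \<partial>?N c)"
    unfolding conv[symmetric] by (subst integral_distr) (auto simp: split_beta')
  also have "\<dots> = gauss_smooth u c x" by (rule gauss_smooth_eq_normal[OF c um, symmetric])
  finally show ?thesis by (simp add: c_def)
qed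

text \<open>The symmetrization \<open>S\<close> of \<open>u\<close> about \<open>x\<close> is even
  and convex, so its supporting line at \<open>t0 = 1 / sqrt 2\<close> has nonnegative slope.
  Evaluated at \<open>\<bar>z\<bar>\<close>, the line gains on average because
  \<open>E \<bar>z\<bar> = sqrt (2 / pi)\<close> is at least \<open>1 / sqrt 2\<close>.\<close>

lemma gauss_smooth_ge_two_point:
  assumes u: "cvx_lip K u" and d: "0 \<le> d"
  shows "(u (x + d / sqrt 2) + u (x - d / sqrt 2)) / 2 \<le> gauss_smooth u d x"
proof -
  define S where "S t = (u (x + d * t) + u (x - d * t)) / 2" for t
  \<comment> \<open>Any point up to \<open>sqrt (2 / pi)\<close> would be dominated; this one makes
    two successive steps fit the total standard deviation of the three-point bound exactly.\<close>
  define t0 :: real where "t0 = 1 / sqrt 2"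
  note int = cvx_lip_integrable[OF u]
  have "convex_on UNIV S"
  proof (rule convex_onI)
    fix t p q :: real assume t: "0 < t" "t < 1"
    have e: "x + d * ((1 - t) *\<^sub>R p + t *\<^sub>R q) = (1 - t) * (x + d * p) + t * (x + d * q)"
         "x - d * ((1 - t) *\<^sub>R p + t *\<^sub>R q) = (1 - t) * (x - d * p) + t * (x - d * q)"
      by (simp_all add: algebra_simps)
    show "S ((1 - t) *\<^sub>R p + t *\<^sub>R q) \<le> (1 - t) * S p + t * S q"
      unfolding S_def e
      using cvx_lip_convex[OF u, of t "x + d * p" "x + d * q"] cvx_lip_convex[OF u, of t "x - d * p" "x - d * q"] t
      by (simp add: field_simps)
  qed simp
  then have "\<exists>s. \<forall>t. S t \<ge> S t0 + s * (t - t0)"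
    using convex_le_Inf_differential[of UNIV S t0] by (intro exI allI) auto
  then obtain s where s: "S t \<ge> S t0 + s * (t - t0)" for t by blast
  have t0: "0 < t0" by (simp add: t0_def)
  have "S (- t0) = S t0" by (simp add: S_def add.commute)
  with s[of "- t0"] t0 have s0: "0 \<le> s" by (auto simp: zero_le_mult_iff)
  have "S t0 = S t0 + s * (t0 - t0)" by simp
  also have "\<dots> \<le> S t0 + s * (sqrt (2 / pi) - t0)"
  proof -
    have "t0 = sqrt (1 / 2)" by (simp add: t0_def real_sqrt_divide)
    also have "\<dots> \<le> sqrt (2 / pi)" using pi_less_4 by (intro real_sqrt_le_mono) (simp add: field_simps)
    finally show ?thesis using s0 by (intro add_left_mono mult_left_mono) auto
  qed
  also have "\<dots> = (\<integral>z. S t0 + s * (\<bar>z\<bar> - t0) \<partial>std_normal)"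
    using integrable_std_normal_abs integral_std_normal_abs std_normal.prob_space by simp
  also have "\<dots> \<le> (\<integral>z. S z \<partial>std_normal)"
  proof (rule integral_mono)
    show "integrable std_normal (\<lambda>z. S t0 + s * (\<bar>z\<bar> - t0))"
      using integrable_std_normal_abs by auto
    show "integrable std_normal S"
      unfolding S_def using int[of x d] int[of x "- d"] by auto
    show "S t0 + s * (\<bar>z\<bar> - t0) \<le> S z" for z
      using s[of "\<bar>z\<bar>"] by (cases "0 \<le> z") (auto simp: S_def add.commute)
  qed
  also have "\<dots> = (gauss_smooth u d x + gauss_smooth u (- d) x) / 2"
    unfolding S_def gauss_smooth_def using int[of x d] int[of x "- d"] by simp
  also have "gauss_smooth u (- d) x = gauss_smooth u d x"
    unfolding gauss_smooth_def
    using integral_std_normal_uminus[of "\<lambda>z. u (x + d * z)"] cvx_lip_measurable[OF u] by simp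
  finally show ?thesis by (simp add: S_def t0_def)
qed

lemma gauss_smooth_ge:
  assumes u: "cvx_lip K u" and d: "0 \<le> d"
  shows "u x \<le> gauss_smooth u d x"
  using gauss_smooth_ge_two_point[OF assms, of x] cvx_lip_midpoint[OF u, of x "d / sqrt 2"] by simp

lemma gauss_smooth_mono:
  assumes u: "cvx_lip K u" and s: "0 < s" "s \<le> t"
  shows "gauss_smooth u s x \<le> gauss_smooth u t x"
proof (cases "s = t")
  case False
  define r where "r = sqrt (t\<^sup>2 - s\<^sup>2)"
  have "s\<^sup>2 < t\<^sup>2" using s False by (intro power_strict_mono) auto
  then have r: "0 < r" "s\<^sup>2 + r\<^sup>2 = t\<^sup>2" by (auto simp: r_def)
  have "gauss_smooth u s x \<le> gauss_smooth (gauss_smooth u s) r x"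
    using r by (intro gauss_smooth_ge[OF cvx_lip_gauss_smooth[OF u]]) auto
  also have "\<dots> = gauss_smooth u t x"
    using gauss_smooth_semigroup[OF s(1) r(1) u, of x] r s by simp
  finally show ?thesis .
qed simp

text \<open>The weights 1/4, 1/2, 1/4 are those of the sum of two independent symmetric steps of
  size \<open>h / 2\<close>. Each step is dominated by a Gaussian of standard deviation
  \<open>h / sqrt 2\<close>, and the two variances add up to the square of \<open>h\<close>.\<close>

lemma gauss_smooth_ge_three_point:
  assumes u: "cvx_lip K u" and h: "0 \<le> h"
  shows "u x / 2 + (u (x + h) + u (x - h)) / 4 \<le> gauss_smooth u h x"
proof (cases "h = 0")
  case False
  with h have h: "0 < h" by simp
  let ?d = "h / sqrt 2"
  have d: "0 < ?d" "?d / sqrt 2 = h / 2" "sqrt (?d\<^sup>2 + ?d\<^sup>2) = h"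
    using h by (auto simp: power_divide)
  have G: "cvx_lip K (gauss_smooth u ?d)" by (rule cvx_lip_gauss_smooth[OF u])
  have "gauss_smooth u h x = gauss_smooth (gauss_smooth u ?d) ?d x"
    using gauss_smooth_semigroup[OF d(1) d(1) u, of x] d(3) by simp
  moreover have "(gauss_smooth u ?d (x + h / 2) + gauss_smooth u ?d (x - h / 2)) / 2 \<le> gauss_smooth (gauss_smooth u ?d) ?d x"
    using gauss_smooth_ge_two_point[OF G, of ?d x] d by simp
  moreover have "(u (x + h) + u x) / 2 \<le> gauss_smooth u ?d (x + h / 2)"
    using gauss_smooth_ge_two_point[OF u, of ?d "x + h / 2"] d by (simp add: add.assoc)
  moreover have "(u x + u (x - h)) / 2 \<le> gauss_smooth u ?d (x - h / 2)"
    using gauss_smooth_ge_two_point[OF u, of ?d "x - h / 2"] d by (simp add: diff_diff_eq)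
  moreover have "x0 / 2 + (a + b) / 4 \<le> g" if "g = g'" "(p + q) / 2 \<le> g'" "(a + x0) / 2 \<le> p" "(x0 + b) / 2 \<le> q"
    for x0 a b g g' p q :: real using that by (simp add: field_simps)
  ultimately show ?thesis by blast
qed (simp add: field_simps)

text \<open>The pointwise bound \<open>\<bar>a - b\<bar> \<le> a + b - 2 a b\<close> on the unit interval shows that two independent
  copies of a \<open>[0,1]\<close>-valued variable are at expected distance at most \<open>1/2\<close>.\<close>
lemma cvx_lip_discrete_step:
  fixes q y :: "'o::finite \<Rightarrow> real"
  assumes u: "cvx_lip K u" and h: "0 \<le> h"
    and q: "\<And>w. 0 \<le> q w" "sum q UNIV = 1" and y: "\<And>w. 0 \<le> y w" "\<And>w. y w \<le> 1"
  defines "m \<equiv> (\<Sum>w\<in>UNIV. q w * y w)"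
  shows "(\<Sum>w\<in>UNIV. q w * u (m + h * (y w - m))) \<le> u m / 2 + (u (m + h) + u (m - h)) / 4"
proof -
  define T where "T = (u (m + h) + u (m - h)) / 2 - u m"
  have T: "0 \<le> T" using cvx_lip_midpoint[OF u, of m h] by (simp add: T_def)
  have sum2: "(\<Sum>w\<in>UNIV. \<Sum>v\<in>UNIV. q w * q v * (y w + y v - 2 * (y w * y v))) = 2 * m - 2 * m\<^sup>2"
  proof -
    have "(\<Sum>w\<in>UNIV. \<Sum>v\<in>UNIV. q w * q v * (y w + y v - 2 * (y w * y v)))
      = (\<Sum>w\<in>UNIV. \<Sum>v\<in>UNIV. (q w * y w) * q v) + (\<Sum>w\<in>UNIV. \<Sum>v\<in>UNIV. q w * (q v * y v))
        - 2 * (\<Sum>w\<in>UNIV. \<Sum>v\<in>UNIV. (q w * y w) * (q v * y v))"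
      by (simp add: algebra_simps sum.distrib sum_subtractf sum_distrib_left)
    also have "\<dots> = m * 1 + 1 * m - 2 * (m * m)"
      unfolding m_def sum_product[symmetric] q(2) by simp
    finally show ?thesis by (simp add: power2_eq_square)
  qed
  \<comment> \<open>Jensen's inequality with a second independent draw \<open>v\<close>, whose value
    \<open>y v\<close> has mean \<open>m\<close>.\<close>
  have "u (m + h * (y w - m)) \<le> (\<Sum>v\<in>UNIV. q v * u (m + h * (y w - y v)))" for w
  proof -
    have "m + h * (y w - m) = (\<Sum>v\<in>UNIV. q v *\<^sub>R (m + h * (y w - y v)))"
    proof -
      have "(\<Sum>v\<in>UNIV. q v *\<^sub>R (m + h * (y w - y v))) = (\<Sum>v\<in>UNIV. (m + h * y w) * q v - h * (q v * y v))"
        by (simp add: algebra_simps)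
      also have "\<dots> = (m + h * y w) * sum q UNIV - h * m"
        by (simp add: sum_subtractf m_def flip: sum_distrib_left)
      finally show ?thesis by (simp add: q algebra_simps)
    qed
    moreover have "u (\<Sum>v\<in>UNIV. q v *\<^sub>R (m + h * (y w - y v))) \<le> (\<Sum>v\<in>UNIV. q v * u (m + h * (y w - y v)))"
      using u q by (intro convex_on_sum[where C=UNIV]) (auto simp: cvx_lip_def)
    ultimately show ?thesis by simp
  qed
  then have "(\<Sum>w\<in>UNIV. q w * u (m + h * (y w - m))) \<le> (\<Sum>w\<in>UNIV. q w * (\<Sum>v\<in>UNIV. q v * u (m + h * (y w - y v))))"
    using q by (intro sum_mono mult_left_mono) auto
  also have "\<dots> = (\<Sum>w\<in>UNIV. \<Sum>v\<in>UNIV. q w * q v * u (m + h * (y w - y v)))" (is "_ = ?D")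
    by (simp add: sum_distrib_left mult.assoc)
  \<comment> \<open>The difference of two independent copies is symmetric, so \<open>u\<close> may
    be averaged over the reflection about \<open>m\<close>.\<close>
  also have "\<dots> = (\<Sum>w\<in>UNIV. \<Sum>v\<in>UNIV. q w * q v * ((u (m + h * (y w - y v)) + u (m - h * (y w - y v))) / 2))"
  proof -
    have "?D = (\<Sum>v\<in>UNIV. \<Sum>w\<in>UNIV. q w * q v * u (m + h * (y w - y v)))" by (rule sum.swap)
    also have "\<dots> = (\<Sum>w\<in>UNIV. \<Sum>v\<in>UNIV. q w * q v * u (m - h * (y w - y v)))"
      by (simp add: algebra_simps)
    finally have "?D + ?D = ?D + (\<Sum>w\<in>UNIV. \<Sum>v\<in>UNIV. q w * q v * u (m - h * (y w - y v)))" by simp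
    also have "\<dots> = 2 * (\<Sum>w\<in>UNIV. \<Sum>v\<in>UNIV. q w * q v * ((u (m + h * (y w - y v)) + u (m - h * (y w - y v))) / 2))"
      by (simp add: sum_distrib_left distrib_left add_divide_distrib flip: sum.distrib)
    finally show ?thesis by simp
  qed
  also have "\<dots> \<le> (\<Sum>w\<in>UNIV. \<Sum>v\<in>UNIV. q w * q v * (u m + (y w + y v - 2 * (y w * y v)) * T))"
  proof (intro sum_mono mult_left_mono)
    fix w v
    define \<delta> where "\<delta> = \<bar>y w - y v\<bar>"
    have \<delta>: "0 \<le> \<delta>" "\<delta> \<le> 1" using y[of w] y[of v] by (auto simp: \<delta>_def)
    have \<delta>le: "\<delta> \<le> y w + y v - 2 * (y w * y v)"
      using y(1)[of w] y(1)[of v] mult_left_le[OF y(2)[of w] y(1)[of v]] mult_left_le[OF y(2)[of v] y(1)[of w]]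
      by (auto simp: \<delta>_def abs_if mult.commute)
    have "u (m + h * (y w - y v)) + u (m - h * (y w - y v)) = u (m + h * \<delta>) + u (m - h * \<delta>)"
      by (auto simp: \<delta>_def abs_if algebra_simps)
    moreover have "u (m + h * \<delta>) \<le> (1 - \<delta>) * u m + \<delta> * u (m + h)"
      using cvx_lip_convex[OF u \<delta>, of m "m + h"] by (simp add: algebra_simps)
    moreover have "u (m - h * \<delta>) \<le> (1 - \<delta>) * u m + \<delta> * u (m - h)"
      using cvx_lip_convex[OF u \<delta>, of m "m - h"] by (simp add: algebra_simps)
    moreover have "\<delta> * T = (\<delta> * u (m + h) + \<delta> * u (m - h)) / 2 - \<delta> * u m"
      by (simp add: T_def field_simps)
    moreover have "(1 - \<delta>) * u m = u m - \<delta> * u m" by (simp add: algebra_simps)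
    moreover have "s / 2 \<le> um + dt" if "s = p + q" "p \<le> e + a" "q \<le> e + b" "dt = (a + b) / 2 - f" "e = um - f"
      for s p q e a b dt f um :: real using that by (simp add: field_simps)
    ultimately have "(u (m + h * (y w - y v)) + u (m - h * (y w - y v))) / 2 \<le> u m + \<delta> * T"
      by blast
    also have "\<dots> \<le> u m + (y w + y v - 2 * (y w * y v)) * T"
      using \<delta>le T by (intro add_left_mono mult_right_mono) auto
    finally show "(u (m + h * (y w - y v)) + u (m - h * (y w - y v))) / 2 \<le> u m + (y w + y v - 2 * (y w * y v)) * T" .
  qed (use q in auto)
  also have "\<dots> = u m * (\<Sum>w\<in>UNIV. \<Sum>v\<in>UNIV. q w * q v) + (2 * m - 2 * m\<^sup>2) * T"
    unfolding sum2[symmetric] by (simp add: distrib_left sum.distrib sum_distrib_left sum_distrib_right mult_ac)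
  also have "\<dots> = u m + (2 * m - 2 * m\<^sup>2) * T"
    by (simp add: q flip: sum_product)
  also have "\<dots> \<le> u m + 1 / 2 * T"
  proof -
    have "0 \<le> (2 * m - 1)\<^sup>2" by simp
    then have "2 * m - 2 * m\<^sup>2 \<le> 1 / 2" by (simp add: power2_diff power_mult_distrib algebra_simps)
    then show ?thesis using T by (intro add_left_mono mult_right_mono) auto
  qed
  also have "\<dots> = u m / 2 + (u (m + h) + u (m - h)) / 4" by (simp add: T_def field_simps)
  finally show ?thesis .
qed


subsection \<open>Gaussian domination of Dirichlet averages\<close>

text \<open>Insert \<open>1 = sum p UNIV\<close> and size bias each summand: the Dirichlet law is
  the mixture of its own posteriors after one predictive draw.\<close>

lemma integral_dirichlet_polya:
  fixes \<alpha> :: "'o::finite \<Rightarrow> real" and f :: "('o \<Rightarrow> real) \<Rightarrow> real"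
  assumes \<alpha>: "\<And>w. 0 \<le> \<alpha> w" and b: "0 < sum \<alpha> UNIV"
    and f [measurable]: "f \<in> borel_measurable (PiM UNIV (\<lambda>_. borel))" and int: "integrable (dirichlet \<alpha>) f"
  shows "(\<integral>p. f p \<partial>dirichlet \<alpha>) = (\<Sum>w\<in>UNIV. \<alpha> w / sum \<alpha> UNIV * (\<integral>p. f p \<partial>dirichlet (\<alpha>(w := \<alpha> w + 1))))"
proof -
  note simplex = AE_dirichlet_simplex[OF \<alpha> b]
  have int_w: "integrable (dirichlet \<alpha>) (\<lambda>p. p w * f p)" for w
  proof (rule Bochner_Integration.integrable_bound[OF int])
    show "AE p in dirichlet \<alpha>. norm (p w * f p) \<le> norm (f p)"
      using simplex
    proof eventually_elim
      case (elim p)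
      then have "p w \<le> 1" using member_le_sum[of w UNIV p] by simp
      with elim show ?case by (simp add: abs_mult mult_left_le_one_le)
    qed
  qed measurable
  have "(\<integral>p. f p \<partial>dirichlet \<alpha>) = (\<integral>p. (\<Sum>w\<in>UNIV. p w * f p) \<partial>dirichlet \<alpha>)"
  proof (rule integral_cong_AE)
    show "AE p in dirichlet \<alpha>. f p = (\<Sum>w\<in>UNIV. p w * f p)"
      using simplex by eventually_elim (simp flip: sum_distrib_right)
  qed measurable
  also have "\<dots> = (\<Sum>w\<in>UNIV. \<integral>p. p w * f p \<partial>dirichlet \<alpha>)"
    using int_w by (rule Bochner_Integration.integral_sum)
  finally show ?thesis
    by (simp add: integral_dirichlet_size_bias[OF \<alpha> b f])
qed

lemma integrable_dirichlet_bounded: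
  fixes \<alpha> :: "'o::finite \<Rightarrow> real" and f :: "('o \<Rightarrow> real) \<Rightarrow> real"
  assumes \<alpha>: "\<And>w. 0 \<le> \<alpha> w" and b: "0 < sum \<alpha> UNIV"
    and [measurable]: "f \<in> borel_measurable (PiM UNIV (\<lambda>_. borel))"
    and bound: "\<And>p. (\<And>w. 0 \<le> p w) \<Longrightarrow> sum p UNIV = 1 \<Longrightarrow> \<bar>f p\<bar> \<le> C"
  shows "integrable (dirichlet \<alpha>) f"
proof -
  interpret prob_space "dirichlet \<alpha>" by (rule prob_space_dirichlet[OF \<alpha>])
  show ?thesis
  proof (rule integrable_const_bound[where B=C])
    show "AE p in dirichlet \<alpha>. norm (f p) \<le> C"
      using AE_dirichlet_simplex[OF \<alpha> b] by eventually_elim (auto intro: bound)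
  qed measurable
qed

lemma convex_combination_bounds:
  fixes p y :: "'o::finite \<Rightarrow> real"
  assumes "\<And>w. 0 \<le> p w" "sum p UNIV = 1" "\<And>w. l \<le> y w" "\<And>w. y w \<le> r"
  shows "l \<le> (\<Sum>w\<in>UNIV. p w * y w)" "(\<Sum>w\<in>UNIV. p w * y w) \<le> r"
proof -
  have "l = (\<Sum>w\<in>UNIV. p w * l)" "r = (\<Sum>w\<in>UNIV. p w * r)"
    using assms(2) by (simp_all flip: sum_distrib_right)
  moreover have "(\<Sum>w\<in>UNIV. p w * l) \<le> (\<Sum>w\<in>UNIV. p w * y w)" "(\<Sum>w\<in>UNIV. p w * y w) \<le> (\<Sum>w\<in>UNIV. p w * r)"
    using assms by (auto intro!: sum_mono mult_left_mono)
  ultimately show "l \<le> (\<Sum>w\<in>UNIV. p w * y w)" "(\<Sum>w\<in>UNIV. p w * y w) \<le> r"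
    by linarith+
qed

lemma dirichlet_mean:
  fixes \<alpha> y :: "'o::finite \<Rightarrow> real"
  assumes \<alpha>: "\<And>w. 0 \<le> \<alpha> w" and b: "0 < sum \<alpha> UNIV"
  shows "(\<integral>p. (\<Sum>w\<in>UNIV. p w * y w) \<partial>dirichlet \<alpha>) = (\<Sum>w\<in>UNIV. \<alpha> w / sum \<alpha> UNIV * y w)"
proof -
  have "integrable (dirichlet \<alpha>) (\<lambda>p. p w)" for w
  proof (rule integrable_dirichlet_bounded[OF \<alpha> b])
    fix p :: "'o \<Rightarrow> real" assume "\<And>w. 0 \<le> p w" "sum p UNIV = 1"
    then show "\<bar>p w\<bar> \<le> 1" using member_le_sum[of w UNIV p] by simp
  qed measurable
  moreover have "(\<integral>p. p w \<partial>dirichlet \<alpha>) = \<alpha> w / sum \<alpha> UNIV" for w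
  proof -
    interpret prob_space "dirichlet (\<alpha>(w := \<alpha> w + 1))"
      by (rule prob_space_dirichlet) (use \<alpha> in \<open>simp add: add_nonneg_nonneg\<close>)
    show ?thesis
      using integral_dirichlet_size_bias[OF \<alpha> b, of "\<lambda>_. 1" w] prob_space by simp
  qed
  ultimately show ?thesis by simp
qed

lemma dirichlet_mean_update:
  fixes \<alpha> y :: "'o::finite \<Rightarrow> real"
  assumes "0 < sum \<alpha> UNIV"
  defines "m \<equiv> \<Sum>v\<in>UNIV. \<alpha> v / sum \<alpha> UNIV * y v"
  shows "(\<Sum>v\<in>UNIV. (\<alpha>(w := \<alpha> w + 1)) v / (sum \<alpha> UNIV + 1) * y v) = m + 1 / (sum \<alpha> UNIV + 1) * (y w - m)"
proof -
  let ?b = "sum \<alpha> UNIV"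
  have "(\<Sum>v\<in>UNIV. (\<alpha>(w := \<alpha> w + 1)) v * y v) = (\<Sum>v\<in>UNIV. \<alpha> v * y v + (if v = w then y v else 0))"
    by (intro sum.cong) (auto simp: algebra_simps)
  also have "\<dots> = (\<Sum>v\<in>UNIV. \<alpha> v * y v) + y w" by (simp add: sum.distrib)
  also have "(\<Sum>v\<in>UNIV. \<alpha> v * y v) = ?b * m"
    using assms(1) by (simp add: m_def sum_distrib_left)
  finally have "(\<Sum>v\<in>UNIV. (\<alpha>(w := \<alpha> w + 1)) v * y v) = ?b * m + y w" .
  moreover have "(\<Sum>v\<in>UNIV. (\<alpha>(w := \<alpha> w + 1)) v / (?b + 1) * y v) = (\<Sum>v\<in>UNIV. (\<alpha>(w := \<alpha> w + 1)) v * y v) / (?b + 1)"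
    by (simp add: sum_divide_distrib)
  moreover have "(?b * m + y w) / (?b + 1) = m + 1 / (?b + 1) * (y w - m)"
    using assms(1) by (simp add: field_simps)
  ultimately show ?thesis by (simp only:)
qed

lemma sum_fun_upd_add_one: "sum (\<alpha>(w := \<alpha> w + 1)) UNIV = sum \<alpha> UNIV + (1::real)" for w :: "'o::finite"
  by (simp add: sum.remove[of UNIV w])

text \<open>Any bound that tends to 0 as the mass grows would serve, since this is only the base of
  the urn induction. The second moment comes from size bias, and
  \<open>\<bar>x\<bar> \<le> sqrt b * x\<^sup>2 + 1 / sqrt b\<close> takes the place of the
  Cauchy-Schwarz inequality.\<close>

lemma dirichlet_deviation:
  fixes \<alpha> y :: "'o::finite \<Rightarrow> real"
  assumes \<alpha>: "\<And>w. 0 \<le> \<alpha> w" and b: "0 < sum \<alpha> UNIV" and y: "\<And>w. 0 \<le> y w" "\<And>w. y w \<le> 1"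
  defines "m \<equiv> \<Sum>w\<in>UNIV. \<alpha> w / sum \<alpha> UNIV * y w"
  shows "(\<integral>p. \<bar>(\<Sum>w\<in>UNIV. p w * y w) - m\<bar> \<partial>dirichlet \<alpha>) \<le> 2 / sqrt (sum \<alpha> UNIV)"
proof -
  let ?b = "sum \<alpha> UNIV" and ?Y = "\<lambda>p. \<Sum>w\<in>UNIV. p w * y w"
  interpret prob_space "dirichlet \<alpha>" by (rule prob_space_dirichlet[OF \<alpha>])
  have q: "0 \<le> \<alpha> w / ?b" "(\<Sum>w\<in>UNIV. \<alpha> w / ?b) = 1" for w
    using \<alpha> b by (auto simp flip: sum_divide_distrib)
  have m: "0 \<le> m" "m \<le> 1"
    using convex_combination_bounds[OF q y] by (auto simp: m_def)
  have Yb: "\<bar>\<Sum>w\<in>UNIV. p w * y w\<bar> \<le> 1" "0 \<le> (\<Sum>w\<in>UNIV. p w * y w)" "(\<Sum>w\<in>UNIV. p w * y w) \<le> 1"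
    if "\<And>w. 0 \<le> p w" "sum p UNIV = 1" for p
    using convex_combination_bounds[OF that y] by auto
  have intY: "integrable (dirichlet \<alpha>) ?Y"
    by (rule integrable_dirichlet_bounded[OF \<alpha> b, where C=1]) (measurable, rule Yb)
  have intY2: "integrable (dirichlet \<alpha>) (\<lambda>p. (?Y p)\<^sup>2)"
    by (rule integrable_dirichlet_bounded[OF \<alpha> b, where C=1]) (measurable, simp add: Yb power_le_one)
  have EY: "expectation ?Y = m" unfolding m_def by (rule dirichlet_mean[OF \<alpha> b])
  have "(\<integral>p. (?Y p)\<^sup>2 \<partial>dirichlet \<alpha>) = (\<integral>p. (\<Sum>w\<in>UNIV. y w * (p w * ?Y p)) \<partial>dirichlet \<alpha>)"
    by (simp add: power2_eq_square sum_distrib_right mult_ac)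
  also have "\<dots> = (\<Sum>w\<in>UNIV. \<integral>p. y w * (p w * ?Y p) \<partial>dirichlet \<alpha>)"
  proof (rule Bochner_Integration.integral_sum)
    show "integrable (dirichlet \<alpha>) (\<lambda>p. y w * (p w * ?Y p))" for w
    proof (rule integrable_mult_right, rule integrable_dirichlet_bounded[OF \<alpha> b, where C=1])
      fix p :: "'o \<Rightarrow> real" assume p: "\<And>w. 0 \<le> p w" "sum p UNIV = 1"
      have "p w \<le> 1" using member_le_sum[of w UNIV p] p by simp
      then show "\<bar>p w * ?Y p\<bar> \<le> 1" using Yb[OF p] p(1)[of w] by (simp add: mult_le_one)
    qed measurable
  qed
  also have "\<dots> = (\<Sum>w\<in>UNIV. y w * (\<alpha> w / ?b * (m + 1 / (?b + 1) * (y w - m))))"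
  proof (rule sum.cong[OF refl])
    fix w
    have \<alpha>': "0 \<le> (\<alpha>(w := \<alpha> w + 1)) v" for v using \<alpha> by (simp add: add_nonneg_nonneg)
    have b': "0 < sum (\<alpha>(w := \<alpha> w + 1)) UNIV" using b by (simp only: sum_fun_upd_add_one)
    have "(\<integral>p. y w * (p w * ?Y p) \<partial>dirichlet \<alpha>) = y w * (\<alpha> w / ?b * (\<integral>p. ?Y p \<partial>dirichlet (\<alpha>(w := \<alpha> w + 1))))"
      by (subst integral_mult_right_zero, subst integral_dirichlet_size_bias[OF \<alpha> b]) auto
    also have "(\<integral>p. ?Y p \<partial>dirichlet (\<alpha>(w := \<alpha> w + 1))) = m + 1 / (?b + 1) * (y w - m)"
      unfolding dirichlet_mean[OF \<alpha>' b'] sum_fun_upd_add_one m_def by (rule dirichlet_mean_update[OF b])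
    finally show "(\<integral>p. y w * (p w * ?Y p) \<partial>dirichlet \<alpha>) = y w * (\<alpha> w / ?b * (m + 1 / (?b + 1) * (y w - m)))" .
  qed
  also have "\<dots> = (\<Sum>w\<in>UNIV. (m - 1 / (?b + 1) * m) * (\<alpha> w / ?b * y w) + 1 / (?b + 1) * (\<alpha> w / ?b * (y w)\<^sup>2))"
    by (intro sum.cong) (auto simp: algebra_simps power2_eq_square add_divide_distrib diff_divide_distrib)
  also have "\<dots> = (m - 1 / (?b + 1) * m) * m + 1 / (?b + 1) * (\<Sum>w\<in>UNIV. \<alpha> w / ?b * (y w)\<^sup>2)"
    unfolding m_def by (simp only: sum.distrib sum_distrib_left)
  also have "\<dots> \<le> m\<^sup>2 + 1 / ?b"
  proof -
    have "(\<Sum>w\<in>UNIV. \<alpha> w / ?b * (y w)\<^sup>2) \<le> 1"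
      using y by (intro convex_combination_bounds(2)[OF q, where l=0]) (auto intro: power_le_one)
    then have "1 / (?b + 1) * (\<Sum>w\<in>UNIV. \<alpha> w / ?b * (y w)\<^sup>2) \<le> 1 / (?b + 1)"
      using b by (intro mult_left_le) auto
    also have "\<dots> \<le> 1 / ?b" using b by (simp add: frac_le)
    finally have 1: "1 / (?b + 1) * (\<Sum>w\<in>UNIV. \<alpha> w / ?b * (y w)\<^sup>2) \<le> 1 / ?b" .
    have "0 \<le> 1 / (?b + 1) * m * m" using b m by simp
    with 1 show ?thesis by (simp add: algebra_simps power2_eq_square)
  qed
  finally have "(\<integral>p. (?Y p)\<^sup>2 \<partial>dirichlet \<alpha>) \<le> m\<^sup>2 + 1 / ?b" .
  then have var: "(\<integral>p. (?Y p - m)\<^sup>2 \<partial>dirichlet \<alpha>) \<le> 1 / ?b"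
    using variance_eq[OF intY intY2] EY by simp
  have "(\<integral>p. \<bar>?Y p - m\<bar> \<partial>dirichlet \<alpha>) \<le> (\<integral>p. sqrt ?b * (?Y p - m)\<^sup>2 + 1 / sqrt ?b \<partial>dirichlet \<alpha>)"
  proof (rule integral_mono)
    show "integrable (dirichlet \<alpha>) (\<lambda>p. \<bar>?Y p - m\<bar>)" using intY by simp
    show "integrable (dirichlet \<alpha>) (\<lambda>p. sqrt ?b * (?Y p - m)\<^sup>2 + 1 / sqrt ?b)"
      using intY intY2 by (simp add: power2_diff)
    fix p
    have "0 \<le> (sqrt ?b * \<bar>?Y p - m\<bar> - 1 / 2)\<^sup>2" by simp
    then have "sqrt ?b * \<bar>?Y p - m\<bar> \<le> (sqrt ?b)\<^sup>2 * (?Y p - m)\<^sup>2 + 1"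
      by (simp add: power2_diff power_mult_distrib power_divide)
    also have "(sqrt ?b)\<^sup>2 * (?Y p - m)\<^sup>2 + 1 = sqrt ?b * (sqrt ?b * (?Y p - m)\<^sup>2 + 1 / sqrt ?b)"
      using b by (simp add: distrib_left flip: mult.assoc)
    finally have "sqrt ?b * \<bar>?Y p - m\<bar> \<le> sqrt ?b * (sqrt ?b * (?Y p - m)\<^sup>2 + 1 / sqrt ?b)" .
    then show "\<bar>?Y p - m\<bar> \<le> sqrt ?b * (?Y p - m)\<^sup>2 + 1 / sqrt ?b"
      using b by (subst (asm) mult_le_cancel_left_pos) auto
  qed
  also have "\<dots> = sqrt ?b * (\<integral>p. (?Y p - m)\<^sup>2 \<partial>dirichlet \<alpha>) + 1 / sqrt ?b"
    using intY intY2 by (subst Bochner_Integration.integral_add) (simp_all add: power2_diff prob_space[unfolded space_dirichlet])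
  also have "\<dots> \<le> sqrt ?b * (1 / ?b) + 1 / sqrt ?b"
    using var b by (intro add_right_mono mult_left_mono) auto
  also have "sqrt ?b * (1 / ?b) = 1 / sqrt ?b"
    using b by (simp add: sqrt_divide_self_eq inverse_eq_divide)
  finally show ?thesis by simp
qed

text \<open>A Polya urn argument: adding one observation moves the posterior mean by an increment of range
  \<open>1 / (b + 1)\<close>, which is dominated in convex order by a Gaussian of variance \<open>1 / (b (b + 1)) = 1 / b - 1 / (b + 1)\<close>,
  and these variances telescope to \<open>1 / b\<close>.\<close>
theorem dirichlet_le_gauss_unit:
  fixes \<alpha> y :: "'o::finite \<Rightarrow> real"
  assumes u: "cvx_lip K u" and \<alpha>: "\<And>w. 0 \<le> \<alpha> w" and b: "0 < sum \<alpha> UNIV"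
    and y: "\<And>w. 0 \<le> y w" "\<And>w. y w \<le> 1"
  shows "(\<integral>p. u (\<Sum>w\<in>UNIV. p w * y w) \<partial>dirichlet \<alpha>)
    \<le> gauss_smooth u (1 / sqrt (sum \<alpha> UNIV)) (\<Sum>w\<in>UNIV. \<alpha> w / sum \<alpha> UNIV * y w)"
proof -
  let ?D = "\<lambda>\<alpha>. \<integral>p. u (\<Sum>w\<in>UNIV. p w * y w) \<partial>dirichlet \<alpha>"
  let ?M = "\<lambda>\<alpha>. \<Sum>w\<in>UNIV. \<alpha> w / sum \<alpha> UNIV * y w"
  let ?G = "\<lambda>\<alpha>. gauss_smooth u (1 / sqrt (sum \<alpha> UNIV)) (?M \<alpha>)"
  have K: "0 \<le> K" using cvx_lipD[OF u, of 1 0] by (simp add: order_trans[OF abs_ge_zero])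
  have um [measurable]: "u \<in> borel_measurable borel" by (rule cvx_lip_measurable[OF u])
  have Yb: "\<bar>\<Sum>w\<in>UNIV. p w * y w\<bar> \<le> 1" "0 \<le> (\<Sum>w\<in>UNIV. p w * y w)" "(\<Sum>w\<in>UNIV. p w * y w) \<le> 1"
    if "\<And>w. 0 \<le> p w" "sum p UNIV = 1" for p
    using convex_combination_bounds[OF that y] by auto
  have int: "integrable (dirichlet \<alpha>) (\<lambda>p. u (\<Sum>w\<in>UNIV. p w * y w))"
    if "\<And>w. 0 \<le> \<alpha> w" "0 < sum \<alpha> UNIV" for \<alpha>
  proof (rule integrable_dirichlet_bounded[OF that, where C="\<bar>u 0\<bar> + K"])
    fix p :: "'o \<Rightarrow> real" assume p: "\<And>w. 0 \<le> p w" "sum p UNIV = 1"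
    have "\<bar>u (\<Sum>w\<in>UNIV. p w * y w) - u 0\<bar> \<le> K * 1"
      using Yb[OF p] K by (intro order_trans[OF cvx_lipD[OF u]] mult_left_mono) auto
    then show "\<bar>u (\<Sum>w\<in>UNIV. p w * y w)\<bar> \<le> \<bar>u 0\<bar> + K" by simp
  qed measurable
  \<comment> \<open>\<open>k\<close> counts the draws that are made before the urn is stopped. The
    error depends only on the mass reached at the end, and the parameters must be general because
    every draw changes them.\<close>
  have "?D \<alpha> - ?G \<alpha> \<le> 2 * K / sqrt (sum \<alpha> UNIV + real k)"
    if "\<And>w. 0 \<le> \<alpha> w" "0 < sum \<alpha> UNIV" for k \<alpha>
    using that
  proof (induction k arbitrary: \<alpha>)
    case (0 \<alpha>)
    interpret prob_space "dirichlet \<alpha>" by (rule prob_space_dirichlet[OF 0(1)])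
    have intY: "integrable (dirichlet \<alpha>) (\<lambda>p. \<Sum>w\<in>UNIV. p w * y w)"
      by (rule integrable_dirichlet_bounded[OF 0, where C=1]) (measurable, rule Yb)
    then have intA: "integrable (dirichlet \<alpha>) (\<lambda>p. \<bar>(\<Sum>w\<in>UNIV. p w * y w) - ?M \<alpha>\<bar>)"
      by (intro integrable_abs Bochner_Integration.integrable_diff) simp_all
    have "?D \<alpha> \<le> (\<integral>p. u (?M \<alpha>) + K * \<bar>(\<Sum>w\<in>UNIV. p w * y w) - ?M \<alpha>\<bar> \<partial>dirichlet \<alpha>)"
    proof (rule integral_mono[OF int[OF 0]])
      show "integrable (dirichlet \<alpha>) (\<lambda>p. u (?M \<alpha>) + K * \<bar>(\<Sum>w\<in>UNIV. p w * y w) - ?M \<alpha>\<bar>)"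
        using intA by simp
      show "u (\<Sum>w\<in>UNIV. p w * y w) \<le> u (?M \<alpha>) + K * \<bar>(\<Sum>w\<in>UNIV. p w * y w) - ?M \<alpha>\<bar>" for p
        using cvx_lipD[OF u, of "\<Sum>w\<in>UNIV. p w * y w" "?M \<alpha>"] by linarith
    qed
    also have "\<dots> = u (?M \<alpha>) + K * (\<integral>p. \<bar>(\<Sum>w\<in>UNIV. p w * y w) - ?M \<alpha>\<bar> \<partial>dirichlet \<alpha>)"
      using intA by (subst Bochner_Integration.integral_add) (simp_all add: prob_space[unfolded space_dirichlet])
    also have "\<dots> \<le> ?G \<alpha> + K * (2 / sqrt (sum \<alpha> UNIV))"
      using 0 K y by (intro add_mono mult_left_mono gauss_smooth_ge[OF u] dirichlet_deviation) auto
    finally show ?case by (simp add: mult.commute)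
  next
    case (Suc k \<alpha>)
    let ?b = "sum \<alpha> UNIV" and ?h = "1 / (sum \<alpha> UNIV + 1)" and ?m = "?M \<alpha>"
    let ?g = "gauss_smooth u (1 / sqrt (?b + 1))"
    have q: "0 \<le> \<alpha> w / ?b" "(\<Sum>w\<in>UNIV. \<alpha> w / ?b) = 1" for w
      using Suc.prems by (auto simp flip: sum_divide_distrib)
    have g: "cvx_lip K ?g" by (rule cvx_lip_gauss_smooth[OF u])
    have step: "?D (\<alpha>(w := \<alpha> w + 1)) \<le> ?g (?m + ?h * (y w - ?m)) + 2 * K / sqrt (?b + real (Suc k))" for w
    proof -
      have "?D (\<alpha>(w := \<alpha> w + 1)) - ?G (\<alpha>(w := \<alpha> w + 1)) \<le> 2 * K / sqrt (sum (\<alpha>(w := \<alpha> w + 1)) UNIV + real k)"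
      proof (rule Suc.IH)
        show "0 \<le> (\<alpha>(w := \<alpha> w + 1)) v" for v using Suc.prems by (simp add: add_nonneg_nonneg)
        show "0 < sum (\<alpha>(w := \<alpha> w + 1)) UNIV" using Suc.prems by (simp only: sum_fun_upd_add_one)
      qed
      moreover have "?M (\<alpha>(w := \<alpha> w + 1)) = ?m + ?h * (y w - ?m)"
        unfolding sum_fun_upd_add_one by (rule dirichlet_mean_update[OF Suc.prems(2)])
      ultimately show ?thesis unfolding sum_fun_upd_add_one by (simp add: add_ac)
    qed
    have "?D \<alpha> = (\<Sum>w\<in>UNIV. \<alpha> w / ?b * ?D (\<alpha>(w := \<alpha> w + 1)))"
      by (rule integral_dirichlet_polya[OF Suc.prems _ int[OF Suc.prems]]) measurable
    also have "\<dots> \<le> (\<Sum>w\<in>UNIV. \<alpha> w / ?b * (?g (?m + ?h * (y w - ?m)) + 2 * K / sqrt (?b + real (Suc k))))"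
      by (intro sum_mono mult_left_mono step q)
    also have "\<dots> = (\<Sum>w\<in>UNIV. \<alpha> w / ?b * ?g (?m + ?h * (y w - ?m))) + 2 * K / sqrt (?b + real (Suc k))"
      by (simp only: distrib_left sum.distrib sum_distrib_right[symmetric] q(2) mult_1)
    also have "(\<Sum>w\<in>UNIV. \<alpha> w / ?b * ?g (?m + ?h * (y w - ?m))) \<le> ?G \<alpha>"
    proof -
      have "(\<Sum>w\<in>UNIV. \<alpha> w / ?b * ?g (?m + ?h * (y w - ?m))) \<le> ?g ?m / 2 + (?g (?m + ?h) + ?g (?m - ?h)) / 4"
        using Suc.prems by (intro cvx_lip_discrete_step[OF g _ q y]) auto
      also have "\<dots> \<le> gauss_smooth ?g ?h ?m"
        using Suc.prems by (intro gauss_smooth_ge_three_point[OF g]) auto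
      \<comment> \<open>The increment alone would allow the smaller standard deviation
        \<open>1 / (b + 1)\<close>; the slack is given away so that the variances telescope
        exactly.\<close>
      also have "\<dots> \<le> gauss_smooth ?g (1 / sqrt (?b * (?b + 1))) ?m"
      proof (rule gauss_smooth_mono[OF g])
        have "sqrt (?b * (?b + 1)) \<le> sqrt ((?b + 1) * (?b + 1))"
          using Suc.prems by (intro real_sqrt_le_mono mult_right_mono) auto
        then show "?h \<le> 1 / sqrt (?b * (?b + 1))"
          using Suc.prems by (intro divide_left_mono) auto
      qed (use Suc.prems in simp)
      also have "\<dots> = ?G \<alpha>"
      proof -
        have "(1 / sqrt (?b + 1))\<^sup>2 + (1 / sqrt (?b * (?b + 1)))\<^sup>2 = 1 / ?b"
        proof -
          have "(1 / sqrt (?b + 1))\<^sup>2 + (1 / sqrt (?b * (?b + 1)))\<^sup>2 = 1 / (?b + 1) + 1 / (?b * (?b + 1))"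
            using Suc.prems by (simp add: power_divide)
          also have "\<dots> = 1 / ?b" using Suc.prems by (simp add: divide_simps)
          finally show ?thesis .
        qed
        then show ?thesis
          using Suc.prems by (subst gauss_smooth_semigroup[OF _ _ u]) (auto simp: real_sqrt_divide)
      qed
      finally show ?thesis .
    qed
    finally show ?case by simp
  qed
  from this[OF \<alpha> b] have "?D \<alpha> - ?G \<alpha> \<le> 2 * K / sqrt (sum \<alpha> UNIV + real k)" for k .
  moreover have "(\<lambda>k. 2 * K / sqrt (sum \<alpha> UNIV + real k)) \<longlonglongrightarrow> 0"
  proof -
    have "(\<lambda>k. 1 / sqrt (c + real k)) \<longlonglongrightarrow> 0" for c by real_asymp
    from tendsto_mult[OF tendsto_const[of "2 * K"] this] show ?thesis by simp
  qed
  ultimately have "?D \<alpha> - ?G \<alpha> \<le> 0" by (intro LIMSEQ_le_const) auto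
  then show ?thesis by simp
qed

lemma cvx_lip_rescale:
  assumes "cvx_lip K u"
  shows "cvx_lip (K * \<bar>c\<bar>) (\<lambda>x. u (d + c * x))"
  unfolding cvx_lip_def
proof (intro conjI allI)
  show "convex_on UNIV (\<lambda>x. u (d + c * x))"
  proof (rule convex_onI)
    fix t x y :: real assume t: "0 < t" "t < 1"
    have "d + c * ((1 - t) *\<^sub>R x + t *\<^sub>R y) = (1 - t) * (d + c * x) + t * (d + c * y)"
      by (simp add: algebra_simps)
    then show "u (d + c * ((1 - t) *\<^sub>R x + t *\<^sub>R y)) \<le> (1 - t) * u (d + c * x) + t * u (d + c * y)"
      using cvx_lip_convex[OF assms, of t] t by simp
  qed simp
  show "\<bar>u (d + c * x) - u (d + c * y)\<bar> \<le> K * \<bar>c\<bar> * \<bar>x - y\<bar>" for x y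
    using cvx_lipD[OF assms, of "d + c * x" "d + c * y"] by (simp add: abs_mult mult.assoc flip: right_diff_distrib)
qed

text \<open>Monotonicity of \<open>u\<close> lets the Gaussian be centred at any \<open>m\<close>
  above the Dirichlet mean; the optimistic prior mean of the regression makes use of this.\<close>

corollary dirichlet_le_gauss:
  fixes \<alpha> y :: "'o::finite \<Rightarrow> real"
  assumes u: "cvx_lip K u" "mono u" and \<alpha>: "\<And>w. 0 \<le> \<alpha> w" and b: "0 < sum \<alpha> UNIV"
    and y: "\<And>w. 0 \<le> y w" "\<And>w. y w \<le> h" and h: "0 < h"
    and m: "(\<Sum>w\<in>UNIV. \<alpha> w / sum \<alpha> UNIV * y w) \<le> m"
  shows "(\<integral>p. u (\<Sum>w\<in>UNIV. p w * y w) \<partial>dirichlet \<alpha>)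
    \<le> (\<integral>z. u (m + h / sqrt (sum \<alpha> UNIV) * z) \<partial>std_normal)"
proof -
  let ?v = "\<lambda>x. u (0 + h * x)" and ?s = "1 / sqrt (sum \<alpha> UNIV)"
  have v: "cvx_lip (K * \<bar>h\<bar>) ?v" by (rule cvx_lip_rescale[OF u(1)])
  have "(\<integral>p. u (\<Sum>w\<in>UNIV. p w * y w) \<partial>dirichlet \<alpha>) = (\<integral>p. ?v (\<Sum>w\<in>UNIV. p w * (y w / h)) \<partial>dirichlet \<alpha>)"
    using h by (simp add: sum_distrib_left)
  also have "\<dots> \<le> gauss_smooth ?v ?s (\<Sum>w\<in>UNIV. \<alpha> w / sum \<alpha> UNIV * (y w / h))"
    using y h by (intro dirichlet_le_gauss_unit[OF v \<alpha> b]) auto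
  also have "\<dots> \<le> (\<integral>z. u (m + h / sqrt (sum \<alpha> UNIV) * z) \<partial>std_normal)"
    unfolding gauss_smooth_def
  proof (rule integral_mono)
    show "integrable std_normal (\<lambda>z. u (m + h / sqrt (sum \<alpha> UNIV) * z))"
      by (rule cvx_lip_integrable[OF u(1)])
    show "integrable std_normal (\<lambda>z. ?v ((\<Sum>w\<in>UNIV. \<alpha> w / sum \<alpha> UNIV * (y w / h)) + ?s * z))"
      by (rule cvx_lip_integrable[OF v])
    fix z
    have "0 + h * ((\<Sum>w\<in>UNIV. \<alpha> w / sum \<alpha> UNIV * (y w / h)) + ?s * z)
      = (\<Sum>w\<in>UNIV. \<alpha> w / sum \<alpha> UNIV * y w) + h / sqrt (sum \<alpha> UNIV) * z"
      using h by (simp add: distrib_left sum_distrib_left)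
    also have "\<dots> \<le> m + h / sqrt (sum \<alpha> UNIV) * z" using m by simp
    finally show "?v ((\<Sum>w\<in>UNIV. \<alpha> w / sum \<alpha> UNIV * (y w / h)) + ?s * z) \<le> u (m + h / sqrt (sum \<alpha> UNIV) * z)"
      by (rule monoD[OF u(2)])
  qed
  finally show ?thesis .
qed

subsection \<open>The Dirichlet prior on models\<close>

abbreviation coords :: "nat \<Rightarrow> (nat \<times> 'x \<times> 'a) set" where
  "coords H \<equiv> {..<H} \<times> UNIV \<times> UNIV"

definition valid_model :: "nat \<Rightarrow> ('x::finite, 'a::finite) model \<Rightarrow> bool" where
  "valid_model H P \<longleftrightarrow> (\<forall>i\<in>coords H. (\<forall>w. 0 \<le> P i w) \<and> sum (P i) UNIV = 1)"

definition valid_param :: "('i \<Rightarrow> 'o::finite \<Rightarrow> real) \<Rightarrow> bool" where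
  "valid_param \<alpha> \<longleftrightarrow> (\<forall>i. (\<forall>w. 0 \<le> \<alpha> i w) \<and> 0 < sum (\<alpha> i) UNIV)"

definition mean_model :: "('i \<Rightarrow> 'o::finite \<Rightarrow> real) \<Rightarrow> 'i \<Rightarrow> 'o \<Rightarrow> real" where
  "mean_model \<alpha> i w = \<alpha> i w / sum (\<alpha> i) UNIV"

lemma valid_paramD: "valid_param \<alpha> \<Longrightarrow> 0 \<le> \<alpha> i w" "valid_param \<alpha> \<Longrightarrow> 0 < sum (\<alpha> i) UNIV"
  by (auto simp: valid_param_def)

lemma valid_mean_model: "valid_param \<alpha> \<Longrightarrow> valid_model H (mean_model \<alpha>)"
  unfolding valid_model_def mean_model_def
  by (auto simp: valid_paramD less_imp_le less_imp_neq[symmetric] simp flip: sum_divide_distrib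
      dest: valid_paramD(2)[THEN less_imp_neq])

lemma valid_modelD:
  assumes "valid_model H P" "t < H"
  shows "0 \<le> P (t, x, a) w" "sum (P (t, x, a)) UNIV = 1" "P (t, x, a) w \<le> 1"
proof -
  have "(t, x, a) \<in> coords H" using assms(2) by simp
  with assms(1) have *: "(\<forall>w. 0 \<le> P (t, x, a) w) \<and> sum (P (t, x, a)) UNIV = 1"
    unfolding valid_model_def by blast
  show 1: "0 \<le> P (t, x, a) w" for w using * by blast
  show 2: "sum (P (t, x, a)) UNIV = 1" using * by blast
  show "P (t, x, a) w \<le> 1" using member_le_sum[of w UNIV "P (t, x, a)"] 1 2 by simp
qed

abbreviation model_space :: "nat \<Rightarrow> ('x::finite, 'a::finite) model measure" where
  "model_space H \<equiv> PiM (coords H) (\<lambda>_. PiM UNIV (\<lambda>_. borel))"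

lemma sets_mdp_prior [simp, measurable_cong]: "sets (mdp_prior H \<alpha>) = sets (model_space H)"
  unfolding mdp_prior_def by (intro sets_PiM_cong) auto

lemma space_mdp_prior: "space (mdp_prior H \<alpha>) = space (model_space H)"
  by (rule sets_eq_imp_space_eq) simp

lemma product_sigma_finite_dirichlet:
  assumes "valid_param \<alpha>"
  shows "product_sigma_finite (\<lambda>i. dirichlet (\<alpha> i))"
  by (intro product_sigma_finite.intro prob_space_imp_sigma_finite prob_space_dirichlet valid_paramD assms)

lemma prob_space_mdp_prior: "valid_param \<alpha> \<Longrightarrow> prob_space (mdp_prior H \<alpha>)"
  unfolding mdp_prior_def by (intro prob_space_PiM prob_space_dirichlet valid_paramD)

lemma measurable_coord [measurable (raw)]:
  assumes "i \<in> I"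
  shows "(\<lambda>P. P i w) \<in> borel_measurable (PiM I (\<lambda>_. PiM UNIV (\<lambda>_::'o. borel :: real measure)))"
  by (rule measurable_compose[OF measurable_component_singleton[OF assms] measurable_component_singleton]) simp

lemma AE_PiM_dirichlet_simplex:
  fixes \<alpha> :: "'i \<Rightarrow> 'o::finite \<Rightarrow> real"
  assumes "valid_param \<alpha>" "finite I"
  shows "AE P in PiM I (\<lambda>i. dirichlet (\<alpha> i)). \<forall>i\<in>I. (\<forall>w. 0 \<le> P i w) \<and> sum (P i) UNIV = 1"
proof -
  have "AE P in PiM I (\<lambda>i. dirichlet (\<alpha> i)). (\<forall>w. 0 \<le> P i w) \<and> sum (P i) UNIV = 1" if "i \<in> I" for i
    using that assms
    by (intro AE_PiM_component[where P="\<lambda>p. (\<forall>w. 0 \<le> p w) \<and> sum p UNIV = 1"] prob_space_dirichlet AE_dirichlet_simplex valid_paramD)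
  then show ?thesis using assms(2) by (auto intro: AE_finite_allI)
qed

lemma AE_mdp_prior_valid:
  fixes \<alpha> :: "nat \<times> 'x::finite \<times> 'a::finite \<Rightarrow> bool \<times> 'x \<Rightarrow> real"
  assumes "valid_param \<alpha>"
  shows "AE P in mdp_prior H \<alpha>. valid_model H P"
  unfolding valid_model_def mdp_prior_def by (rule AE_PiM_dirichlet_simplex[OF assms]) simp

lemma integrable_mdp_prior:
  fixes \<alpha> :: "nat \<times> 'x::finite \<times> 'a::finite \<Rightarrow> bool \<times> 'x \<Rightarrow> real" and f :: "_ \<Rightarrow> real"
  assumes \<alpha>: "valid_param \<alpha>" and [measurable]: "f \<in> borel_measurable (model_space H)"
    and bound: "\<And>P. valid_model H P \<Longrightarrow> \<bar>f P\<bar> \<le> C"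
  shows "integrable (mdp_prior H \<alpha>) f"
proof -
  interpret prob_space "mdp_prior H \<alpha>" by (rule prob_space_mdp_prior[OF \<alpha>])
  show ?thesis
  proof (rule integrable_const_bound[where B=C])
    show "AE P in mdp_prior H \<alpha>. norm (f P) \<le> C"
      using AE_mdp_prior_valid[OF \<alpha>] by eventually_elim (simp add: bound)
  qed measurable
qed

text \<open>Bayes' rule for one observation in unnormalized form: likelihood times prior is the
  predictive probability times the updated prior.\<close>

lemma mdp_prior_size_bias:
  fixes \<alpha> :: "nat \<times> 'x::finite \<times> 'a::finite \<Rightarrow> bool \<times> 'x \<Rightarrow> real" and f :: "_ \<Rightarrow> real"
  assumes \<alpha>: "valid_param \<alpha>" and i: "i \<in> coords H"
    and f [measurable]: "f \<in> borel_measurable (model_space H)"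
    and bound: "\<And>P. valid_model H P \<Longrightarrow> \<bar>f P\<bar> \<le> C"
  shows "(\<integral>P. P i w * f P \<partial>mdp_prior H \<alpha>)
    = mean_model \<alpha> i w * (\<integral>P. f P \<partial>mdp_prior H (\<alpha>(i := (\<alpha> i)(w := \<alpha> i w + 1))))"
proof -
  let ?\<alpha>' = "\<alpha>(i := (\<alpha> i)(w := \<alpha> i w + 1))"
  define J where "J = coords H - {i}"
  have J: "insert i J = coords H" "i \<notin> J" "finite J" using i by (auto simp: J_def)
  have \<alpha>': "valid_param ?\<alpha>'"
    using \<alpha> unfolding valid_param_def
    by (auto simp: add_nonneg_nonneg sum_fun_upd_add_one[simplified] add_pos_pos)
  interpret A: product_sigma_finite "\<lambda>i. dirichlet (\<alpha> i)"
    by (rule product_sigma_finite_dirichlet[OF \<alpha>])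
  interpret B: product_sigma_finite "\<lambda>j. dirichlet (?\<alpha>' j)"
    by (rule product_sigma_finite_dirichlet[OF \<alpha>'])
  have eqJ: "PiM J (\<lambda>j. dirichlet (?\<alpha>' j)) = PiM J (\<lambda>j. dirichlet (\<alpha> j))"
    by (intro PiM_cong) (auto simp: J_def)
  have int1: "integrable (mdp_prior H \<alpha>) (\<lambda>P. P i w * f P)"
  proof (rule integrable_mdp_prior[OF \<alpha>, where C=C])
    show "(\<lambda>P. P i w * f P) \<in> borel_measurable (model_space H)" using i by measurable
    fix P :: "('x, 'a) model" assume P: "valid_model H P"
    obtain t x a where i': "i = (t, x, a)" "t < H" using i by auto
    show "\<bar>P i w * f P\<bar> \<le> C"
      using valid_modelD[OF P i'(2)] bound[OF P] unfolding i'
      by (simp add: abs_mult) (metis abs_ge_zero mult_left_le_one_le order_trans)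
  qed
  have int2: "integrable (mdp_prior H ?\<alpha>') f"
    by (rule integrable_mdp_prior[OF \<alpha>' f bound])
  have m: "(\<lambda>y. f (x(i := y))) \<in> borel_measurable (PiM UNIV (\<lambda>_. borel))" if "x \<in> space (PiM J (\<lambda>i. dirichlet (\<alpha> i)))" for x
  proof (rule measurable_compose[OF _ f])
    show "(\<lambda>y. x(i := y)) \<in> PiM UNIV (\<lambda>_. borel) \<rightarrow>\<^sub>M model_space H"
      by (rule measurable_fun_upd[where J=J])
         (use J that in \<open>auto simp: space_PiM intro!: measurable_const\<close>)
  qed
  have "(\<integral>P. P i w * f P \<partial>mdp_prior H \<alpha>)
     = (\<integral>x. (\<integral>y. (x(i := y)) i w * f (x(i := y)) \<partial>dirichlet (\<alpha> i)) \<partial>PiM J (\<lambda>i. dirichlet (\<alpha> i)))"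
    using A.product_integral_insert[OF J(3,2), of "\<lambda>P. P i w * f P"] int1 by (simp add: J mdp_prior_def)
  also have "\<dots> = (\<integral>x. mean_model \<alpha> i w * (\<integral>y. f (x(i := y)) \<partial>dirichlet (?\<alpha>' i)) \<partial>PiM J (\<lambda>i. dirichlet (\<alpha> i)))"
    using m by (intro Bochner_Integration.integral_cong refl)
      (simp add: integral_dirichlet_size_bias[OF valid_paramD[OF \<alpha>]] mean_model_def)
  also have "\<dots> = mean_model \<alpha> i w * (\<integral>x. (\<integral>y. f (x(i := y)) \<partial>dirichlet (?\<alpha>' i)) \<partial>PiM J (\<lambda>i. dirichlet (\<alpha> i)))"
    by (rule integral_mult_right_zero)
  also have "(\<integral>x. (\<integral>y. f (x(i := y)) \<partial>dirichlet (?\<alpha>' i)) \<partial>PiM J (\<lambda>i. dirichlet (\<alpha> i))) = (\<integral>P. f P \<partial>mdp_prior H ?\<alpha>')"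
    unfolding eqJ[symmetric]
    using B.product_integral_insert[OF J(3,2), of f] int2 unfolding mdp_prior_def J(1) by simp
  finally show ?thesis .
qed

section \<open>Conjugate updating over one episode\<close>

definition ep_index :: "('x, 'a) episode \<Rightarrow> nat \<Rightarrow> nat \<times> 'x \<times> 'a" where
  "ep_index e t = (t, ep_state e t, ep_action e t)"

definition posterior :: "(nat \<times> 'x \<times> 'a \<Rightarrow> bool \<times> 'x \<Rightarrow> real) \<Rightarrow> ('x, 'a) episode list
    \<Rightarrow> nat \<times> 'x \<times> 'a \<Rightarrow> bool \<times> 'x \<Rightarrow> real" where
  "posterior \<alpha> h = (\<lambda>(t, x, a) w. \<alpha> (t, x, a) w + real (count_list (data h t x a) w))"

definition visits :: "('x, 'a) episode list \<Rightarrow> nat \<times> 'x \<times> 'a \<Rightarrow> nat" where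
  "visits h = (\<lambda>(t, x, a). length (data h t x a))"

text \<open>The part of an episode's probability that depends on the model. The initial state and
  the choice of actions factor out and leave the posterior unaffected.\<close>

definition ep_likelihood :: "nat \<Rightarrow> ('x, 'a) model \<Rightarrow> ('x, 'a) episode \<Rightarrow> real" where
  "ep_likelihood H P e = (\<Prod>t<H. P (ep_index e t) (ep_outcome e t))"

lemma data_snoc: "data (h @ [e]) t x a = data h t x a @ (if ep_index e t = (t, x, a) then [ep_outcome e t] else [])"
  by (auto simp: data_def ep_index_def)

lemma visits_snoc: "visits (h @ [e]) i = visits h i + of_bool (ep_index e (fst i) = i)"
  by (cases i) (simp add: visits_def data_snoc)

lemma posterior_Nil [simp]: "posterior \<alpha> [] = \<alpha>"
  by (auto simp: posterior_def data_def)

lemma posterior_snoc: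
  "posterior \<alpha> (h @ [e]) i w = posterior \<alpha> h i w + of_bool (ep_index e (fst i) = i \<and> ep_outcome e (fst i) = w)"
  by (cases i) (simp add: posterior_def data_snoc)

lemma sum_count_list: "(\<Sum>w\<in>UNIV. count_list xs w) = length (xs :: 'o::finite list)"
  by (rule sum_count_set) auto

lemma sum_posterior: "sum (posterior \<alpha> h i) UNIV = sum (\<alpha> i) UNIV + real (visits h i)"
  for \<alpha> :: "nat \<times> 'x::finite \<times> 'a \<Rightarrow> bool \<times> 'x \<Rightarrow> real"
  by (cases i) (simp add: posterior_def visits_def sum.distrib flip: of_nat_sum sum_count_list)

lemma valid_posterior: "valid_param \<alpha> \<Longrightarrow> valid_param (posterior \<alpha> h)"
  for \<alpha> :: "nat \<times> 'x::finite \<times> 'a \<Rightarrow> bool \<times> 'x \<Rightarrow> real"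
  unfolding valid_param_def sum_posterior by (auto simp: posterior_def intro: add_pos_nonneg)

lemma valid_likelihood:
  assumes "valid_model H P"
  shows "0 \<le> ep_likelihood H P e" "ep_likelihood H P e \<le> 1"
  unfolding ep_likelihood_def ep_index_def
  by (intro prod_nonneg prod_le_1 ballI conjI valid_modelD[OF assms]; simp)+

text \<open>The steps of an episode visit pairwise different coordinates of the model, so each observed outcome is
  weighted by the posterior mean before the episode.\<close>
lemma mdp_prior_episode_update:
  fixes \<alpha> :: "nat \<times> 'x::finite \<times> 'a::finite \<Rightarrow> bool \<times> 'x \<Rightarrow> real" and f :: "_ \<Rightarrow> real"
  assumes \<alpha>: "valid_param \<alpha>"
    and f: "f \<in> borel_measurable (model_space H)"
    and bound: "\<And>P. valid_model H P \<Longrightarrow> \<bar>f P\<bar> \<le> C"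
  shows "(\<integral>P. ep_likelihood H P e * f P \<partial>mdp_prior H (posterior \<alpha> h))
    = ep_likelihood H (mean_model (posterior \<alpha> h)) e * (\<integral>P. f P \<partial>mdp_prior H (posterior \<alpha> (h @ [e])))"
proof -
  define \<gamma> where "\<gamma> = posterior \<alpha> h"
  have \<gamma>: "valid_param \<gamma>" unfolding \<gamma>_def by (rule valid_posterior[OF \<alpha>])
  \<comment> \<open>The parameters after only the first \<open>k\<close> steps of \<open>e\<close>;
    the condition \<open>fst i < k\<close> reads the time off the index.\<close>
  define \<gamma>' where "\<gamma>' k i w = \<gamma> i w + of_bool (fst i < k \<and> ep_index e (fst i) = i \<and> ep_outcome e (fst i) = w)" for k i w
  have \<gamma>': "valid_param (\<gamma>' k)" for k
    using \<gamma> unfolding valid_param_def \<gamma>'_def sum.distrib by (auto intro: add_pos_nonneg sum_nonneg)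
  have "(\<integral>P. (\<Prod>t<k. P (ep_index e t) (ep_outcome e t)) * f P \<partial>mdp_prior H \<gamma>)
      = (\<Prod>t<k. mean_model \<gamma> (ep_index e t) (ep_outcome e t)) * (\<integral>P. f P \<partial>mdp_prior H (\<gamma>' k))"
    if "k \<le> H" "f \<in> borel_measurable (model_space H)" "\<And>P. valid_model H P \<Longrightarrow> \<bar>f P\<bar> \<le> C" for k f
    using that
  proof (induction k arbitrary: f)
    case 0
    have "\<gamma>' 0 = \<gamma>" by (simp add: \<gamma>'_def fun_eq_iff)
    then show ?case by simp
  next
    case (Suc k f)
    let ?i = "ep_index e k" and ?w = "ep_outcome e k"
    have i: "?i \<in> coords H" using Suc.prems by (auto simp: ep_index_def)
    have upd: "(\<gamma>' k)(?i := (\<gamma>' k ?i)(?w := \<gamma>' k ?i ?w + 1)) = \<gamma>' (Suc k)"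
      by (auto simp: fun_eq_iff \<gamma>'_def ep_index_def less_Suc_eq)
    have mean: "mean_model (\<gamma>' k) ?i ?w = mean_model \<gamma> ?i ?w"
      by (simp add: mean_model_def \<gamma>'_def ep_index_def)
    note [measurable] = Suc.prems(2)
    have "(\<integral>P. (\<Prod>t<Suc k. P (ep_index e t) (ep_outcome e t)) * f P \<partial>mdp_prior H \<gamma>)
       = (\<integral>P. (\<Prod>t<k. P (ep_index e t) (ep_outcome e t)) * (P ?i ?w * f P) \<partial>mdp_prior H \<gamma>)"
      by (simp add: mult_ac)
    also have "\<dots> = (\<Prod>t<k. mean_model \<gamma> (ep_index e t) (ep_outcome e t)) * (\<integral>P. P ?i ?w * f P \<partial>mdp_prior H (\<gamma>' k))"
    proof (rule Suc.IH)
      show "(\<lambda>P. P ?i ?w * f P) \<in> borel_measurable (model_space H)" using i by measurable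
      show "\<bar>P ?i ?w * f P\<bar> \<le> C" if P: "valid_model H P" for P
        using valid_modelD[OF P, of k] Suc.prems(3)[OF P] Suc.prems(1) unfolding ep_index_def
        by (simp add: abs_mult Suc_le_eq) (metis abs_ge_zero mult_left_le_one_le order_trans)
    qed (use Suc.prems in simp)
    also have "(\<integral>P. P ?i ?w * f P \<partial>mdp_prior H (\<gamma>' k)) = mean_model \<gamma> ?i ?w * (\<integral>P. f P \<partial>mdp_prior H (\<gamma>' (Suc k)))"
      unfolding upd[symmetric] mean[symmetric]
      by (rule mdp_prior_size_bias[OF \<gamma>' i Suc.prems(2,3)])
    finally show ?case by (simp add: mult_ac)
  qed
  from this[OF order_refl f bound]
  have "(\<integral>P. ep_likelihood H P e * f P \<partial>mdp_prior H \<gamma>)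
    = ep_likelihood H (mean_model \<gamma>) e * (\<integral>P. f P \<partial>mdp_prior H (\<gamma>' H))"
    unfolding ep_likelihood_def .
  also have "mdp_prior H (\<gamma>' H) = mdp_prior H (posterior \<alpha> (h @ [e]))"
    unfolding mdp_prior_def by (intro PiM_cong refl arg_cong[where f=dirichlet]) (auto simp: \<gamma>'_def \<gamma>_def posterior_snoc)
  finally show ?thesis by (simp add: \<gamma>_def)
qed

subsection \<open>Episodes as weighted walks\<close>

text \<open>The products and sums over \<open>t\<close> that define episode probabilities and costs
  do not split along the list of steps; these recursive forms do.\<close>

primrec walk_prob :: "('x, 'a) model \<Rightarrow> ('x, 'a) policy \<Rightarrow> nat \<Rightarrow> 'x \<Rightarrow> ('a \<times> bool \<times> 'x) list \<Rightarrow> real" where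
  "walk_prob P \<pi> t x [] = 1"
| "walk_prob P \<pi> t x (s # ss) =
    (if fst s = \<pi> t x then P (t, x, fst s) (snd s) else 0) * walk_prob P \<pi> (Suc t) (snd (snd s)) ss"

primrec walk_cost :: "(nat \<Rightarrow> 'x \<Rightarrow> 'a \<Rightarrow> bool \<times> 'x \<Rightarrow> real) \<Rightarrow> nat \<Rightarrow> 'x \<Rightarrow> ('a \<times> bool \<times> 'x) list \<Rightarrow> real" where
  "walk_cost c t x [] = 0"
| "walk_cost c t x (s # ss) = c t x (fst s) (snd s) + walk_cost c (Suc t) (snd (snd s)) ss"

text \<open>One recursion for both uses: the reward as cost gives the value of a policy, and the
  Bellman error as cost gives the regret bound.\<close>

primrec policy_cost :: "('x::finite, 'a) model \<Rightarrow> ('x, 'a) policy \<Rightarrow> (nat \<Rightarrow> 'x \<Rightarrow> 'a \<Rightarrow> bool \<times> 'x \<Rightarrow> real)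
    \<Rightarrow> nat \<Rightarrow> nat \<Rightarrow> 'x \<Rightarrow> real" where
  "policy_cost P \<pi> c H 0 x = 0"
| "policy_cost P \<pi> c H (Suc k) x = (let t = H - Suc k in
    (\<Sum>w\<in>UNIV. P (t, x, \<pi> t x) w * (c t x (\<pi> t x) w + policy_cost P \<pi> c H k (snd w))))"

definition ep_cost :: "nat \<Rightarrow> (nat \<Rightarrow> 'x \<Rightarrow> 'a \<Rightarrow> bool \<times> 'x \<Rightarrow> real) \<Rightarrow> ('x, 'a) episode \<Rightarrow> real" where
  "ep_cost H c e = (\<Sum>t<H. c t (ep_state e t) (ep_action e t) (ep_outcome e t))"

lemma Vrem_eq_policy_cost: "Vrem P \<pi> H k x = policy_cost P \<pi> (\<lambda>t x a w. of_bool (fst w)) H k x"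
  by (induction k arbitrary: x) (simp_all add: Let_def)

lemma sum_lists_Suc:
  fixes f :: "'b::finite list \<Rightarrow> 'c::comm_monoid_add"
  shows "(\<Sum>s\<in>{s. length s = Suc k}. f s) = (\<Sum>b\<in>UNIV. \<Sum>s\<in>{s. length s = k}. f (b # s))"
proof -
  have "(\<Sum>b\<in>UNIV. \<Sum>s\<in>{s. length s = k}. f (b # s)) = (\<Sum>(b, s)\<in>UNIV \<times> {s. length s = k}. f (b # s))"
    using finite_lists_length_eq[of "UNIV :: 'b set" k] by (simp add: sum.cartesian_product)
  also have "\<dots> = (\<Sum>s\<in>{s. length s = Suc k}. f s)"
    by (rule sum.reindex_bij_witness[where i="\<lambda>s. (hd s, tl s)" and j="\<lambda>(b, s). b # s"])
       (auto simp: length_Suc_conv)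
  finally show ?thesis ..
qed

lemma finite_lists_length: "finite {s :: 'b::finite list. length s = k}"
  using finite_lists_length_eq[of "UNIV :: 'b set" k] by simp

lemma sum_pair_fst_eq:
  fixes f :: "'a::finite \<times> 'b::finite \<Rightarrow> real"
  assumes "\<And>a b. a \<noteq> a0 \<Longrightarrow> f (a, b) = 0"
  shows "(\<Sum>s\<in>UNIV. f s) = (\<Sum>b\<in>UNIV. f (a0, b))"
proof -
  have "(\<Sum>s\<in>UNIV. f s) = (\<Sum>a\<in>UNIV. \<Sum>b\<in>UNIV. f (a, b))"
    by (simp add: sum.cartesian_product flip: UNIV_Times_UNIV)
  also have "\<dots> = (\<Sum>a\<in>{a0}. \<Sum>b\<in>UNIV. f (a, b))"
    using assms by (intro sum.mono_neutral_right) (auto intro!: sum.neutral)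
  finally show ?thesis by simp
qed

lemma sum_walk_prob:
  fixes P :: "('x::finite, 'a::finite) model"
  assumes "valid_model H P" "k \<le> H"
  shows "(\<Sum>s\<in>{s. length s = k}. walk_prob P \<pi> (H - k) x s) = 1"
  using assms(2)
proof (induction k arbitrary: x)
  case (Suc k)
  let ?t = "H - Suc k"
  have t: "?t < H" "Suc ?t = H - k" using Suc.prems by auto
  have "(\<Sum>s\<in>{s. length s = Suc k}. walk_prob P \<pi> ?t x s)
      = (\<Sum>b\<in>UNIV. (if fst b = \<pi> ?t x then P (?t, x, fst b) (snd b) else 0) * (\<Sum>s\<in>{s. length s = k}. walk_prob P \<pi> (H - k) (snd (snd b)) s))"
    unfolding sum_lists_Suc walk_prob.simps t(2) by (simp add: sum_distrib_left)
  also have "\<dots> = (\<Sum>b\<in>UNIV. (if fst b = \<pi> ?t x then P (?t, x, fst b) (snd b) else 0))"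
    using Suc by simp
  also have "\<dots> = (\<Sum>w\<in>UNIV. P (?t, x, \<pi> ?t x) w)"
    by (subst sum_pair_fst_eq[where ?a0.0="\<pi> ?t x"]) auto
  also have "\<dots> = 1" by (rule valid_modelD[OF assms(1) t(1)])
  finally show ?case .
qed (simp add: finite_lists_length)

lemma sum_walk_cost:
  fixes P :: "('x::finite, 'a::finite) model"
  assumes "valid_model H P" "k \<le> H"
  shows "(\<Sum>s\<in>{s. length s = k}. walk_prob P \<pi> (H - k) x s * walk_cost c (H - k) x s) = policy_cost P \<pi> c H k x"
  using assms(2)
proof (induction k arbitrary: x)
  case (Suc k)
  let ?t = "H - Suc k"
  have t: "?t < H" "Suc ?t = H - k" using Suc.prems by auto
  let ?p = "\<lambda>b. if fst b = \<pi> ?t x then P (?t, x, fst b) (snd b) else 0"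
  have "(\<Sum>s\<in>{s. length s = Suc k}. walk_prob P \<pi> ?t x s * walk_cost c ?t x s)
      = (\<Sum>b\<in>UNIV. \<Sum>s\<in>{s. length s = k}. ?p b * (c ?t x (fst b) (snd b) * walk_prob P \<pi> (H - k) (snd (snd b)) s
          + walk_prob P \<pi> (H - k) (snd (snd b)) s * walk_cost c (H - k) (snd (snd b)) s))"
    unfolding sum_lists_Suc walk_prob.simps walk_cost.simps t(2) by (simp add: algebra_simps cong: if_cong)
  also have "\<dots> = (\<Sum>b\<in>UNIV. ?p b * (c ?t x (fst b) (snd b) * (\<Sum>s\<in>{s. length s = k}. walk_prob P \<pi> (H - k) (snd (snd b)) s)
          + (\<Sum>s\<in>{s. length s = k}. walk_prob P \<pi> (H - k) (snd (snd b)) s * walk_cost c (H - k) (snd (snd b)) s)))"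
    by (simp only: sum_distrib_left sum.distrib distrib_left)
  also have "\<dots> = (\<Sum>b\<in>UNIV. ?p b * (c ?t x (fst b) (snd b) + policy_cost P \<pi> c H k (snd (snd b))))"
    using Suc by (simp add: sum_walk_prob[OF assms(1)])
  also have "\<dots> = (\<Sum>w\<in>UNIV. P (?t, x, \<pi> ?t x) w * (c ?t x (\<pi> ?t x) w + policy_cost P \<pi> c H k (snd w)))"
    by (subst sum_pair_fst_eq[where ?a0.0="\<pi> ?t x"]) auto
  finally show ?case by (simp add: Let_def)
qed (simp add: finite_lists_length)

lemma ep_state_Suc: "ep_state (x, s # ss) (Suc t) = ep_state (snd (snd s), ss) t"
  by (auto simp: ep_state_def nth_Cons split: nat.split)

text \<open>The offset \<open>t\<close> is what the induction generalizes: the list loses its head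
  while model and policy keep absolute time.\<close>

lemma ep_prob_eq_walk_prob:
  assumes "length ss = k"
  shows "(\<Prod>j<k. if ep_action (x, ss) j = \<pi> (t + j) (ep_state (x, ss) j)
        then P (t + j, ep_state (x, ss) j, ep_action (x, ss) j) (ep_outcome (x, ss) j) else 0) = walk_prob P \<pi> t x ss"
  using assms
proof (induction ss arbitrary: k t x)
  case (Cons s ss)
  then obtain k' where k: "k = Suc k'" by (cases k) auto
  have "ep_action (x, s # ss) (Suc j) = ep_action (snd (snd s), ss) j"
       "ep_outcome (x, s # ss) (Suc j) = ep_outcome (snd (snd s), ss) j" for j
    by (simp_all add: ep_action_def ep_outcome_def)
  moreover have "ep_state (x, s # ss) 0 = x" "ep_action (x, s # ss) 0 = fst s" "ep_outcome (x, s # ss) 0 = snd s"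
    by (simp_all add: ep_state_def ep_action_def ep_outcome_def)
  ultimately show ?case
    using Cons.IH[where k=k' and x="snd (snd s)" and t="Suc t"] Cons.prems unfolding k prod.lessThan_Suc_shift
    by (simp add: ep_state_Suc cong: if_cong)
qed simp

lemma ep_cost_eq_walk_cost:
  assumes "length ss = k"
  shows "(\<Sum>j<k. c (t + j) (ep_state (x, ss) j) (ep_action (x, ss) j) (ep_outcome (x, ss) j)) = walk_cost c t x ss"
  using assms
proof (induction ss arbitrary: k t x)
  case (Cons s ss)
  then obtain k' where k: "k = Suc k'" by (cases k) auto
  have "ep_action (x, s # ss) (Suc j) = ep_action (snd (snd s), ss) j"
       "ep_outcome (x, s # ss) (Suc j) = ep_outcome (snd (snd s), ss) j" for j
    by (simp_all add: ep_action_def ep_outcome_def)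
  moreover have "ep_state (x, s # ss) 0 = x" "ep_action (x, s # ss) 0 = fst s" "ep_outcome (x, s # ss) 0 = snd s"
    by (simp_all add: ep_state_def ep_action_def ep_outcome_def)
  ultimately show ?case
    using Cons.IH[where k=k' and x="snd (snd s)" and t="Suc t"] Cons.prems unfolding k sum.lessThan_Suc_shift
    by (simp add: ep_state_Suc)
qed simp

lemma ep_prob_Pair: "length s = H \<Longrightarrow> ep_prob \<rho> P H \<pi> (x, s) = pmf \<rho> x * walk_prob P \<pi> 0 x s"
  using ep_prob_eq_walk_prob[of s H x \<pi> 0 P, unfolded add_0] by (simp add: ep_prob_def)

lemma ep_cost_Pair: "length s = H \<Longrightarrow> ep_cost H c (x, s) = walk_cost c 0 x s"
  using ep_cost_eq_walk_cost[of s H c 0 x] by (simp add: ep_cost_def)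

lemma episodes_eq: "episodes H = UNIV \<times> {s. length s = H}"
  by (auto simp: episodes_def)

lemma sum_ep_prob:
  fixes P :: "('x::finite, 'a::finite) model"
  assumes "valid_model H P"
  shows "(\<Sum>e\<in>episodes H. ep_prob \<rho> P H \<pi> e * f (fst e)) = (\<Sum>x\<in>UNIV. pmf \<rho> x * f x)"
proof -
  have "(\<Sum>e\<in>episodes H. ep_prob \<rho> P H \<pi> e * f (fst e))
     = (\<Sum>x\<in>UNIV. \<Sum>s\<in>{s. length s = H}. ep_prob \<rho> P H \<pi> (x, s) * f x)"
    unfolding episodes_eq by (simp add: sum.cartesian_product split_beta')
  also have "\<dots> = (\<Sum>x\<in>UNIV. (pmf \<rho> x * f x) * (\<Sum>s\<in>{s. length s = H}. walk_prob P \<pi> (H - H) x s))"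
    unfolding sum_distrib_left
    by (intro sum.cong refl) (simp add: ep_prob_Pair)
  finally show ?thesis by (simp add: sum_walk_prob[OF assms order_refl, simplified])
qed

lemma sum_ep_prob_1:
  fixes P :: "('x::finite, 'a::finite) model"
  assumes "valid_model H P"
  shows "(\<Sum>e\<in>episodes H. ep_prob \<rho> P H \<pi> e) = 1"
  using sum_ep_prob[OF assms, of \<rho> \<pi> "\<lambda>_. 1"] by (simp add: sum_pmf_eq_1)

lemma sum_ep_cost:
  fixes P :: "('x::finite, 'a::finite) model"
  assumes "valid_model H P"
  shows "(\<Sum>e\<in>episodes H. ep_prob \<rho> P H \<pi> e * ep_cost H c e) = (\<Sum>x\<in>UNIV. pmf \<rho> x * policy_cost P \<pi> c H H x)"
proof -
  have "(\<Sum>e\<in>episodes H. ep_prob \<rho> P H \<pi> e * ep_cost H c e)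
     = (\<Sum>x\<in>UNIV. \<Sum>s\<in>{s. length s = H}. ep_prob \<rho> P H \<pi> (x, s) * ep_cost H c (x, s))"
    unfolding episodes_eq by (simp add: sum.cartesian_product split_beta')
  also have "\<dots> = (\<Sum>x\<in>UNIV. pmf \<rho> x * (\<Sum>s\<in>{s. length s = H}. walk_prob P \<pi> (H - H) x s * walk_cost c (H - H) x s))"
    unfolding sum_distrib_left
    by (intro sum.cong refl) (simp add: ep_prob_Pair ep_cost_Pair)
  finally show ?thesis by (simp only: sum_walk_cost[OF assms order_refl])
qed

text \<open>Separates the two sources of randomness: noise acts only through the indicator, the
  model only through the likelihood.\<close>

lemma ep_prob_eq_likelihood:
  "ep_prob \<rho> P H \<pi> e = pmf \<rho> (fst e) * of_bool (\<forall>t<H. ep_action e t = \<pi> t (ep_state e t)) * ep_likelihood H P e"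
proof (cases "\<forall>t<H. ep_action e t = \<pi> t (ep_state e t)")
  case True
  then show ?thesis by (simp add: ep_prob_def ep_likelihood_def ep_index_def)
next
  case False
  then have "(\<Prod>t<H. (if ep_action e t = \<pi> t (ep_state e t)
               then P (t, ep_state e t, ep_action e t) (ep_outcome e t) else 0)) = 0"
    by (auto intro!: prod_zero)
  with False show ?thesis by (simp only: ep_prob_def of_bool_def if_False mult_zero_right mult_zero_left)
qed

lemma ep_prob_bounds:
  assumes "valid_model H P"
  shows "0 \<le> ep_prob \<rho> P H \<pi> e" "ep_prob \<rho> P H \<pi> e \<le> 1"
  unfolding ep_prob_eq_likelihood using valid_likelihood[OF assms, of e] pmf_le_1[of \<rho> "fst e"]
  by (auto simp: of_bool_def intro: mult_le_one)

subsection \<open>Values and policies\<close>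

lemma Vrem_bounds:
  fixes P :: "('x::finite, 'a::finite) model"
  assumes "valid_model H P" "k \<le> H"
  shows "0 \<le> Vrem P \<pi> H k x" "Vrem P \<pi> H k x \<le> real k"
proof -
  have "0 \<le> Vrem P \<pi> H k x \<and> Vrem P \<pi> H k x \<le> real k"
    using assms(2)
  proof (induction k arbitrary: x)
    case (Suc k)
    then have t: "H - Suc k < H" by simp
    note v = valid_modelD[OF assms(1) t]
    have "0 \<le> of_bool (fst w) + Vrem P \<pi> H k (snd w)" "of_bool (fst w) + Vrem P \<pi> H k (snd w) \<le> real (Suc k)" for w
      using Suc.IH[of "snd w"] Suc.prems by (auto simp: of_bool_def)
    from convex_combination_bounds[OF v(1,2) this] show ?case by (simp add: Let_def)
  qed simp
  then show "0 \<le> Vrem P \<pi> H k x" "Vrem P \<pi> H k x \<le> real k" by auto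
qed

lemma Vrem_cong:
  assumes "\<And>t. t < H \<Longrightarrow> \<pi> t = \<pi>' t" "k \<le> H"
  shows "Vrem P \<pi> H k x = Vrem P \<pi>' H k x"
  using assms(2)
proof (induction k arbitrary: x)
  case (Suc k)
  then have "H - Suc k < H" by simp
  with Suc show ?case by (simp add: Let_def assms(1))
qed simp

text \<open>Policies are functions of all natural times, an infinite type, but values read them only
  up to the horizon. These finitely many representatives make the maximum in \<open>Vstar\<close>
  attained and measurable.\<close>

definition policies :: "nat \<Rightarrow> ('x, 'a) policy set" where
  "policies H = PiE {..<H} (\<lambda>_. UNIV)"

lemma finite_policies: "finite (policies H :: ('x::finite, 'a::finite) policy set)"
  unfolding policies_def by (intro finite_PiE) auto

lemma restrict_policy: "restrict \<pi> {..<H} \<in> policies H"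
  by (simp add: policies_def PiE_def)

lemma Vpi_restrict: "Vpi P H (restrict \<pi> {..<H}) 0 x = Vpi P H \<pi> 0 x"
  unfolding Vpi_def by (rule Vrem_cong) auto

lemma Vstar_eq: "Vstar P H 0 x = Max ((\<lambda>\<pi>. Vpi P H \<pi> 0 x) ` policies H)"
proof -
  have "range (\<lambda>\<pi>. Vpi P H \<pi> 0 x) = (\<lambda>\<pi>. Vpi P H \<pi> 0 x) ` policies H"
  proof (intro equalityI image_subsetI)
    fix \<pi>
    show "Vpi P H \<pi> 0 x \<in> (\<lambda>\<pi>. Vpi P H \<pi> 0 x) ` policies H"
      unfolding Vpi_restrict[of P H \<pi> x, symmetric] by (intro imageI restrict_policy)
  qed auto
  then show ?thesis by (simp add: Vstar_def)
qed

lemma policies_nonempty: "policies H \<noteq> {}"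
  using restrict_policy[of undefined H] by blast

lemma Vpi_le_Vstar:
  fixes P :: "('x::finite, 'a::finite) model"
  shows "Vpi P H \<pi> 0 x \<le> Vstar P H 0 x"
  unfolding Vstar_eq Vpi_restrict[of P H \<pi> x, symmetric]
  by (intro Max_ge finite_imageI finite_policies imageI restrict_policy)

lemma Vstar_le:
  fixes P :: "('x::finite, 'a::finite) model"
  assumes "\<And>\<pi>. Vpi P H \<pi> 0 x \<le> c"
  shows "Vstar P H 0 x \<le> c"
  unfolding Vstar_eq using finite_policies policies_nonempty assms by (subst Max_le_iff) auto

lemma measurable_Vrem [measurable]:
  assumes "k \<le> H"
  shows "(\<lambda>P. Vrem P \<pi> H k x) \<in> borel_measurable (model_space H :: ('x::finite, 'a::finite) model measure)"
  using assms
proof (induction k arbitrary: x)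
  case (Suc k)
  then have "(H - Suc k, x, \<pi> (H - Suc k) x) \<in> coords H" and [measurable]: "(\<lambda>P. Vrem P \<pi> H k y) \<in> borel_measurable (model_space H :: ('x, 'a) model measure)" for y
    by auto
  then show ?case unfolding Vrem.simps Let_def by measurable
qed simp

lemma measurable_Vpi [measurable]:
  "(\<lambda>P. Vpi P H \<pi> 0 x) \<in> borel_measurable (model_space H :: ('x::finite, 'a::finite) model measure)"
  unfolding Vpi_def by (rule measurable_Vrem) simp

lemma measurable_Vstar [measurable]:
  "(\<lambda>P. Vstar P H 0 x) \<in> borel_measurable (model_space H :: ('x::finite, 'a::finite) model measure)"
  unfolding Vstar_eq
  by (rule borel_measurable_Max[OF finite_policies]) measurable

subsection \<open>Reduction of the Bayes regret to posterior means\<close>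

lemma sets_noise [simp, measurable_cong]: "sets (noise H) = sets (PiM (coords H) (\<lambda>_. borel))"
  unfolding noise_def by (intro sets_PiM_cong) auto

lemma prob_space_noise: "prob_space (noise H)"
  unfolding noise_def by (intro prob_space_PiM std_normal.prob_space_axioms)

lemma measurable_sum_list [measurable (raw)]:
  fixes f :: "'b \<Rightarrow> 'c \<Rightarrow> real"
  assumes "\<And>w. f w \<in> borel_measurable M"
  shows "(\<lambda>z. \<Sum>w\<leftarrow>ws. f w z) \<in> borel_measurable M"
  using assms by (induction ws) auto

lemma measurable_rlsvi_Qrem:
  fixes h :: "('x::finite, 'a::finite) episode list"
  assumes "k \<le> H"
  shows "(\<lambda>\<xi>. rlsvi_Qrem \<theta> v lam H h \<xi> k x a) \<in> borel_measurable (PiM (coords H) (\<lambda>_. borel))"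
  using assms
proof (induction k arbitrary: x a)
  case (Suc k)
  then have i: "(H - Suc k, x, a) \<in> coords H"
    and [measurable]: "(\<lambda>\<xi>. rlsvi_Qrem \<theta> v lam H h \<xi> k y b) \<in> borel_measurable (PiM (coords H) (\<lambda>_. borel))" for y b
    by auto
  have [measurable]: "(\<lambda>\<xi>. Max (range (rlsvi_Qrem \<theta> v lam H h \<xi> k y))) \<in> borel_measurable (PiM (coords H) (\<lambda>_. borel))" for y
    by (rule borel_measurable_Max[OF finite]) measurable
  from i show ?case unfolding rlsvi_Qrem.simps rlsvi_F_def by measurable
qed simp

text \<open>The arbitrary tie breaking is harmless because \<open>SOME\<close> sees only the set of
  maximizers, and this set is a measurable function of the noise with values in a finite
  type.\<close>

lemma measurable_rlsvi_policy:
  fixes h :: "('x::finite, 'a::finite) episode list"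
  shows "(\<lambda>\<xi>. rlsvi_policy \<theta> v lam H h \<xi> t x) \<in> measurable (PiM (coords H) (\<lambda>_. borel)) (count_space UNIV)"
proof -
  let ?N = "PiM (coords H) (\<lambda>_. borel) :: (nat \<times> 'x \<times> 'a \<Rightarrow> real) measure"
  let ?Q = "rlsvi_Q \<theta> v lam H h"
  have [measurable]: "(\<lambda>\<xi>. ?Q \<xi> t x a) \<in> borel_measurable ?N" for a
    unfolding rlsvi_Q_def by (rule measurable_rlsvi_Qrem) simp
  then have [measurable]: "Measurable.pred ?N (\<lambda>\<xi>. ?Q \<xi> t x a' \<le> ?Q \<xi> t x a)" for a a'
    unfolding pred_def by (intro borel_measurable_le)
  have "(\<lambda>\<xi>. {a. \<forall>a'. ?Q \<xi> t x a' \<le> ?Q \<xi> t x a}) \<in> measurable ?N (count_space UNIV)"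
  proof (subst measurable_count_space_eq2)
    show "(\<lambda>\<xi>. {a. \<forall>a'. ?Q \<xi> t x a' \<le> ?Q \<xi> t x a}) \<in> space ?N \<rightarrow> UNIV \<and>
      (\<forall>S\<in>UNIV. (\<lambda>\<xi>. {a. \<forall>a'. ?Q \<xi> t x a' \<le> ?Q \<xi> t x a}) -` {S} \<inter> space ?N \<in> sets ?N)"
    proof (intro conjI ballI)
      fix S :: "'a set"
      have "(\<lambda>\<xi>. {a. \<forall>a'. ?Q \<xi> t x a' \<le> ?Q \<xi> t x a}) -` {S} \<inter> space ?N
        = {\<xi>\<in>space ?N. \<forall>a. (a \<in> S) = (\<forall>a'. ?Q \<xi> t x a' \<le> ?Q \<xi> t x a)}"
        by auto
      also have "\<dots> \<in> sets ?N" by measurable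
      finally show "(\<lambda>\<xi>. {a. \<forall>a'. ?Q \<xi> t x a' \<le> ?Q \<xi> t x a}) -` {S} \<inter> space ?N \<in> sets ?N" .
    qed simp
  qed simp
  from measurable_compose[OF this, of "\<lambda>S. SOME a. a \<in> S" "count_space UNIV"]
  show ?thesis unfolding rlsvi_policy_def by simp
qed

section \<open>Marginal law of the histories\<close>

locale rlsvi_run =
  fixes \<theta> :: "nat \<times> 'x::finite \<times> 'a::finite \<Rightarrow> real" and v lam :: real and H :: nat
    and \<rho> :: "'x pmf" and \<alpha> :: "nat \<times> 'x \<times> 'a \<Rightarrow> bool \<times> 'x \<Rightarrow> real"
  assumes \<alpha>: "valid_param \<alpha>"
begin

definition pol :: "('x, 'a) episode list \<Rightarrow> (nat \<times> 'x \<times> 'a \<Rightarrow> real) \<Rightarrow> ('x, 'a) policy" where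
  "pol h \<xi> = rlsvi_policy \<theta> v lam H h \<xi>"

definition post_mean :: "('x, 'a) episode list \<Rightarrow> ('x, 'a) model" where
  "post_mean h = mean_model (posterior \<alpha> h)"

definition compat :: "('x, 'a) episode list \<Rightarrow> ('x, 'a) episode \<Rightarrow> real" where
  "compat h e = (\<integral>\<xi>. of_bool (\<forall>t<H. ep_action e t = pol h \<xi> t (ep_state e t)) \<partial>noise H)"

definition kernel :: "('x, 'a) model \<Rightarrow> ('x, 'a) episode list \<Rightarrow> ('x, 'a) episode \<Rightarrow> real" where
  "kernel P h e = (\<integral>\<xi>. ep_prob \<rho> P H (pol h \<xi>) e \<partial>noise H)"

text \<open>The marginal law of the histories, with model and noise integrated out: each next
  episode is drawn from the posterior mean model. That this is the right law is the content of
  \<open>integral_weight\<close>.\<close>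

definition weight :: "('x, 'a) episode list \<Rightarrow> real" where
  "weight h = (\<Prod>l<length h. kernel (post_mean (take l h)) (take l h) (h ! l))"

definition hists :: "nat \<Rightarrow> ('x, 'a) episode list set" where
  "hists L = {h. length h = L \<and> set h \<subseteq> episodes H}"

definition gap :: "('x, 'a) model \<Rightarrow> ('x, 'a) policy \<Rightarrow> real" where
  "gap P \<pi> = (\<Sum>x\<in>UNIV. pmf \<rho> x * (Vstar P H 0 x - Vpi P H \<pi> 0 x))"

sublocale noise: prob_space "noise H :: (nat \<times> 'x \<times> 'a \<Rightarrow> real) measure"
  by (rule prob_space_noise)

lemma measurable_pol [measurable]: "(\<lambda>\<xi>. pol h \<xi> t x) \<in> measurable (PiM (coords H) (\<lambda>_. borel)) (count_space UNIV)"
  unfolding pol_def by (rule measurable_rlsvi_policy)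

text \<open>The noise acts only through the policy, and up to the horizon there are finitely many
  policies. A functional of the played policy is thus a simple function of the noise, and its
  integral is a finite mixture whose weights do not involve the model.\<close>

lemma policy_mixture:
  fixes F :: "('x, 'a) policy \<Rightarrow> real"
  assumes F: "\<And>\<pi>. F (restrict \<pi> {..<H}) = F \<pi>"
  shows "integrable (noise H) (\<lambda>\<xi>. F (pol h \<xi>))" (is ?int)
    and "(\<integral>\<xi>. F (pol h \<xi>) \<partial>noise H) = (\<Sum>\<pi>\<in>policies H. measure (noise H) {\<xi>\<in>space (noise H). \<forall>t<H. \<forall>x. pol h \<xi> t x = \<pi> t x} * F \<pi>)" (is ?eq)
proof -
  define E where "E \<pi> = {\<xi>\<in>space (noise H). \<forall>t<H. \<forall>x. pol h \<xi> t x = \<pi> t x}" for \<pi>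
  have E: "E \<pi> \<in> sets (noise H)" for \<pi> unfolding E_def by measurable
  have eq: "F (pol h \<xi>) = (\<Sum>\<pi>\<in>policies H. indicator (E \<pi>) \<xi> * F \<pi>)" if "\<xi> \<in> space (noise H)" for \<xi>
  proof -
    have "\<xi> \<in> E \<pi> \<longleftrightarrow> \<pi> = restrict (pol h \<xi>) {..<H}" if \<pi>: "\<pi> \<in> policies H" for \<pi>
    proof
      assume "\<xi> \<in> E \<pi>"
      then show "\<pi> = restrict (pol h \<xi>) {..<H}"
        using \<pi> unfolding E_def by (intro ext) (auto simp: policies_def PiE_def extensional_def restrict_def)
    qed (use \<open>\<xi> \<in> space (noise H)\<close> in \<open>auto simp: E_def\<close>)
    then have "(\<Sum>\<pi>\<in>policies H. indicator (E \<pi>) \<xi> * F \<pi>) = (\<Sum>\<pi>\<in>policies H. if restrict (pol h \<xi>) {..<H} = \<pi> then F \<pi> else 0)"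
      by (intro sum.cong) (auto simp: indicator_def)
    also have "\<dots> = F (pol h \<xi>)" using restrict_policy[of "pol h \<xi>" H] F by (simp add: sum.delta' finite_policies)
    finally show ?thesis ..
  qed
  have int: "integrable (noise H) (\<lambda>\<xi>. indicator (E \<pi>) \<xi> * F \<pi>)" for \<pi>
    by (intro integrable_mult_left integrable_real_indicator[OF E]) (simp add: noise.emeasure_eq_measure)
  show ?int
    by (rule iffD2[OF Bochner_Integration.integrable_cong[OF refl eq]])
       (assumption, rule Bochner_Integration.integrable_sum[OF int])
  have "(\<integral>\<xi>. F (pol h \<xi>) \<partial>noise H) = (\<integral>\<xi>. (\<Sum>\<pi>\<in>policies H. indicator (E \<pi>) \<xi> * F \<pi>) \<partial>noise H)"
    by (rule Bochner_Integration.integral_cong[OF refl eq])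
  also have "\<dots> = (\<Sum>\<pi>\<in>policies H. measure (noise H) (E \<pi>) * F \<pi>)"
  proof -
    have "(\<integral>\<xi>. indicator (E \<pi>) \<xi> * F \<pi> \<partial>noise H) = measure (noise H) (E \<pi>) * F \<pi>" for \<pi>
      using E[THEN sets.sets_into_space] by (simp add: Int_absorb2)
    then show ?thesis by (simp only: Bochner_Integration.integral_sum[OF int])
  qed
  finally show ?eq by (simp only: E_def)
qed

lemma ep_prob_restrict: "ep_prob \<rho> P H (restrict \<pi> {..<H}) e = ep_prob \<rho> P H \<pi> e"
  by (simp add: ep_prob_def)

lemma gap_restrict: "gap P (restrict \<pi> {..<H}) = gap P \<pi>"
  by (simp add: gap_def Vpi_restrict)

lemma integrable_ep_prob: "integrable (noise H) (\<lambda>\<xi>. ep_prob \<rho> P H (pol h \<xi>) e)"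
  by (rule policy_mixture) (rule ep_prob_restrict)

lemma integrable_gap: "integrable (noise H) (\<lambda>\<xi>. gap P (pol h \<xi>))"
  by (rule policy_mixture) (rule gap_restrict)

lemma kernel_eq: "kernel P h e = pmf \<rho> (fst e) * compat h e * ep_likelihood H P e"
  unfolding kernel_def ep_prob_eq_likelihood compat_def by simp

lemma sum_kernel:
  assumes "valid_model H P"
  shows "(\<Sum>e\<in>episodes H. kernel P h e) = 1"
proof -
  have "(\<Sum>e\<in>episodes H. kernel P h e) = (\<integral>\<xi>. (\<Sum>e\<in>episodes H. ep_prob \<rho> P H (pol h \<xi>) e) \<partial>noise H)"
    unfolding kernel_def by (rule Bochner_Integration.integral_sum[symmetric]) (rule integrable_ep_prob)
  then show ?thesis by (simp add: sum_ep_prob_1[OF assms] noise.prob_space)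
qed

lemma kernel_nonneg: "valid_model H P \<Longrightarrow> 0 \<le> kernel P h e"
  unfolding kernel_def by (intro Bochner_Integration.integral_nonneg ep_prob_bounds)

lemma valid_post_mean: "valid_model H (post_mean h)"
  unfolding post_mean_def by (intro valid_mean_model valid_posterior \<alpha>)

lemma weight_nonneg: "0 \<le> weight h"
  unfolding weight_def by (intro prod_nonneg kernel_nonneg valid_post_mean)

lemma weight_Nil [simp]: "weight [] = 1"
  by (simp add: weight_def)

lemma weight_snoc: "weight (h @ [e]) = weight h * kernel (post_mean h) h e"
  by (simp add: weight_def nth_append)

lemma hists_0 [simp]: "hists 0 = {[]}"
  by (auto simp: hists_def)

lemma sum_hists_Suc: "(\<Sum>h\<in>hists (Suc L). f h) = (\<Sum>h\<in>hists L. \<Sum>e\<in>episodes H. f (h @ [e]))"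
proof -
  have "(\<Sum>h\<in>hists L. \<Sum>e\<in>episodes H. f (h @ [e])) = (\<Sum>(h, e)\<in>hists L \<times> episodes H. f (h @ [e]))"
    by (simp add: sum.cartesian_product)
  also have "\<dots> = (\<Sum>h\<in>hists (Suc L). f h)"
    by (rule sum.reindex_bij_witness[where i="\<lambda>h. (butlast h, last h)" and j="\<lambda>(h, e). h @ [e]"])
       (auto simp: hists_def length_Suc_conv_rev append_butlast_last_id dest: in_set_butlastD)
  finally show ?thesis ..
qed

lemma sum_weight: "(\<Sum>h\<in>hists L. weight h) = 1"
  by (induction L) (simp_all add: sum_hists_Suc weight_snoc sum_kernel[OF valid_post_mean] flip: sum_distrib_left)

lemma sum_weight_le:
  assumes "\<And>h. h \<in> hists L \<Longrightarrow> f h \<le> c"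
  shows "(\<Sum>h\<in>hists L. weight h * f h) \<le> c"
proof -
  have "(\<Sum>h\<in>hists L. weight h * f h) \<le> (\<Sum>h\<in>hists L. weight h * c)"
    using assms by (intro sum_mono mult_left_mono weight_nonneg) auto
  then show ?thesis by (simp add: sum_weight flip: sum_distrib_right)
qed

lemma gap_bounds:
  assumes "valid_model H P"
  shows "0 \<le> gap P \<pi>" "gap P \<pi> \<le> real H"
proof -
  have "0 \<le> Vstar P H 0 x - Vpi P H \<pi> 0 x" "Vstar P H 0 x - Vpi P H \<pi> 0 x \<le> real H" for x
  proof -
    have "Vstar P H 0 x \<le> real H"
      using Vrem_bounds[OF assms order_refl] by (intro Vstar_le) (simp add: Vpi_def)
    moreover have "0 \<le> Vpi P H \<pi> 0 x" using Vrem_bounds[OF assms order_refl] by (simp add: Vpi_def)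
    ultimately show "Vstar P H 0 x - Vpi P H \<pi> 0 x \<le> real H" by simp
    show "0 \<le> Vstar P H 0 x - Vpi P H \<pi> 0 x" using Vpi_le_Vstar[of P H \<pi> x] by simp
  qed
  from convex_combination_bounds[where p="pmf \<rho>", OF pmf_nonneg _ this]
  show "0 \<le> gap P \<pi>" "gap P \<pi> \<le> real H" by (simp_all add: gap_def sum_pmf_eq_1)
qed

lemma measurable_gap: "(\<lambda>P. gap P \<pi>) \<in> borel_measurable (model_space H)"
  unfolding gap_def by measurable

lemma measurable_ep_likelihood: "(\<lambda>P. ep_likelihood H P e) \<in> borel_measurable (model_space H)"
  unfolding ep_likelihood_def by (intro borel_measurable_prod measurable_coord) (auto simp: ep_index_def)

lemma measurable_mean_gap: "(\<lambda>P. \<integral>\<xi>. gap P (pol h \<xi>) \<partial>noise H) \<in> borel_measurable (model_space H)"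
  unfolding policy_mixture(2)[of "gap P" for P, OF gap_restrict]
  by (intro borel_measurable_sum borel_measurable_times measurable_gap) auto

lemma mean_gap_bounds:
  assumes "valid_model H P"
  shows "\<bar>\<integral>\<xi>. gap P (pol h \<xi>) \<partial>noise H\<bar> \<le> real H"
proof -
  have "0 \<le> (\<integral>\<xi>. gap P (pol h \<xi>) \<partial>noise H)"
    by (intro Bochner_Integration.integral_nonneg gap_bounds assms)
  moreover have "(\<integral>\<xi>. gap P (pol h \<xi>) \<partial>noise H) \<le> real H"
    by (intro noise.integral_le_const integrable_gap AE_I2 gap_bounds assms)
  ultimately show ?thesis by simp
qed

text \<open>Bayes' rule for a whole history in unnormalized form. Episodes are removed from the end
  and the likelihood of the removed one joins the integrand, hence the general \<open>f\<close>.
  Noise enters through the factor \<open>compat\<close>, which is free of the model.\<close>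

lemma integral_weight:
  assumes "f \<in> borel_measurable (model_space H)" "\<And>P. valid_model H P \<Longrightarrow> \<bar>f P\<bar> \<le> C"
  shows "(\<integral>P. (\<Prod>l<length h. kernel P (take l h) (h ! l)) * f P \<partial>mdp_prior H \<alpha>)
    = weight h * (\<integral>P. f P \<partial>mdp_prior H (posterior \<alpha> h))"
  using assms
proof (induction h arbitrary: f rule: rev_induct)
  case (snoc e h)
  let ?c = "pmf \<rho> (fst e) * compat h e"
  have "(\<integral>P. (\<Prod>l<length (h @ [e]). kernel P (take l (h @ [e])) ((h @ [e]) ! l)) * f P \<partial>mdp_prior H \<alpha>)
    = (\<integral>P. ?c * ((\<Prod>l<length h. kernel P (take l h) (h ! l)) * (ep_likelihood H P e * f P)) \<partial>mdp_prior H \<alpha>)"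
    by (simp add: nth_append kernel_eq[of _ h] mult_ac)
  also have "\<dots> = ?c * (\<integral>P. (\<Prod>l<length h. kernel P (take l h) (h ! l)) * (ep_likelihood H P e * f P) \<partial>mdp_prior H \<alpha>)"
    by (rule integral_mult_right_zero)
  also have "(\<integral>P. (\<Prod>l<length h. kernel P (take l h) (h ! l)) * (ep_likelihood H P e * f P) \<partial>mdp_prior H \<alpha>)
    = weight h * (\<integral>P. ep_likelihood H P e * f P \<partial>mdp_prior H (posterior \<alpha> h))"
  proof (rule snoc.IH)
    show "(\<lambda>P. ep_likelihood H P e * f P) \<in> borel_measurable (model_space H)"
      by (intro borel_measurable_times measurable_ep_likelihood snoc.prems)
    show "\<bar>ep_likelihood H P e * f P\<bar> \<le> C" if P: "valid_model H P" for P
      using valid_likelihood[OF P, of e] snoc.prems(2)[OF P]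
      by (simp add: abs_mult) (metis abs_ge_zero mult_left_le_one_le order_trans)
  qed
  also have "(\<integral>P. ep_likelihood H P e * f P \<partial>mdp_prior H (posterior \<alpha> h))
    = ep_likelihood H (post_mean h) e * (\<integral>P. f P \<partial>mdp_prior H (posterior \<alpha> (h @ [e])))"
    unfolding post_mean_def by (rule mdp_prior_episode_update[OF \<alpha> snoc.prems])
  finally show ?case by (simp add: weight_snoc kernel_eq[of "post_mean h"] mult_ac)
qed simp

text \<open>Episode probabilities sum to one, so all episodes after \<open>l\<close> sum out and the
  regret of episode \<open>l\<close> involves only the prefix before it and its own noise.\<close>

lemma regret_decomposition:
  assumes "valid_model H P"
  shows "(\<Sum>es\<in>hists L. hist_prob \<theta> v lam H \<rho> P \<Xi> es * hist_regret \<theta> v lam H P \<Xi> es)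
    = (\<Sum>l<L. \<Sum>h\<in>hists l. hist_prob \<theta> v lam H \<rho> P \<Xi> h * gap P (pol h (\<Xi> l)))"
proof (induction L)
  case (Suc L)
  have prob: "hist_prob \<theta> v lam H \<rho> P \<Xi> (h @ [e]) = hist_prob \<theta> v lam H \<rho> P \<Xi> h * ep_prob \<rho> P H (pol h (\<Xi> (length h))) e" for h e
    by (simp add: hist_prob_def nth_append pol_def)
  have regret: "hist_regret \<theta> v lam H P \<Xi> (h @ [e]) = hist_regret \<theta> v lam H P \<Xi> h
      + (Vstar P H 0 (fst e) - Vpi P H (pol h (\<Xi> (length h))) 0 (fst e))" for h e
    by (simp add: hist_regret_def nth_append pol_def)
  have gap: "(\<Sum>e\<in>episodes H. ep_prob \<rho> P H \<pi> e * (Vstar P H 0 (fst e) - Vpi P H \<pi> 0 (fst e))) = gap P \<pi>" for \<pi>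
    unfolding gap_def by (rule sum_ep_prob[OF assms, of \<rho> \<pi> "\<lambda>x. Vstar P H 0 x - Vpi P H \<pi> 0 x"])
  have "(\<Sum>es\<in>hists (Suc L). hist_prob \<theta> v lam H \<rho> P \<Xi> es * hist_regret \<theta> v lam H P \<Xi> es)
     = (\<Sum>h\<in>hists L. hist_prob \<theta> v lam H \<rho> P \<Xi> h * hist_regret \<theta> v lam H P \<Xi> h * (\<Sum>e\<in>episodes H. ep_prob \<rho> P H (pol h (\<Xi> (length h))) e)
         + hist_prob \<theta> v lam H \<rho> P \<Xi> h * (\<Sum>e\<in>episodes H. ep_prob \<rho> P H (pol h (\<Xi> (length h))) e *
            (Vstar P H 0 (fst e) - Vpi P H (pol h (\<Xi> (length h))) 0 (fst e))))"
    unfolding sum_hists_Suc prob regret sum_distrib_left sum.distrib[symmetric]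
    by (intro sum.cong refl) (simp add: algebra_simps)
  also have "\<dots> = (\<Sum>h\<in>hists L. hist_prob \<theta> v lam H \<rho> P \<Xi> h * hist_regret \<theta> v lam H P \<Xi> h
      + hist_prob \<theta> v lam H \<rho> P \<Xi> h * gap P (pol h (\<Xi> L)))"
    by (intro sum.cong refl) (simp add: gap hists_def sum_ep_prob_1[OF assms])
  finally show ?case using Suc by (simp add: sum.distrib)
qed (simp add: hist_regret_def)

lemma integral_hist_prob_gap:
  assumes h: "h \<in> hists l" and l: "l < L"
  shows "integrable (PiM {..<L} (\<lambda>_. noise H)) (\<lambda>\<Xi>. hist_prob \<theta> v lam H \<rho> P \<Xi> h * gap P (pol h (\<Xi> l)))" (is ?int)
    and "(\<integral>\<Xi>. hist_prob \<theta> v lam H \<rho> P \<Xi> h * gap P (pol h (\<Xi> l)) \<partial>PiM {..<L} (\<lambda>_. noise H))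
      = (\<Prod>k<length h. kernel P (take k h) (h ! k)) * (\<integral>\<xi>. gap P (pol h \<xi>) \<partial>noise H)" (is ?eq)
proof -
  interpret N: product_sigma_finite "\<lambda>_::nat. noise H :: (nat \<times> 'x \<times> 'a \<Rightarrow> real) measure"
    by (intro product_sigma_finite.intro noise.sigma_finite_measure_axioms)
  have len: "length h = l" using h by (simp add: hists_def)
  \<comment> \<open>One factor per episode, each a function of that episode's noise alone:
    probabilities before \<open>l\<close>, the gap at \<open>l\<close>, and 1 afterwards, where the
    noise integrates out.\<close>
  define F where "F k \<xi> = (if k < l then ep_prob \<rho> P H (pol (take k h) \<xi>) (h ! k) else if k = l then gap P (pol h \<xi>) else 1)" for k \<xi>
  have split: "(\<Prod>k<L. g k) = (\<Prod>k<l. g k) * g l" if "\<And>k. l < k \<Longrightarrow> g k = 1" for g :: "nat \<Rightarrow> real"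
  proof -
    have "(\<Prod>k<L. g k) = (\<Prod>k<Suc l. g k)" using l that by (intro prod.mono_neutral_right) auto
    then show ?thesis by simp
  qed
  have eq: "hist_prob \<theta> v lam H \<rho> P \<Xi> h * gap P (pol h (\<Xi> l)) = (\<Prod>k<L. F k (\<Xi> k))" for \<Xi>
    by (subst split) (auto simp: F_def hist_prob_def len pol_def)
  have int: "integrable (noise H) (F k)" for k
    unfolding F_def by (cases "k < l"; cases "k = l") (auto simp: integrable_ep_prob integrable_gap)
  show ?int unfolding eq by (rule N.product_integrable_prod) (auto intro: int)
  have "(\<integral>\<Xi>. (\<Prod>k<L. F k (\<Xi> k)) \<partial>PiM {..<L} (\<lambda>_. noise H)) = (\<Prod>k<L. \<integral>\<xi>. F k \<xi> \<partial>noise H)"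
    by (rule N.product_integral_prod) (auto intro: int)
  also have "\<dots> = (\<Prod>k<l. \<integral>\<xi>. F k \<xi> \<partial>noise H) * (\<integral>\<xi>. F l \<xi> \<partial>noise H)"
    by (rule split) (simp add: F_def noise.prob_space)
  also have "\<dots> = (\<Prod>k<length h. kernel P (take k h) (h ! k)) * (\<integral>\<xi>. gap P (pol h \<xi>) \<partial>noise H)"
    by (simp add: F_def len kernel_def)
  finally show ?eq unfolding eq .
qed

text \<open>The inner integral can be rewritten by \<open>regret_decomposition\<close> for valid
  models only, hence almost everywhere, and \<open>integral_cong_AE\<close> then asks for
  measurability of the original form.\<close>

lemma measurable_inner_regret:
  "(\<lambda>P. \<integral>\<Xi>. (\<Sum>es\<in>hists L. hist_prob \<theta> v lam H \<rho> P \<Xi> es * hist_regret \<theta> v lam H P \<Xi> es) \<partial>PiM {..<L} (\<lambda>_. noise H))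
    \<in> borel_measurable (model_space H)"
proof -
  interpret N: product_sigma_finite "\<lambda>_::nat. noise H :: (nat \<times> 'x \<times> 'a \<Rightarrow> real) measure"
    by (intro product_sigma_finite.intro noise.sigma_finite_measure_axioms)
  let ?N = "PiM {..<L} (\<lambda>_. noise H)"
  \<comment> \<open>The regret of episode \<open>l\<close> is attached to the factor of that
    episode, so each summand is again a product over episodes with independent noise.\<close>
  define F where "F P es l k \<pi> = ep_prob \<rho> P H \<pi> (es ! k) *
    (if k = l then Vstar P H 0 (fst (es ! l)) - Vpi P H \<pi> 0 (fst (es ! l)) else 1)"
    for P es l k and \<pi> :: "('x, 'a) policy"
  have F: "F P es l k (restrict \<pi> {..<H}) = F P es l k \<pi>" for P es l k \<pi>
    by (simp add: F_def ep_prob_restrict Vpi_restrict)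
  have int: "integrable (noise H) (\<lambda>\<xi>. F P es l k (pol h \<xi>))" for P es l k h
    by (rule policy_mixture(1)) (rule F)
  have eq: "hist_prob \<theta> v lam H \<rho> P \<Xi> es * hist_regret \<theta> v lam H P \<Xi> es = (\<Sum>l<L. \<Prod>k<L. F P es l k (pol (take k es) (\<Xi> k)))"
    if "es \<in> hists L" for P \<Xi> es
  proof -
    have "length es = L" using that by (simp add: hists_def)
    then show ?thesis
      by (simp add: hist_prob_def hist_regret_def F_def prod.distrib sum_distrib_left pol_def)
  qed
  have "(\<integral>\<Xi>. (\<Sum>es\<in>hists L. hist_prob \<theta> v lam H \<rho> P \<Xi> es * hist_regret \<theta> v lam H P \<Xi> es) \<partial>?N)
    = (\<Sum>es\<in>hists L. \<Sum>l<L. \<Prod>k<L. \<integral>\<xi>. F P es l k (pol (take k es) \<xi>) \<partial>noise H)" for P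
  proof -
    have intp: "integrable ?N (\<lambda>\<Xi>. \<Prod>k<L. F P es l k (pol (take k es) (\<Xi> k)))" for es l
      by (rule N.product_integrable_prod) (auto intro: int)
    have "(\<integral>\<Xi>. (\<Sum>es\<in>hists L. hist_prob \<theta> v lam H \<rho> P \<Xi> es * hist_regret \<theta> v lam H P \<Xi> es) \<partial>?N)
      = (\<integral>\<Xi>. (\<Sum>es\<in>hists L. \<Sum>l<L. \<Prod>k<L. F P es l k (pol (take k es) (\<Xi> k))) \<partial>?N)"
      by (intro Bochner_Integration.integral_cong refl sum.cong eq)
    also have "\<dots> = (\<Sum>es\<in>hists L. \<Sum>l<L. \<integral>\<Xi>. (\<Prod>k<L. F P es l k (pol (take k es) (\<Xi> k))) \<partial>?N)"
      using intp by (simp add: Bochner_Integration.integral_sum Bochner_Integration.integrable_sum)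
    also have "\<dots> = (\<Sum>es\<in>hists L. \<Sum>l<L. \<Prod>k<L. \<integral>\<xi>. F P es l k (pol (take k es) \<xi>) \<partial>noise H)"
      by (intro sum.cong refl N.product_integral_prod) (auto intro: int)
    finally show ?thesis .
  qed
  moreover have "(\<lambda>P. \<integral>\<xi>. F P es l k (pol h \<xi>) \<partial>noise H) \<in> borel_measurable (model_space H)" for es l k h
  proof -
    have m: "(\<lambda>P. F P es l k \<pi>) \<in> borel_measurable (model_space H)" for \<pi>
      unfolding F_def ep_prob_eq_likelihood using measurable_ep_likelihood by measurable
    show ?thesis
      unfolding policy_mixture(2)[of "F P es l k" for P, OF F]
      by (intro borel_measurable_sum borel_measurable_times m) auto
  qed
  ultimately show ?thesis by simp
qed

theorem bayes_regret_eq: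
  "bayes_regret_rlsvi \<theta> v lam H \<rho> \<alpha> L
    = (\<Sum>l<L. \<Sum>h\<in>hists l. weight h * (\<integral>P. (\<integral>\<xi>. gap P (pol h \<xi>) \<partial>noise H) \<partial>mdp_prior H (posterior \<alpha> h)))"
proof -
  let ?G = "\<lambda>P h. \<integral>\<xi>. gap P (pol h \<xi>) \<partial>noise H"
  let ?K = "\<lambda>P h. \<Prod>k<length h. kernel P (take k h) (h ! k)"
  let ?R = "\<lambda>P. \<integral>\<Xi>. (\<Sum>es\<in>hists L. hist_prob \<theta> v lam H \<rho> P \<Xi> es * hist_regret \<theta> v lam H P \<Xi> es) \<partial>PiM {..<L} (\<lambda>_. noise H)"
  have R: "?R P = (\<Sum>l<L. \<Sum>h\<in>hists l. ?K P h * ?G P h)" if "valid_model H P" for P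
  proof -
    have "?R P = (\<Sum>l<L. \<Sum>h\<in>hists l. \<integral>\<Xi>. hist_prob \<theta> v lam H \<rho> P \<Xi> h * gap P (pol h (\<Xi> l)) \<partial>PiM {..<L} (\<lambda>_. noise H))"
      unfolding regret_decomposition[OF that]
      by (subst Bochner_Integration.integral_sum, (auto intro!: Bochner_Integration.integrable_sum integral_hist_prob_gap)[1],
          intro sum.cong refl Bochner_Integration.integral_sum, auto intro: integral_hist_prob_gap)
    also have "\<dots> = (\<Sum>l<L. \<Sum>h\<in>hists l. ?K P h * ?G P h)"
      by (intro sum.cong refl integral_hist_prob_gap(2)) auto
    finally show ?thesis .
  qed
  have Km: "(\<lambda>P. ?K P h) \<in> borel_measurable (model_space H)" for h
    unfolding kernel_eq by (intro borel_measurable_prod borel_measurable_times measurable_ep_likelihood) auto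
  have Kb: "0 \<le> ?K P h \<and> ?K P h \<le> 1" if P: "valid_model H P" for P h
  proof -
    have "kernel P g e \<le> 1" for g e
      unfolding kernel_def by (intro noise.integral_le_const integrable_ep_prob AE_I2 ep_prob_bounds P)
    then show ?thesis using kernel_nonneg[OF P] by (intro conjI prod_nonneg prod_le_1 ballI)
  qed
  have int: "integrable (mdp_prior H \<alpha>) (\<lambda>P. ?K P h * ?G P h)" for h
  proof (rule integrable_mdp_prior[OF \<alpha>])
    show "(\<lambda>P. ?K P h * ?G P h) \<in> borel_measurable (model_space H)"
      by (intro borel_measurable_times Km measurable_mean_gap)
    show "\<bar>?K P h * ?G P h\<bar> \<le> 1 * real H" if P: "valid_model H P" for P
      unfolding abs_mult using Kb[OF P, of h] mean_gap_bounds[OF P, of h] by (intro mult_mono) auto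
  qed
  have "bayes_regret_rlsvi \<theta> v lam H \<rho> \<alpha> L = (\<integral>P. ?R P \<partial>mdp_prior H \<alpha>)"
    by (simp add: bayes_regret_rlsvi_def hists_def)
  also have "\<dots> = (\<integral>P. (\<Sum>l<L. \<Sum>h\<in>hists l. ?K P h * ?G P h) \<partial>mdp_prior H \<alpha>)"
  proof (rule integral_cong_AE)
    show "AE P in mdp_prior H \<alpha>. ?R P = (\<Sum>l<L. \<Sum>h\<in>hists l. ?K P h * ?G P h)"
      using AE_mdp_prior_valid[OF \<alpha>] by eventually_elim (rule R)
    show "?R \<in> borel_measurable (mdp_prior H \<alpha>)"
      using measurable_inner_regret by (simp cong: measurable_cong_sets)
    have "(\<lambda>P. \<Sum>l<L. \<Sum>h\<in>hists l. ?K P h * ?G P h) \<in> borel_measurable (model_space H)"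
      by (intro borel_measurable_sum borel_measurable_times Km measurable_mean_gap)
    then show "(\<lambda>P. \<Sum>l<L. \<Sum>h\<in>hists l. ?K P h * ?G P h) \<in> borel_measurable (mdp_prior H \<alpha>)"
      by (simp cong: measurable_cong_sets)
  qed
  also have "\<dots> = (\<Sum>l<L. \<Sum>h\<in>hists l. \<integral>P. ?K P h * ?G P h \<partial>mdp_prior H \<alpha>)"
    by (simp add: Bochner_Integration.integral_sum Bochner_Integration.integrable_sum int)
  also have "\<dots> = (\<Sum>l<L. \<Sum>h\<in>hists l. weight h * (\<integral>P. ?G P h \<partial>mdp_prior H (posterior \<alpha> h)))"
    by (intro sum.cong refl integral_weight[where C="real H"] measurable_mean_gap mean_gap_bounds)
  finally show ?thesis .
qed

end

subsection \<open>Resampling one coordinate of a product measure\<close>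

context product_sigma_finite
begin

lemma nn_integral_PiM_resample:
  assumes I: "finite I" "i \<in> I" and prob: "prob_space (M i)" and f: "f \<in> borel_measurable (PiM I M)"
  shows "(\<integral>\<^sup>+ x. f x \<partial>PiM I M) = (\<integral>\<^sup>+ y. (\<integral>\<^sup>+ x. f (x(i := y)) \<partial>PiM I M) \<partial>M i)"
proof -
  define J where "J = I - {i}"
  have J: "insert i J = I" "i \<notin> J" "finite J" using I by (auto simp: J_def)
  have f': "f \<in> borel_measurable (PiM (insert i J) M)" using f by (simp add: J)
  have "(\<integral>\<^sup>+ x. f x \<partial>PiM I M) = (\<integral>\<^sup>+ y. (\<integral>\<^sup>+ x. f (x(i := y)) \<partial>PiM J M) \<partial>M i)"
    using product_nn_integral_insert_rev[OF J(3,2) f'] by (simp add: J)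
  also have "\<dots> = (\<integral>\<^sup>+ y. (\<integral>\<^sup>+ x. f (x(i := y)) \<partial>PiM I M) \<partial>M i)"
  proof (rule nn_integral_cong)
    fix y assume y: "y \<in> space (M i)"
    have "(\<lambda>x. x(i := y)) \<in> measurable (PiM (insert i J) M) (PiM (insert i J) M)"
      using y by (intro measurable_fun_upd[where J="insert i J"]) (auto intro: measurable_const)
    from measurable_compose[OF this f']
    have "(\<integral>\<^sup>+ x. f (x(i := y)) \<partial>PiM I M) = (\<integral>\<^sup>+ x. (\<integral>\<^sup>+ y'. f ((x(i := y'))(i := y)) \<partial>M i) \<partial>PiM J M)"
      using product_nn_integral_insert[OF J(3,2), of "\<lambda>x. f (x(i := y))"] by (simp add: J)
    then show "(\<integral>\<^sup>+ x. f (x(i := y)) \<partial>PiM J M) = (\<integral>\<^sup>+ x. f (x(i := y)) \<partial>PiM I M)"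
      by (simp add: prob_space.emeasure_space_1[OF prob])
  qed
  finally show ?thesis .
qed

text \<open>The outer integral keeps the full product, with the stale entry at \<open>i\<close>
  overwritten. Successive swaps therefore never change the index set. The Bochner statements follow
  from the equality of the two laws, which needs only indicator functions.\<close>

lemma integral_PiM_resample:
  fixes f :: "_ \<Rightarrow> real"
  assumes I: "finite I" "i \<in> I" and prob: "\<And>i. prob_space (M i)" and f: "integrable (PiM I M) f"
  shows "(\<integral>x. f x \<partial>PiM I M) = (\<integral>y. (\<integral>x. f (x(i := y)) \<partial>PiM I M) \<partial>M i)"
    and "(\<integral>x. f x \<partial>PiM I M) = (\<integral>x. (\<integral>y. f (x(i := y)) \<partial>M i) \<partial>PiM I M)"
    and "integrable (PiM I M) (\<lambda>x. \<integral>y. f (x(i := y)) \<partial>M i)"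
proof -
  interpret Q: prob_space "PiM I M" by (rule prob_space_PiM) (rule prob)
  interpret i: prob_space "M i" by (rule prob)
  interpret pair_sigma_finite "M i" "PiM I M" by unfold_locales
  have upd [measurable]: "(\<lambda>z. (snd z)(i := fst z)) \<in> measurable (M i \<Otimes>\<^sub>M PiM I M) (PiM I M)"
    using I by (intro measurable_fun_upd[where J=I]) auto
  have distr: "distr (M i \<Otimes>\<^sub>M PiM I M) (PiM I M) (\<lambda>z. (snd z)(i := fst z)) = PiM I M"
  proof (rule measure_eqI)
    fix A assume "A \<in> sets (distr (M i \<Otimes>\<^sub>M PiM I M) (PiM I M) (\<lambda>z. (snd z)(i := fst z)))"
    then have A [measurable]: "A \<in> sets (PiM I M)" by simp
    have "emeasure (distr (M i \<Otimes>\<^sub>M PiM I M) (PiM I M) (\<lambda>z. (snd z)(i := fst z))) A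
      = (\<integral>\<^sup>+ z. indicator A z \<partial>distr (M i \<Otimes>\<^sub>M PiM I M) (PiM I M) (\<lambda>z. (snd z)(i := fst z)))"
      by simp
    also have "\<dots> = (\<integral>\<^sup>+ z. indicator A ((snd z)(i := fst z)) \<partial>(M i \<Otimes>\<^sub>M PiM I M))"
      by (rule nn_integral_distr) measurable
    also have "\<dots> = (\<integral>\<^sup>+ y. (\<integral>\<^sup>+ x. indicator A (x(i := y)) \<partial>PiM I M) \<partial>M i)"
    proof -
      have "(\<lambda>z. indicator A ((snd z)(i := fst z)) :: ennreal) \<in> borel_measurable (M i \<Otimes>\<^sub>M PiM I M)"
        by measurable
      from Q.nn_integral_fst[OF this] show ?thesis by (simp only: fst_conv snd_conv)
    qed
    also have "\<dots> = emeasure (PiM I M) A"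
      using nn_integral_PiM_resample[OF I prob, of "indicator A"] A by simp
    finally show "emeasure (distr (M i \<Otimes>\<^sub>M PiM I M) (PiM I M) (\<lambda>z. (snd z)(i := fst z))) A = emeasure (PiM I M) A" .
  qed simp
  have fm [measurable]: "f \<in> borel_measurable (PiM I M)" using f by auto
  have int: "integrable (M i \<Otimes>\<^sub>M PiM I M) (\<lambda>z. f ((snd z)(i := fst z)))"
  proof -
    have "integrable (distr (M i \<Otimes>\<^sub>M PiM I M) (PiM I M) (\<lambda>z. (snd z)(i := fst z))) f"
      unfolding distr by (rule f)
    then show ?thesis by (rule integrable_distr[OF upd])
  qed
  have eq: "(\<integral>x. f x \<partial>PiM I M) = (\<integral>z. f ((snd z)(i := fst z)) \<partial>(M i \<Otimes>\<^sub>M PiM I M))"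
    using integral_distr[OF upd fm] unfolding distr .
  show "(\<integral>x. f x \<partial>PiM I M) = (\<integral>y. (\<integral>x. f (x(i := y)) \<partial>PiM I M) \<partial>M i)"
    unfolding eq using integral_fst'[OF int] by simp
  have int': "integrable (M i \<Otimes>\<^sub>M PiM I M) (case_prod (\<lambda>y x. f (x(i := y))))"
    using int by (simp add: split_beta')
  show "(\<integral>x. f x \<partial>PiM I M) = (\<integral>x. (\<integral>y. f (x(i := y)) \<partial>M i) \<partial>PiM I M)"
    unfolding eq using integral_snd[OF int'] by (simp add: split_beta')
  show "integrable (PiM I M) (\<lambda>x. \<integral>y. f (x(i := y)) \<partial>M i)"
    using integrable_snd[OF int'] by simp
qed

end

subsection \<open>Increasing convex functions\<close>

text \<open>The Lipschitz constant 1 is the one that survives every operation in a backup: maxima,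
  expectations and weighted sums of total weight at most one.\<close>

definition inc_cvx :: "(real \<Rightarrow> real) \<Rightarrow> bool" where
  "inc_cvx u \<longleftrightarrow> cvx_lip 1 u \<and> mono u"

lemma inc_cvxI:
  assumes "\<And>t x y. 0 < t \<Longrightarrow> t < 1 \<Longrightarrow> u ((1 - t) * x + t * y) \<le> (1 - t) * u x + t * u y"
    and "\<And>x y. x \<le> y \<Longrightarrow> u x \<le> u y" and "\<And>x y. x \<le> y \<Longrightarrow> u y \<le> u x + (y - x)"
  shows "inc_cvx u"
proof -
  have "\<bar>u x - u y\<bar> \<le> 1 * \<bar>x - y\<bar>" for x y
    using assms(2,3)[of x y] assms(2,3)[of y x] by (cases "x \<le> y") auto
  moreover have "convex_on UNIV u"
    using assms(1) by (intro convex_onI) auto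
  ultimately show ?thesis using assms(2) by (simp add: inc_cvx_def cvx_lip_def monoI)
qed

lemma inc_cvxD:
  assumes "inc_cvx u"
  shows "0 \<le> t \<Longrightarrow> t \<le> 1 \<Longrightarrow> u ((1 - t) * x + t * y) \<le> (1 - t) * u x + t * u y"
    and "x \<le> y \<Longrightarrow> u x \<le> u y" and "x \<le> y \<Longrightarrow> u y \<le> u x + (y - x)"
  using assms cvx_lip_convex[of 1 u t x y] cvx_lipD[of 1 u y x] by (auto simp: inc_cvx_def dest: monoD)

lemma inc_cvx_const: "inc_cvx (\<lambda>_. c)"
  by (rule inc_cvxI) (auto simp: algebra_simps)

lemma inc_cvx_id: "inc_cvx (\<lambda>z. z)"
  by (rule inc_cvxI) auto

text \<open>Total weight below one occurs in the regression, where the constant prior value takes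
  the share \<open>\<beta> / mass\<close>.\<close>

lemma inc_cvx_affine_sum:
  fixes q :: "'o::finite \<Rightarrow> real"
  assumes q: "\<And>w. 0 \<le> q w" "sum q UNIV \<le> 1" and f: "\<And>w. inc_cvx (f w)"
  shows "inc_cvx (\<lambda>z. c + (\<Sum>w\<in>UNIV. q w * (d w + f w z)))"
proof (rule inc_cvxI)
  fix t x y :: real assume t: "0 < t" "t < 1"
  have "(\<Sum>w\<in>UNIV. q w * (d w + f w ((1 - t) * x + t * y)))
      \<le> (\<Sum>w\<in>UNIV. q w * (d w + ((1 - t) * f w x + t * f w y)))"
    using t q inc_cvxD(1)[OF f] by (intro sum_mono mult_left_mono add_left_mono) auto
  also have "\<dots> = (\<Sum>w\<in>UNIV. (1 - t) * (q w * (d w + f w x)) + t * (q w * (d w + f w y)))"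
    by (intro sum.cong) (auto simp: algebra_simps)
  also have "\<dots> = (1 - t) * (\<Sum>w\<in>UNIV. q w * (d w + f w x)) + t * (\<Sum>w\<in>UNIV. q w * (d w + f w y))"
    by (simp only: sum.distrib sum_distrib_left)
  finally show "c + (\<Sum>w\<in>UNIV. q w * (d w + f w ((1 - t) * x + t * y)))
      \<le> (1 - t) * (c + (\<Sum>w\<in>UNIV. q w * (d w + f w x))) + t * (c + (\<Sum>w\<in>UNIV. q w * (d w + f w y)))"
    by (simp add: algebra_simps)
next
  fix x y :: real assume xy: "x \<le> y"
  show "c + (\<Sum>w\<in>UNIV. q w * (d w + f w x)) \<le> c + (\<Sum>w\<in>UNIV. q w * (d w + f w y))"
    using q inc_cvxD(2)[OF f xy] by (intro sum_mono mult_left_mono add_left_mono) auto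
  have "(\<Sum>w\<in>UNIV. q w * (d w + f w y)) \<le> (\<Sum>w\<in>UNIV. q w * (d w + (f w x + (y - x))))"
    using q inc_cvxD(3)[OF f xy] by (intro sum_mono mult_left_mono add_left_mono) auto
  also have "\<dots> = (\<Sum>w\<in>UNIV. q w * (d w + f w x)) + sum q UNIV * (y - x)"
    by (simp add: algebra_simps sum.distrib sum_subtractf sum_distrib_left)
  also have "sum q UNIV * (y - x) \<le> 1 * (y - x)" using q xy by (intro mult_right_mono) auto
  finally show "c + (\<Sum>w\<in>UNIV. q w * (d w + f w y)) \<le> c + (\<Sum>w\<in>UNIV. q w * (d w + f w x)) + (y - x)" by simp
qed

lemma inc_cvx_Max:
  fixes f :: "real \<Rightarrow> 'a::finite \<Rightarrow> real"
  assumes f: "\<And>a. inc_cvx (\<lambda>z. f z a)"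
  shows "inc_cvx (\<lambda>z. Max (range (f z)))"
proof (rule inc_cvxI)
  have ge: "f z a \<le> Max (range (f z))" for z a by (rule Max_ge) auto
  have le: "Max (range (f z)) \<le> c" if "\<And>a. f z a \<le> c" for z c using that by (subst Max_le_iff) auto
  { fix t x y :: real assume t: "0 < t" "t < 1"
    show "Max (range (f ((1 - t) * x + t * y))) \<le> (1 - t) * Max (range (f x)) + t * Max (range (f y))"
    proof (rule le)
      fix a
      have "f ((1 - t) * x + t * y) a \<le> (1 - t) * f x a + t * f y a"
        using inc_cvxD(1)[OF f[of a]] t by simp
      also have "\<dots> \<le> (1 - t) * Max (range (f x)) + t * Max (range (f y))"
        using t by (intro add_mono mult_left_mono ge) auto
      finally show "f ((1 - t) * x + t * y) a \<le> (1 - t) * Max (range (f x)) + t * Max (range (f y))" .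
    qed }
  fix x y :: real assume xy: "x \<le> y"
  show "Max (range (f x)) \<le> Max (range (f y))"
    by (rule le) (rule order_trans[OF inc_cvxD(2)[OF f xy] ge])
  show "Max (range (f y)) \<le> Max (range (f x)) + (y - x)"
    by (rule le) (rule order_trans[OF inc_cvxD(3)[OF f xy] add_right_mono[OF ge]])
qed

lemma (in prob_space) inc_cvx_integral:
  assumes f: "\<And>\<omega>. inc_cvx (\<lambda>z. f z \<omega>)" and int: "\<And>z. integrable M (f z)"
  shows "inc_cvx (\<lambda>z. \<integral>\<omega>. f z \<omega> \<partial>M)"
proof (rule inc_cvxI)
  fix t x y :: real assume t: "0 < t" "t < 1"
  have "(\<integral>\<omega>. f ((1 - t) * x + t * y) \<omega> \<partial>M) \<le> (\<integral>\<omega>. (1 - t) * f x \<omega> + t * f y \<omega> \<partial>M)"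
    using t inc_cvxD(1)[OF f] int by (intro Bochner_Integration.integral_mono) auto
  also have "\<dots> = (1 - t) * (\<integral>\<omega>. f x \<omega> \<partial>M) + t * (\<integral>\<omega>. f y \<omega> \<partial>M)"
    using int by simp
  finally show "(\<integral>\<omega>. f ((1 - t) * x + t * y) \<omega> \<partial>M) \<le> (1 - t) * (\<integral>\<omega>. f x \<omega> \<partial>M) + t * (\<integral>\<omega>. f y \<omega> \<partial>M)" .
next
  fix x y :: real assume xy: "x \<le> y"
  show "(\<integral>\<omega>. f x \<omega> \<partial>M) \<le> (\<integral>\<omega>. f y \<omega> \<partial>M)"
    using int inc_cvxD(2)[OF f xy] by (intro Bochner_Integration.integral_mono) auto
  have "(\<integral>\<omega>. f y \<omega> \<partial>M) \<le> (\<integral>\<omega>. f x \<omega> + (y - x) \<partial>M)"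
    using int inc_cvxD(3)[OF f xy] by (intro Bochner_Integration.integral_mono) auto
  then show "(\<integral>\<omega>. f y \<omega> \<partial>M) \<le> (\<integral>\<omega>. f x \<omega> \<partial>M) + (y - x)"
    using int by (simp add: prob_space)
qed

subsection \<open>Optimism of the randomized value functions\<close>

locale rlsvi_tuned =
  fixes H :: nat and \<beta> :: real and \<rho> :: "'x::finite pmf"
    and \<alpha> :: "nat \<times> 'x \<times> 'a::finite \<Rightarrow> bool \<times> 'x \<Rightarrow> real"
  assumes H: "0 < H" and \<beta>: "2 \<le> \<beta>" and \<alpha>_nonneg: "\<And>i w. 0 \<le> \<alpha> i w" and sum_\<alpha>: "\<And>i. sum (\<alpha> i) UNIV = \<beta>"

sublocale rlsvi_tuned \<subseteq> rlsvi_run "\<lambda>_. real H" "(real H)\<^sup>2" "(real H)\<^sup>2 / \<beta>" H \<rho> \<alpha>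
  using \<beta> \<alpha>_nonneg sum_\<alpha> by unfold_locales (auto simp: valid_param_def)

context rlsvi_tuned
begin

text \<open>Total pseudocount of the posterior and, up to the factor \<open>v\<close>, precision of
  the regression; the choice \<open>v / lam = \<beta>\<close> makes the two coincide.\<close>

definition mass :: "('x, 'a) episode list \<Rightarrow> nat \<times> 'x \<times> 'a \<Rightarrow> real" where
  "mass h i = \<beta> + real (visits h i)"

abbreviation counts :: "('x, 'a) episode list \<Rightarrow> nat \<times> 'x \<times> 'a \<Rightarrow> bool \<times> 'x \<Rightarrow> nat" where
  "counts h \<equiv> \<lambda>(t, x, a). count_list (data h t x a)"

lemma mass: "sum (posterior \<alpha> h i) UNIV = mass h i" "0 < mass h i" "\<beta> \<le> mass h i"
  using \<beta> by (auto simp: sum_posterior sum_\<alpha> mass_def)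

lemma sum_counts: "(\<Sum>w\<in>UNIV. counts h i w) = visits h i"
  by (cases i) (simp add: visits_def sum_count_list)

abbreviation F_update where
  "F_update h \<equiv> rlsvi_F (\<lambda>_. real H) ((real H)\<^sup>2) ((real H)\<^sup>2 / \<beta>) h"

text \<open>Puts the regression into the form of a posterior mean: the same weights on the counts as
  under the Dirichlet posterior, all pseudocounts placed on the value \<open>H\<close>, and noise of
  standard deviation \<open>H / sqrt mass\<close>.\<close>

lemma rlsvi_F_eq:
  "F_update h \<xi> t Q x a
    = (\<beta> * real H / mass h (t, x, a) + real H / sqrt (mass h (t, x, a)) * \<xi> (t, x, a))
      + (\<Sum>w\<in>UNIV. real (counts h (t, x, a) w) / mass h (t, x, a) * (of_bool (fst w) + Max (range (Q (snd w)))))"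
proof -
  let ?b = "mass h (t, x, a)"
  have b: "0 < ?b" by (rule mass)
  have h: "0 < real H" using H by simp
  have var: "rlsvi_var ((real H)\<^sup>2) ((real H)\<^sup>2 / \<beta>) h t x a = (real H)\<^sup>2 / ?b"
    using h \<beta> b by (simp add: rlsvi_var_def mass_def visits_def add_divide_distrib[symmetric] inverse_eq_divide)
  have list: "(\<Sum>w\<leftarrow>data h t x a. g w) = (\<Sum>w\<in>UNIV. real (count_list (data h t x a) w) * g w)" for g :: "_ \<Rightarrow> real"
  proof -
    have "(\<Sum>w\<leftarrow>xs. g w) = (\<Sum>w\<in>UNIV. real (count_list xs w) * g w)" for xs
    proof (induction xs)
      case (Cons y ys)
      have "real (count_list (y # ys) w) * g w = (if w = y then g w else 0) + real (count_list ys w) * g w" for w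
        by (auto simp: distrib_right)
      then show ?case by (simp add: Cons sum.distrib del: count_list.simps)
    qed simp
    then show ?thesis .
  qed
  let ?S = "\<Sum>w\<in>UNIV. real (count_list (data h t x a) w) * (of_bool (fst w) + Max (range (Q (snd w))))"
  have "(real H)\<^sup>2 / ?b * (real H / ((real H)\<^sup>2 / \<beta>)) = \<beta> * real H / ?b"
       "(real H)\<^sup>2 / ?b * (1 / (real H)\<^sup>2 * ?S) = ?S / ?b"
       "sqrt ((real H)\<^sup>2 / ?b) = real H / sqrt ?b"
    using h b by (simp_all add: real_sqrt_divide)
  then have "F_update h \<xi> t Q x a = \<beta> * real H / ?b + ?S / ?b + real H / sqrt ?b * \<xi> (t, x, a)"
    unfolding rlsvi_F_def var list by (simp only: distrib_left)
  also have "?S / ?b = (\<Sum>w\<in>UNIV. real (counts h (t, x, a) w) / ?b * (of_bool (fst w) + Max (range (Q (snd w)))))"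
    by (simp add: sum_divide_distrib)
  finally show ?thesis by (simp only: add_ac)
qed

text \<open>Interpolates between two value functions: \<open>J = {}\<close> gives the optimal one of
  the model \<open>P\<close>, \<open>J = coords H\<close> the randomized one. \<open>J\<close>
  collects the coordinates whose backups have been exchanged.\<close>

primrec hybrid :: "('x, 'a) episode list \<Rightarrow> (nat \<times> 'x \<times> 'a) set \<Rightarrow> ('x, 'a) model \<Rightarrow> (nat \<times> 'x \<times> 'a \<Rightarrow> real)
    \<Rightarrow> nat \<Rightarrow> 'x \<Rightarrow> 'a \<Rightarrow> real" where
  "hybrid h J P \<xi> 0 = (\<lambda>x a. 0)"
| "hybrid h J P \<xi> (Suc k) = (\<lambda>x a. let t = H - Suc k in
    if (t, x, a) \<in> J then F_update h \<xi> t (hybrid h J P \<xi> k) x a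
    else (\<Sum>w\<in>UNIV. P (t, x, a) w * (of_bool (fst w) + Max (range (hybrid h J P \<xi> k (snd w))))))"

text \<open>The backup at \<open>i\<close> is replaced by a free variable \<open>z\<close>, so that
  the rest of the recursion becomes visible as a function of that single backup.\<close>

primrec pinned :: "('x, 'a) episode list \<Rightarrow> (nat \<times> 'x \<times> 'a) set \<Rightarrow> ('x, 'a) model \<Rightarrow> (nat \<times> 'x \<times> 'a \<Rightarrow> real)
    \<Rightarrow> nat \<times> 'x \<times> 'a \<Rightarrow> real \<Rightarrow> nat \<Rightarrow> 'x \<Rightarrow> 'a \<Rightarrow> real" where
  "pinned h J P \<xi> i z 0 = (\<lambda>x a. 0)"
| "pinned h J P \<xi> i z (Suc k) = (\<lambda>x a. let t = H - Suc k in
    if (t, x, a) = i then z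
    else if (t, x, a) \<in> J then F_update h \<xi> t (pinned h J P \<xi> i z k) x a
    else (\<Sum>w\<in>UNIV. P (t, x, a) w * (of_bool (fst w) + Max (range (pinned h J P \<xi> i z k (snd w))))))"

lemma hybrid_eq_pinned:
  assumes "k0 < H" "k \<le> H"
  shows "hybrid h J P \<xi> k x a = pinned h J P \<xi> (H - Suc k0, x0, a0) (hybrid h J P \<xi> (Suc k0) x0 a0) k x a"
proof -
  define Z where "Z = hybrid h J P \<xi> (Suc k0) x0 a0"
  have "hybrid h J P \<xi> k x a = pinned h J P \<xi> (H - Suc k0, x0, a0) Z k x a"
    using assms(2)
  proof (induction k arbitrary: x a)
    case (Suc k)
    have IH: "hybrid h J P \<xi> k = pinned h J P \<xi> (H - Suc k0, x0, a0) Z k"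
      using Suc by (intro ext) auto
    show ?case
    proof (cases "(H - Suc k, x, a) = (H - Suc k0, x0, a0)")
      case True
      then have "k = k0" "x = x0" "a = a0" using Suc.prems assms(1) by auto
      then show ?thesis by (simp add: Let_def Z_def)
    next
      case False
      then show ?thesis unfolding hybrid.simps(2) pinned.simps(2) IH[symmetric] Let_def by (simp only: False if_False)
    qed
  qed simp
  then show ?thesis by (simp only: Z_def)
qed

text \<open>Once the entry at \<open>i\<close> is pinned, neither the transition row nor the noise
  at \<open>i\<close> is read, nor the membership of \<open>i\<close> in \<open>J\<close>. The same
  function of \<open>z\<close> therefore describes the situation before and after the swap.\<close>

lemma pinned_cong:
  "pinned h J (P(i := p)) \<xi> i z k = pinned h J P \<xi> i z k"
  "pinned h (insert i J) P (\<xi>(i := e)) i z k = pinned h J P \<xi> i z k"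
  by (induction k) (auto simp: fun_eq_iff Let_def rlsvi_F_def)

lemma inc_cvx_pinned:
  assumes "valid_model H P" "k \<le> H"
  shows "inc_cvx (\<lambda>z. pinned h J P \<xi> i z k x a)"
  using assms(2)
proof (induction k arbitrary: x a)
  case (Suc k)
  let ?t = "H - Suc k"
  have t: "?t < H" using Suc.prems by simp
  have V: "inc_cvx (\<lambda>z. Max (range (pinned h J P \<xi> i z k y)))" for y
    using Suc by (intro inc_cvx_Max) auto
  consider "(?t, x, a) = i" | "(?t, x, a) \<noteq> i" "(?t, x, a) \<in> J" | "(?t, x, a) \<noteq> i" "(?t, x, a) \<notin> J" by blast
  then show ?case
  proof cases
    case 1
    then show ?thesis by (simp add: Let_def inc_cvx_id)
  next
    case 2
    have "(\<Sum>w\<in>UNIV. real (counts h (?t, x, a) w) / mass h (?t, x, a)) = real (visits h (?t, x, a)) / mass h (?t, x, a)"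
      by (simp only: sum_counts[symmetric] of_nat_sum sum_divide_distrib)
    also have "\<dots> \<le> 1" using \<beta> by (simp add: mass_def)
    finally show ?thesis
      using 2 mass(2)[of h "(?t, x, a)"] unfolding pinned.simps Let_def rlsvi_F_eq
      by (simp only: if_False if_True, intro inc_cvx_affine_sum V) (auto simp: less_imp_le)
  next
    case 3
    have "inc_cvx (\<lambda>z. 0 + (\<Sum>w\<in>UNIV. P (?t, x, a) w * (of_bool (fst w) + Max (range (pinned h J P \<xi> i z k (snd w))))))"
      by (intro inc_cvx_affine_sum V valid_modelD[OF assms(1) t]) (simp add: valid_modelD[OF assms(1) t])
    then show ?thesis using 3 by (simp add: Let_def)
  qed
qed (simp add: inc_cvx_const)

lemma hybrid_future:
  assumes "\<And>t x a. (t, x, a) \<in> J \<Longrightarrow> t \<le> t0" "k \<le> H - Suc t0"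
  shows "hybrid h J P \<xi> k = hybrid h {} P \<xi>' k" "hybrid h J (P((t0, x0, a0) := p)) \<xi> k = hybrid h J P \<xi> k"
  using assms(2)
proof (induction k)
  case (Suc k)
  { case 1
    have "(H - Suc k, x, a) \<notin> J" for x a using assms(1)[of "H - Suc k" x a] 1 by auto
    with Suc(1) 1 show ?case by (auto simp: fun_eq_iff Let_def) }
  { case 2
    have "(H - Suc k, x, a) \<notin> J" "(H - Suc k, x, a) \<noteq> (t0, x0, a0)" for x a using assms(1)[of "H - Suc k" x a] 2 by auto
    with Suc(2) 2 show ?case by (auto simp: fun_eq_iff Let_def) }
qed auto

lemma hybrid_empty_bounds:
  assumes "valid_model H P" "k \<le> H"
  shows "0 \<le> hybrid h {} P \<xi> k x a \<and> hybrid h {} P \<xi> k x a \<le> real k"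
  using assms(2)
proof (induction k arbitrary: x a)
  case (Suc k)
  then have t: "H - Suc k < H" by simp
  note v = valid_modelD[OF assms(1) t]
  have "0 \<le> of_bool (fst w) + Max (range (hybrid h {} P \<xi> k (snd w)))"
       "of_bool (fst w) + Max (range (hybrid h {} P \<xi> k (snd w))) \<le> real (Suc k)" for w
  proof -
    have IH: "0 \<le> hybrid h {} P \<xi> k (snd w) b" "hybrid h {} P \<xi> k (snd w) b \<le> real k" for b
      using Suc by auto
    have "0 \<le> Max (range (hybrid h {} P \<xi> k (snd w)))"
      by (rule order_trans[OF IH(1)[of undefined] Max_ge]) auto
    moreover have "Max (range (hybrid h {} P \<xi> k (snd w))) \<le> real k"
      using IH(2) by (subst Max_le_iff) auto
    ultimately show "0 \<le> of_bool (fst w) + Max (range (hybrid h {} P \<xi> k (snd w)))"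
       "of_bool (fst w) + Max (range (hybrid h {} P \<xi> k (snd w))) \<le> real (Suc k)"
      unfolding of_nat_Suc of_bool_def by (cases "fst w"; simp only: if_True if_False; linarith)+
  qed
  from convex_combination_bounds[OF v(1,2) this] show ?case by (simp add: Let_def)
qed simp

lemma Vrem_le_hybrid:
  assumes "valid_model H P" "k \<le> H"
  shows "Vrem P \<pi> H k x \<le> Max (range (hybrid h {} P \<xi> k x))"
  using assms(2)
proof (induction k arbitrary: x)
  case (Suc k)
  let ?t = "H - Suc k"
  have t: "?t < H" using Suc.prems by simp
  have "Vrem P \<pi> H (Suc k) x \<le> hybrid h {} P \<xi> (Suc k) x (\<pi> ?t x)"
    using Suc valid_modelD(1)[OF assms(1) t] by (auto simp: Let_def intro!: sum_mono mult_left_mono)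
  also have "\<dots> \<le> Max (range (hybrid h {} P \<xi> (Suc k) x))" by (rule Max_ge) auto
  finally show ?case .
qed simp

lemma Vstar_le_hybrid:
  assumes "valid_model H P"
  shows "Vstar P H 0 x \<le> Max (range (hybrid h {} P \<xi> H x))"
  using Vrem_le_hybrid[OF assms order_refl] by (intro Vstar_le) (simp add: Vpi_def)

lemma hybrid_coords:
  assumes "k \<le> H"
  shows "hybrid h (coords H) P \<xi> k = rlsvi_Qrem (\<lambda>_. real H) ((real H)\<^sup>2) ((real H)\<^sup>2 / \<beta>) H h \<xi> k"
  using assms
proof (induction k)
  case (Suc k)
  then have IH: "hybrid h (coords H) P \<xi> k = rlsvi_Qrem (\<lambda>_. real H) ((real H)\<^sup>2) ((real H)\<^sup>2 / \<beta>) H h \<xi> k"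
    by simp
  have "(H - Suc k, x, a) \<in> coords H" for x :: 'x and a :: 'a using Suc.prems by simp
  then show ?case unfolding hybrid.simps(2) rlsvi_Qrem.simps(2) IH Let_def by (simp only: if_True)
qed simp

text \<open>A crude envelope whose only purpose is integrability; it does not enter the regret
  rate.\<close>

definition noise_bound :: "(nat \<times> 'x \<times> 'a \<Rightarrow> real) \<Rightarrow> real" where
  "noise_bound \<xi> = real H + real H * (\<Sum>i\<in>coords H. \<bar>\<xi> i\<bar>)"

lemma abs_Max_le:
  fixes f :: "'b::finite \<Rightarrow> real"
  assumes "\<And>b. \<bar>f b\<bar> \<le> c"
  shows "\<bar>Max (range f)\<bar> \<le> c"
proof -
  have "Max (range f) \<in> range f" by (rule Max_in) auto
  then obtain b where "Max (range f) = f b" by (rule rangeE)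
  with assms show ?thesis by simp
qed

lemma hybrid_bound:
  assumes "valid_model H P" "k \<le> H"
  shows "\<bar>hybrid h J P \<xi> k x a\<bar> \<le> real k * noise_bound \<xi>"
  using assms(2)
proof (induction k arbitrary: x a)
  case (Suc k)
  let ?t = "H - Suc k" and ?B = "noise_bound \<xi>"
  let ?V = "\<lambda>w. of_bool (fst w) + Max (range (hybrid h J P \<xi> k (snd w))) :: real"
  have t: "?t < H" using Suc.prems by simp
  have H1: "1 \<le> real H" using H by simp
  have B: "real H \<le> ?B" by (simp add: noise_bound_def sum_nonneg)
  have V: "\<bar>?V w\<bar> \<le> 1 + real k * ?B" for w
  proof -
    have "\<bar>Max (range (hybrid h J P \<xi> k (snd w)))\<bar> \<le> real k * ?B"
      using Suc by (intro abs_Max_le) auto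
    then show ?thesis by (auto simp: of_bool_def)
  qed
  have wsum: "\<bar>\<Sum>w\<in>UNIV. q w * ?V w\<bar> \<le> 1 + real k * ?B" if "\<And>w. 0 \<le> q w" "sum q UNIV \<le> 1" for q :: "bool \<times> 'x \<Rightarrow> real"
  proof -
    have "\<bar>\<Sum>w\<in>UNIV. q w * ?V w\<bar> \<le> (\<Sum>w\<in>UNIV. q w * \<bar>?V w\<bar>)"
      using that by (intro order_trans[OF sum_abs]) (simp add: abs_mult)
    also have "\<dots> \<le> (\<Sum>w\<in>UNIV. q w * (1 + real k * ?B))"
      using that V by (intro sum_mono mult_left_mono) auto
    also have "\<dots> = sum q UNIV * (1 + real k * ?B)" by (simp only: sum_distrib_right)
    also have "\<dots> \<le> 1 * (1 + real k * ?B)"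
      using that B H1 by (intro mult_right_mono) auto
    finally show ?thesis by simp
  qed
  show ?case
  proof (cases "(?t, x, a) \<in> J")
    case False
    have "\<bar>hybrid h J P \<xi> (Suc k) x a\<bar> \<le> 1 + real k * ?B"
      using False wsum[of "P (?t, x, a)"] valid_modelD[OF assms(1) t] by (simp add: Let_def)
    also have "\<dots> \<le> real (Suc k) * ?B" using B H1 by (simp add: algebra_simps)
    finally show ?thesis .
  next
    case True
    let ?i = "(?t, x, a)"
    let ?b = "mass h ?i" and ?n = "real (visits h ?i)"
    let ?q = "\<lambda>w. real (counts h ?i w) / ?b"
    have b: "0 < ?b" by (rule mass)
    have sq: "sum ?q UNIV = ?n / ?b"
      by (simp only: sum_counts[symmetric] of_nat_sum sum_divide_distrib)
    have "\<bar>\<Sum>w\<in>UNIV. ?q w * ?V w\<bar> \<le> (\<Sum>w\<in>UNIV. ?q w * \<bar>?V w\<bar>)"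
      using b by (intro order_trans[OF sum_abs]) (simp add: abs_mult)
    also have "\<dots> \<le> (\<Sum>w\<in>UNIV. ?q w * (1 + real k * ?B))"
      using b V by (intro sum_mono mult_left_mono) auto
    also have "\<dots> = ?n / ?b * (1 + real k * ?B)" by (simp only: sum_distrib_right[symmetric] sq)
    finally have 1: "\<bar>\<Sum>w\<in>UNIV. ?q w * ?V w\<bar> \<le> ?n / ?b * (1 + real k * ?B)" .
    \<comment> \<open>The prior weight \<open>\<beta> / ?b\<close> and the data weight
      \<open>?n / ?b\<close> add up to one, so only the noise can enlarge the bound at this
      step.\<close>
    have "\<beta> * real H / ?b + ?n / ?b * (1 + real k * ?B) \<le> \<beta> / ?b * (real H + real k * ?B) + ?n / ?b * (real H + real k * ?B)"
      using b \<beta> B H1 by (intro add_mono mult_left_mono) (auto simp: field_simps)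
    also have "\<dots> = (real H + real k * ?B) * ((\<beta> + ?n) / ?b)"
      by (simp add: algebra_simps add_divide_distrib)
    also have "(\<beta> + ?n) / ?b = 1" using b by (simp add: mass_def)
    finally have 2: "\<beta> * real H / ?b + ?n / ?b * (1 + real k * ?B) \<le> real H + real k * ?B" by simp
    have "1 \<le> sqrt ?b" using mass(3)[of h ?i] \<beta> by simp
    then have "real H / sqrt ?b * \<bar>\<xi> ?i\<bar> \<le> real H * \<bar>\<xi> ?i\<bar>"
      by (intro mult_right_mono) (auto simp: divide_le_eq mult_le_cancel_left1)
    also have "\<dots> \<le> real H * (\<Sum>i\<in>coords H. \<bar>\<xi> i\<bar>)"
      using t by (intro mult_left_mono member_le_sum) auto
    finally have 3: "\<bar>real H / sqrt ?b * \<xi> ?i\<bar> \<le> ?B - real H"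
      using b by (simp add: abs_mult noise_bound_def)
    have "\<bar>hybrid h J P \<xi> (Suc k) x a\<bar> \<le> \<beta> * real H / ?b + \<bar>real H / sqrt ?b * \<xi> ?i\<bar> + \<bar>\<Sum>w\<in>UNIV. ?q w * ?V w\<bar>"
    proof -
      have "0 \<le> \<beta> * real H / ?b" using b \<beta> by simp
      moreover have "\<bar>A + B + C\<bar> \<le> A + \<bar>B\<bar> + \<bar>C\<bar>" if "0 \<le> A" for A B C :: real using that by simp
      ultimately show ?thesis using True unfolding hybrid.simps Let_def rlsvi_F_eq by (simp only: if_True)
    qed
    also have "\<dots> \<le> real (Suc k) * ?B" using 1 2 3 by (simp add: algebra_simps)
    finally show ?thesis .
  qed
qed simp

end

section \<open>Integrability of the hybrid values and exchange of backups\<close>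

context rlsvi_tuned
begin

lemma noise_component:
  fixes f :: "real \<Rightarrow> real"
  assumes i: "i \<in> (coords H :: (nat \<times> 'x \<times> 'a) set)" and f: "integrable std_normal f"
  shows "integrable (noise H) (\<lambda>\<xi>. f (\<xi> i))" "(\<integral>\<xi>. f (\<xi> i) \<partial>noise H) = (\<integral>z. f z \<partial>std_normal)"
proof -
  have d: "distr (noise H) std_normal (\<lambda>\<xi>. \<xi> i) = std_normal"
    unfolding noise_def by (rule distr_PiM_component[OF std_normal.prob_space_axioms i])
  have m: "(\<lambda>\<xi>. \<xi> i) \<in> measurable (noise H) std_normal"
    unfolding noise_def by (rule measurable_component_singleton[OF i])
  have fm: "f \<in> borel_measurable std_normal" using f by (rule borel_measurable_integrable)
  show "integrable (noise H) (\<lambda>\<xi>. f (\<xi> i))"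
    by (rule integrable_distr[OF m]) (simp only: d f)
  show "(\<integral>\<xi>. f (\<xi> i) \<partial>noise H) = (\<integral>z. f z \<partial>std_normal)"
    using integral_distr[OF m fm] by (simp only: d)
qed

lemma integrable_noise_bound: "integrable (noise H) noise_bound"
proof -
  have "integrable (noise H) (\<lambda>\<xi>. \<bar>\<xi> i\<bar>)" if "i \<in> coords H" for i :: "nat \<times> 'x \<times> 'a"
    by (rule noise_component(1)[OF that integrable_std_normal_abs])
  then show ?thesis
    unfolding noise_bound_def
    by (intro Bochner_Integration.integrable_add integrable_mult_right Bochner_Integration.integrable_sum) simp_all
qed

lemma measurable_hybrid:
  assumes "k \<le> H"
  shows "(\<lambda>z. hybrid h J (fst z) (snd z) k x a) \<in> borel_measurable (model_space H \<Otimes>\<^sub>M PiM (coords H) (\<lambda>_. borel))"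
  using assms
proof (induction k arbitrary: x a)
  case (Suc k)
  let ?M = "model_space H \<Otimes>\<^sub>M PiM (coords H) (\<lambda>_. borel :: real measure) :: (('x, 'a) model \<times> (nat \<times> 'x \<times> 'a \<Rightarrow> real)) measure"
  let ?i = "(H - Suc k, x, a)"
  have i: "?i \<in> coords H" using Suc.prems by simp
  have V [measurable]: "(\<lambda>z. Max (range (hybrid h J (fst z) (snd z) k y))) \<in> borel_measurable ?M" for y
    using Suc by (intro borel_measurable_Max[OF finite]) simp
  have P: "(\<lambda>z. fst z ?i w) \<in> borel_measurable ?M" for w
    by (rule measurable_compose[OF measurable_fst measurable_coord[OF i]])
  have X: "(\<lambda>z. snd z ?i) \<in> borel_measurable ?M"
    by (rule measurable_compose[OF measurable_snd measurable_component_singleton[OF i]])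
  show ?case
  proof (cases "?i \<in> J")
    case True
    then show ?thesis unfolding hybrid.simps Let_def rlsvi_F_eq
      by (simp only: if_True) (intro borel_measurable_add borel_measurable_times borel_measurable_sum borel_measurable_const X V)
  next
    case False
    then show ?thesis unfolding hybrid.simps Let_def
      by (simp only: if_False) (intro borel_measurable_add borel_measurable_times borel_measurable_sum borel_measurable_const P V)
  qed
qed simp

lemma measurable_pinned:
  assumes "k \<le> H"
  shows "(\<lambda>\<xi>. pinned h J P \<xi> i z k x a) \<in> borel_measurable (PiM (coords H) (\<lambda>_. borel))"
  using assms
proof (induction k arbitrary: x a)
  case (Suc k)
  let ?M = "PiM (coords H) (\<lambda>_. borel :: real measure) :: (nat \<times> 'x \<times> 'a \<Rightarrow> real) measure"
  let ?i = "(H - Suc k, x, a)"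
  have i: "?i \<in> coords H" using Suc.prems by simp
  have V: "(\<lambda>\<xi>. Max (range (pinned h J P \<xi> i z k y))) \<in> borel_measurable ?M" for y
    using Suc by (intro borel_measurable_Max[OF finite]) simp
  have X: "(\<lambda>\<xi>. \<xi> ?i) \<in> borel_measurable ?M"
    by (rule measurable_component_singleton[OF i])
  consider "?i = i" | "?i \<noteq> i" "?i \<in> J" | "?i \<noteq> i" "?i \<notin> J" by blast
  then show ?case
  proof cases
    case 1
    then show ?thesis by (simp add: Let_def)
  next
    case 2
    then show ?thesis unfolding pinned.simps Let_def rlsvi_F_eq
      by (simp only: if_True if_False) (intro borel_measurable_add borel_measurable_times borel_measurable_sum borel_measurable_const X V)
  next
    case 3
    then show ?thesis unfolding pinned.simps Let_def
      by (simp only: if_False) (intro borel_measurable_add borel_measurable_times borel_measurable_sum borel_measurable_const V)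
  qed
qed simp

definition hybrid_value :: "('x, 'a) episode list \<Rightarrow> 'x \<Rightarrow> (nat \<times> 'x \<times> 'a) set \<Rightarrow> ('x, 'a) model \<Rightarrow> real" where
  "hybrid_value h x J P = (\<integral>\<xi>. Max (range (hybrid h J P \<xi> H x)) \<partial>noise H)"

lemma measurable_Max_hybrid:
  "(\<lambda>z. Max (range (hybrid h J (fst z) (snd z) H x))) \<in> borel_measurable (model_space H \<Otimes>\<^sub>M PiM (coords H) (\<lambda>_. borel))"
  by (intro borel_measurable_Max[OF finite] measurable_hybrid order_refl)

lemma integrable_Max_hybrid:
  assumes P: "valid_model H P" "P \<in> space (model_space H)"
  shows "integrable (noise H) (\<lambda>\<xi>. Max (range (hybrid h J P \<xi> H x)))"
proof (rule Bochner_Integration.integrable_bound)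
  show "integrable (noise H) (\<lambda>\<xi>. real H * noise_bound \<xi>)"
    using integrable_noise_bound by simp
  have "(\<lambda>\<xi>. Max (range (hybrid h J P \<xi> H x))) \<in> borel_measurable (PiM (coords H) (\<lambda>_. borel))"
    using measurable_compose[OF measurable_Pair1'[OF P(2)] measurable_Max_hybrid] by simp
  then show "(\<lambda>\<xi>. Max (range (hybrid h J P \<xi> H x))) \<in> borel_measurable (noise H)"
    by (simp cong: measurable_cong_sets)
  have "\<bar>Max (range (hybrid h J P \<xi> H x))\<bar> \<le> real H * noise_bound \<xi>" for \<xi>
    by (intro abs_Max_le hybrid_bound[OF P(1)]) simp
  then show "AE \<xi> in noise H. norm (Max (range (hybrid h J P \<xi> H x))) \<le> norm (real H * noise_bound \<xi>)"
    by (auto intro: order_trans[OF _ abs_ge_self])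
qed

lemma hybrid_value_bound:
  assumes P: "valid_model H P" "P \<in> space (model_space H)"
  shows "\<bar>hybrid_value h x J P\<bar> \<le> real H * (\<integral>\<xi>. noise_bound \<xi> \<partial>noise H)"
proof -
  have "\<bar>hybrid_value h x J P\<bar> \<le> (\<integral>\<xi>. \<bar>Max (range (hybrid h J P \<xi> H x))\<bar> \<partial>noise H)"
    unfolding hybrid_value_def by (rule integral_abs_bound)
  also have "\<dots> \<le> (\<integral>\<xi>. real H * noise_bound \<xi> \<partial>noise H)"
    by (intro Bochner_Integration.integral_mono integrable_abs integrable_Max_hybrid P integrable_mult_right
        integrable_noise_bound abs_Max_le hybrid_bound) auto
  finally show ?thesis by simp
qed

lemma measurable_hybrid_value: "hybrid_value h x J \<in> borel_measurable (model_space H)"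
proof -
  have "(\<lambda>(P, \<xi>). Max (range (hybrid h J P \<xi> H x))) \<in> borel_measurable (model_space H \<Otimes>\<^sub>M noise H)"
    using measurable_Max_hybrid[of h J x] by (simp add: split_beta' cong: measurable_cong_sets sets_pair_measure_cong)
  then show ?thesis
    unfolding hybrid_value_def[abs_def] by (rule noise.borel_measurable_lebesgue_integral)
qed

lemma integrable_hybrid_value: "integrable (mdp_prior H (posterior \<alpha> h)) (hybrid_value h' x J)"
proof -
  interpret prob_space "mdp_prior H (posterior \<alpha> h)" by (intro prob_space_mdp_prior valid_posterior \<alpha>)
  show ?thesis
  proof (rule integrable_const_bound)
    show "AE P in mdp_prior H (posterior \<alpha> h). norm (hybrid_value h' x J P) \<le> real H * (\<integral>\<xi>. noise_bound \<xi> \<partial>noise H)"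
      using AE_mdp_prior_valid[OF valid_posterior[OF \<alpha>]] AE_space
      by eventually_elim (simp add: hybrid_value_bound space_mdp_prior)
    show "hybrid_value h' x J \<in> borel_measurable (mdp_prior H (posterior \<alpha> h))"
      using measurable_hybrid_value by (simp cong: measurable_cong_sets)
  qed
qed

text \<open>Since the swaps proceed in order of time, the values after \<open>t0\<close> are still those of the model: they are bounded
  by the horizon and do not involve the noise. The final value is an increasing convex function of the backup at
  \<open>(t0, x0, a0)\<close> whatever the type of the earlier backups.\<close>
lemma optimism_step:
  assumes J: "\<And>t x a. (t, x, a) \<in> J \<Longrightarrow> t \<le> t0" and t0: "t0 < H" and i0: "(t0, x0, a0) \<notin> J"
  shows "(\<integral>P. hybrid_value h x J P \<partial>mdp_prior H (posterior \<alpha> h))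
    \<le> (\<integral>P. hybrid_value h x (insert (t0, x0, a0) J) P \<partial>mdp_prior H (posterior \<alpha> h))"
proof -
  let ?i = "(t0, x0, a0)" and ?\<Pi> = "mdp_prior H (posterior \<alpha> h)"
  \<comment> \<open>Off by one: \<open>k0\<close> steps to go is the period after \<open>t0\<close>,
    and \<open>Suc k0\<close> steps to go is \<open>t0\<close> itself.\<close>
  define k0 where "k0 = H - Suc t0"
  have k0: "k0 < H" "H - Suc k0 = t0" "k0 \<le> H - Suc t0" using t0 by (auto simp: k0_def)
  have i: "?i \<in> coords H" using t0 by simp
  have \<gamma>: "valid_param (posterior \<alpha> h)" by (rule valid_posterior[OF \<alpha>])
  interpret D: product_sigma_finite "\<lambda>i. dirichlet (posterior \<alpha> h i)"
    by (rule product_sigma_finite_dirichlet[OF \<gamma>])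
  interpret N: product_sigma_finite "\<lambda>_ :: nat \<times> 'x \<times> 'a. std_normal"
    by (intro product_sigma_finite.intro std_normal.sigma_finite_measure_axioms)
  have prob: "prob_space (dirichlet (posterior \<alpha> h i))" for i
    by (rule prob_space_dirichlet[OF valid_paramD(1)[OF \<gamma>]])
  note int = integrable_hybrid_value[unfolded mdp_prior_def]
  have fin: "finite (coords H :: (nat \<times> 'x \<times> 'a) set)" by simp
  note res = D.integral_PiM_resample[OF fin i prob int]
  have "(\<integral>P. hybrid_value h x J P \<partial>?\<Pi>) = (\<integral>P. (\<integral>p. hybrid_value h x J (P(?i := p)) \<partial>dirichlet (posterior \<alpha> h ?i)) \<partial>?\<Pi>)"
    unfolding mdp_prior_def by (rule res(2))
  also have "\<dots> \<le> (\<integral>P. hybrid_value h x (insert ?i J) P \<partial>?\<Pi>)"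
  proof (rule integral_mono_AE)
    show "integrable ?\<Pi> (\<lambda>P. \<integral>p. hybrid_value h x J (P(?i := p)) \<partial>dirichlet (posterior \<alpha> h ?i))"
      unfolding mdp_prior_def by (rule res(3))
    show "integrable ?\<Pi> (hybrid_value h x (insert ?i J))" by (rule integrable_hybrid_value)
    show "AE P in ?\<Pi>. (\<integral>p. hybrid_value h x J (P(?i := p)) \<partial>dirichlet (posterior \<alpha> h ?i)) \<le> hybrid_value h x (insert ?i J) P"
      using AE_mdp_prior_valid[OF \<gamma>] AE_space
    proof eventually_elim
      fix P :: "('x, 'a) model" assume P: "valid_model H P" "P \<in> space ?\<Pi>"
      then have P': "P \<in> space (model_space H)" by (simp add: space_mdp_prior)
      \<comment> \<open>The model recursion with \<open>J = {}\<close> ignores the noise argument,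
        which is filled with \<open>undefined\<close>.\<close>
      define y where "y w = of_bool (fst w) + Max (range (hybrid h {} P undefined k0 (snd w)))" for w :: "bool \<times> 'x"
      define U where "U z = (\<integral>\<xi>. Max (range (pinned h J P \<xi> ?i z H x)) \<partial>noise H)" for z
      let ?b = "mass h ?i"
      have b: "0 < ?b" by (rule mass)
      have y: "0 \<le> y w" "y w \<le> real H" for w
      proof -
        have B: "0 \<le> hybrid h {} P undefined k0 (snd w) a" "hybrid h {} P undefined k0 (snd w) a \<le> real k0" for a
          using hybrid_empty_bounds[OF P(1)] k0 by auto
        have "0 \<le> Max (range (hybrid h {} P undefined k0 (snd w)))"
          by (rule order_trans[OF B(1)[of undefined] Max_ge]) auto
        moreover have "Max (range (hybrid h {} P undefined k0 (snd w))) \<le> real k0"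
          using B(2) by (subst Max_le_iff) auto
        moreover have "0 \<le> (of_bool (fst w) :: real)" "of_bool (fst w) \<le> (1 :: real)" by auto
        moreover have "real k0 + 1 \<le> real H" using k0 by simp
        ultimately show "0 \<le> y w" "y w \<le> real H" unfolding y_def by linarith+
      qed
      have future: "hybrid h J (P(?i := p)) \<xi> k0 = hybrid h {} P undefined k0" for p \<xi>
      proof -
        have "hybrid h J (P(?i := p)) \<xi> k0 = hybrid h J P \<xi> k0"
          by (rule hybrid_future(2)[OF _ k0(3)]) (rule J)
        also have "\<dots> = hybrid h {} P undefined k0"
          by (rule hybrid_future(1)[OF _ k0(3)]) (rule J)
        finally show ?thesis .
      qed
      have future': "hybrid h (insert ?i J) P \<xi> k0 = hybrid h {} P undefined k0" for \<xi>
        by (rule hybrid_future(1)[OF _ k0(3)]) (use J in auto)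
      have val: "hybrid h J (P(?i := p)) \<xi> (Suc k0) x0 a0 = (\<Sum>w\<in>UNIV. p w * y w)" for p \<xi>
        unfolding hybrid.simps Let_def k0(2) future using i0 by (simp add: y_def)
      have lhs: "hybrid_value h x J (P(?i := p)) = U (\<Sum>w\<in>UNIV. p w * y w)" for p
      proof -
        have "hybrid h J (P(?i := p)) \<xi> H x = pinned h J P \<xi> ?i (\<Sum>w\<in>UNIV. p w * y w) H x" for \<xi>
          using hybrid_eq_pinned[OF k0(1) order_refl, of h J "P(?i := p)" \<xi> x _ x0 a0]
          unfolding k0(2) val pinned_cong by (intro ext)
        then show ?thesis by (simp add: hybrid_value_def U_def)
      qed
      let ?m = "\<beta> * real H / ?b + (\<Sum>w\<in>UNIV. real (counts h ?i w) / ?b * y w)"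
      have val': "hybrid h (insert ?i J) P (\<xi>(?i := e)) (Suc k0) x0 a0 = ?m + real H / sqrt ?b * e" for \<xi> e
        unfolding hybrid.simps Let_def k0(2) future' rlsvi_F_eq by (simp add: y_def)
      have pinv: "pinned h (insert ?i J) P (\<xi>(?i := e)) ?i z H = pinned h J P \<xi> ?i z H" for \<xi> e z
        by (rule pinned_cong)
      \<comment> \<open>Only the noise at the swapped coordinate is singled out. The remaining noise
        stays inside \<open>U\<close>, together with a stale entry at this coordinate that
        \<open>pinned\<close> never reads.\<close>
      have rhs: "hybrid_value h x (insert ?i J) P = (\<integral>e. U (?m + real H / sqrt ?b * e) \<partial>std_normal)"
      proof -
        have "hybrid h (insert ?i J) P (\<xi>(?i := e)) H x = pinned h J P \<xi> ?i (?m + real H / sqrt ?b * e) H x" for \<xi> e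
          using hybrid_eq_pinned[OF k0(1) order_refl, of h "insert ?i J" P "\<xi>(?i := e)" x _ x0 a0]
          unfolding k0(2) val' pinv by (intro ext)
        moreover have "hybrid_value h x (insert ?i J) P
          = (\<integral>e. (\<integral>\<xi>. Max (range (hybrid h (insert ?i J) P (\<xi>(?i := e)) H x)) \<partial>noise H) \<partial>std_normal)"
          unfolding hybrid_value_def noise_def
          by (rule N.integral_PiM_resample(1)[OF fin i])
             (use integrable_Max_hybrid[OF P(1) P', unfolded noise_def] in \<open>auto intro: std_normal.prob_space_axioms\<close>)
        ultimately show ?thesis by (simp add: U_def)
      qed
      have U: "inc_cvx U"
        unfolding U_def[abs_def]
      proof (rule noise.inc_cvx_integral)
        have pc: "inc_cvx (\<lambda>z. Max (range (pinned h J P \<xi> ?i z H x)))" for \<xi>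
          by (intro inc_cvx_Max inc_cvx_pinned P) simp
        show "inc_cvx (\<lambda>z. Max (range (pinned h J P \<xi> ?i z H x)))" for \<xi> by (rule pc)
        fix z
        \<comment> \<open>Integrability is known at the value that the model itself produces; the
          Lipschitz bound in \<open>z\<close> carries it to all other values.\<close>
        define z0 where "z0 = (\<Sum>w\<in>UNIV. P ?i w * y w)"
        have "hybrid h J P \<xi> H x = pinned h J P \<xi> ?i z0 H x" for \<xi>
          using hybrid_eq_pinned[OF k0(1) order_refl, of h J P \<xi> x _ x0 a0] val[of "P ?i" \<xi>]
          unfolding k0(2) z0_def by (intro ext) simp
        then have int0: "integrable (noise H) (\<lambda>\<xi>. Max (range (pinned h J P \<xi> ?i z0 H x)))"
          using integrable_Max_hybrid[OF P(1) P', of h J x] by simp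
        show "integrable (noise H) (\<lambda>\<xi>. Max (range (pinned h J P \<xi> ?i z H x)))"
        proof (rule Bochner_Integration.integrable_bound)
          show "integrable (noise H) (\<lambda>\<xi>. \<bar>Max (range (pinned h J P \<xi> ?i z0 H x))\<bar> + \<bar>z - z0\<bar>)"
            using int0 by simp
          have "(\<lambda>\<xi>. Max (range (pinned h J P \<xi> ?i z H x))) \<in> borel_measurable (PiM (coords H) (\<lambda>_. borel))"
            by (intro borel_measurable_Max[OF finite] measurable_pinned order_refl)
          then show "(\<lambda>\<xi>. Max (range (pinned h J P \<xi> ?i z H x))) \<in> borel_measurable (noise H)"
            by (simp cong: measurable_cong_sets)
          have "\<bar>Max (range (pinned h J P \<xi> ?i z H x)) - Max (range (pinned h J P \<xi> ?i z0 H x))\<bar> \<le> 1 * \<bar>z - z0\<bar>" for \<xi>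
            using pc[of \<xi>] unfolding inc_cvx_def by (auto dest: cvx_lipD)
          then show "AE \<xi> in noise H. norm (Max (range (pinned h J P \<xi> ?i z H x)))
              \<le> norm (\<bar>Max (range (pinned h J P \<xi> ?i z0 H x))\<bar> + \<bar>z - z0\<bar>)"
            by (intro AE_I2) (smt (verit) real_norm_def)
        qed
      qed
      \<comment> \<open>The counts agree on both sides. The pseudocounts multiply values at most
        \<open>H\<close> in the Dirichlet mean and exactly \<open>H\<close> in the
        regression.\<close>
      have "(\<Sum>w\<in>UNIV. posterior \<alpha> h ?i w / ?b * y w)
          = (\<Sum>w\<in>UNIV. \<alpha> ?i w / ?b * y w) + (\<Sum>w\<in>UNIV. real (counts h ?i w) / ?b * y w)"
        by (simp add: posterior_def add_divide_distrib distrib_right sum.distrib)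
      also have "(\<Sum>w\<in>UNIV. \<alpha> ?i w / ?b * y w) \<le> (\<Sum>w\<in>UNIV. \<alpha> ?i w / ?b * real H)"
        using y b \<alpha>_nonneg by (intro sum_mono mult_left_mono) auto
      also have "(\<Sum>w\<in>UNIV. \<alpha> ?i w / ?b * real H) = \<beta> * real H / ?b"
        by (simp only: sum_distrib_right[symmetric] sum_divide_distrib[symmetric] sum_\<alpha>) simp
      finally have m: "(\<Sum>w\<in>UNIV. posterior \<alpha> h ?i w / sum (posterior \<alpha> h ?i) UNIV * y w) \<le> ?m"
        by (simp add: mass(1))
      have "(\<integral>p. U (\<Sum>w\<in>UNIV. p w * y w) \<partial>dirichlet (posterior \<alpha> h ?i))
        \<le> (\<integral>z. U (?m + real H / sqrt (sum (posterior \<alpha> h ?i) UNIV) * z) \<partial>std_normal)"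
        using U H by (intro dirichlet_le_gauss[where K=1] valid_paramD[OF \<gamma>] y m) (auto simp: inc_cvx_def)
      then show "(\<integral>p. hybrid_value h x J (P(?i := p)) \<partial>dirichlet (posterior \<alpha> h ?i)) \<le> hybrid_value h x (insert ?i J) P"
        unfolding lhs rhs by (simp only: mass(1))
    qed
  qed
  finally show ?thesis .
qed

text \<open>Time order matters only between periods: within a period no backup feeds into another,
  so the inner induction may add its coordinates in any order.\<close>

lemma optimism_layers:
  assumes "t \<le> H"
  shows "(\<integral>P. hybrid_value h x {} P \<partial>mdp_prior H (posterior \<alpha> h))
    \<le> (\<integral>P. hybrid_value h x (coords t) P \<partial>mdp_prior H (posterior \<alpha> h))"
  using assms
proof (induction t)
  case (Suc t)
  let ?I = "\<lambda>J. \<integral>P. hybrid_value h x J P \<partial>mdp_prior H (posterior \<alpha> h)"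
  have "?I (coords t) \<le> ?I (coords t \<union> {t} \<times> S)" if "finite S" for S :: "('x \<times> 'a) set"
    using that
  proof (induction S rule: finite_induct)
    case (insert xa S)
    obtain x0 a0 where xa: "xa = (x0, a0)" by (cases xa)
    have "?I (coords t \<union> {t} \<times> S) \<le> ?I (insert (t, x0, a0) (coords t \<union> {t} \<times> S))"
      using Suc.prems insert.hyps xa by (intro optimism_step) auto
    also have "insert (t, x0, a0) (coords t \<union> {t} \<times> S) = coords t \<union> {t} \<times> insert xa S"
      using xa by auto
    finally show ?case using insert.IH by simp
  qed simp
  from this[of UNIV] have "?I (coords t) \<le> ?I (coords t \<union> {t} \<times> UNIV)" by simp
  moreover have "coords t \<union> {t} \<times> UNIV = (coords (Suc t) :: (nat \<times> 'x \<times> 'a) set)" by (auto simp: less_Suc_eq)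
  ultimately show ?case using Suc by simp
qed simp

abbreviation Q_rem :: "('x, 'a) episode list \<Rightarrow> (nat \<times> 'x \<times> 'a \<Rightarrow> real) \<Rightarrow> nat \<Rightarrow> 'x \<Rightarrow> 'a \<Rightarrow> real" where
  "Q_rem h \<xi> k \<equiv> rlsvi_Qrem (\<lambda>_. real H) ((real H)\<^sup>2) ((real H)\<^sup>2 / \<beta>) H h \<xi> k"

theorem optimism:
  "(\<integral>P. Vstar P H 0 x \<partial>mdp_prior H (posterior \<alpha> h)) \<le> (\<integral>\<xi>. Max (range (Q_rem h \<xi> H x)) \<partial>noise H)"
proof -
  have \<gamma>: "valid_param (posterior \<alpha> h)" by (rule valid_posterior[OF \<alpha>])
  interpret prob_space "mdp_prior H (posterior \<alpha> h)" by (rule prob_space_mdp_prior[OF \<gamma>])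
  have "(\<integral>P. Vstar P H 0 x \<partial>mdp_prior H (posterior \<alpha> h)) \<le> (\<integral>P. hybrid_value h x {} P \<partial>mdp_prior H (posterior \<alpha> h))"
  proof (rule integral_mono_AE)
    show "integrable (mdp_prior H (posterior \<alpha> h)) (\<lambda>P. Vstar P H 0 x)"
    proof (rule integrable_mdp_prior[OF \<gamma>, where C="real H"])
      fix P :: "('x, 'a) model" assume P: "valid_model H P"
      have "Vstar P H 0 x \<le> real H"
        using Vrem_bounds[OF P order_refl] by (intro Vstar_le) (simp add: Vpi_def)
      moreover have "0 \<le> Vstar P H 0 x"
        using Vrem_bounds[OF P order_refl] by (intro order_trans[OF _ Vpi_le_Vstar[of P H undefined]]) (simp add: Vpi_def)
      ultimately show "\<bar>Vstar P H 0 x\<bar> \<le> real H" by simp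
    qed measurable
    show "integrable (mdp_prior H (posterior \<alpha> h)) (hybrid_value h x {})" by (rule integrable_hybrid_value)
    show "AE P in mdp_prior H (posterior \<alpha> h). Vstar P H 0 x \<le> hybrid_value h x {} P"
      using AE_mdp_prior_valid[OF \<gamma>] AE_space
    proof eventually_elim
      fix P :: "('x, 'a) model" assume P: "valid_model H P" "P \<in> space (mdp_prior H (posterior \<alpha> h))"
      then have "P \<in> space (model_space H)" by (simp add: space_mdp_prior)
      then show "Vstar P H 0 x \<le> hybrid_value h x {} P"
        unfolding hybrid_value_def
        by (intro noise.integral_ge_const integrable_Max_hybrid P AE_I2 Vstar_le_hybrid)
    qed
  qed
  also have "\<dots> \<le> (\<integral>P. hybrid_value h x (coords H) P \<partial>mdp_prior H (posterior \<alpha> h))"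
    by (rule optimism_layers) simp
  also have "\<dots> = (\<integral>\<xi>. Max (range (Q_rem h \<xi> H x)) \<partial>noise H)"
    unfolding hybrid_value_def hybrid_coords[OF order_refl] by (simp add: prob_space)
  finally show ?thesis .
qed

end

subsection \<open>Regret as Bellman error under the posterior mean\<close>

context rlsvi_run
begin

text \<open>For a fixed policy the value is a sum over episodes, and each likelihood is a product
  over pairwise different, hence independent, coordinates. Expectation therefore replaces every
  factor by its mean.\<close>

lemma integral_Vpi:
  "(\<integral>P. (\<Sum>x\<in>UNIV. pmf \<rho> x * Vpi P H \<pi> 0 x) \<partial>mdp_prior H (posterior \<alpha> h)) = (\<Sum>x\<in>UNIV. pmf \<rho> x * Vpi (post_mean h) H \<pi> 0 x)"
proof -
  let ?c = "\<lambda>(t::nat) (x::'x) (a::'a) w. of_bool (fst w) :: real"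
  have \<gamma>: "valid_param (posterior \<alpha> h)" by (rule valid_posterior[OF \<alpha>])
  have eq: "(\<Sum>x\<in>UNIV. pmf \<rho> x * Vpi P H \<pi> 0 x) = (\<Sum>e\<in>episodes H. ep_prob \<rho> P H \<pi> e * ep_cost H ?c e)"
    if "valid_model H P" for P
    unfolding sum_ep_cost[OF that] by (simp add: Vpi_def Vrem_eq_policy_cost)
  have m: "(\<lambda>P. ep_prob \<rho> P H \<pi> e) \<in> borel_measurable (model_space H)" for e
    unfolding ep_prob_eq_likelihood by (intro borel_measurable_times measurable_ep_likelihood) auto
  have int: "integrable (mdp_prior H (posterior \<alpha> h)) (\<lambda>P. ep_prob \<rho> P H \<pi> e)" for e
    by (rule integrable_mdp_prior[OF \<gamma> m, where C=1]) (simp add: ep_prob_bounds)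
  have mean: "(\<integral>P. ep_prob \<rho> P H \<pi> e \<partial>mdp_prior H (posterior \<alpha> h)) = ep_prob \<rho> (post_mean h) H \<pi> e" for e
  proof -
    interpret prob_space "mdp_prior H (posterior \<alpha> (h @ [e]))" by (intro prob_space_mdp_prior valid_posterior \<alpha>)
    have "(\<integral>P. ep_likelihood H P e \<partial>mdp_prior H (posterior \<alpha> h)) = ep_likelihood H (post_mean h) e"
      using mdp_prior_episode_update[OF \<alpha>, where f="\<lambda>_. 1" and H=H and C=1 and e=e and h=h] by (simp add: post_mean_def prob_space)
    then show ?thesis by (simp add: ep_prob_eq_likelihood)
  qed
  have "(\<integral>P. (\<Sum>x\<in>UNIV. pmf \<rho> x * Vpi P H \<pi> 0 x) \<partial>mdp_prior H (posterior \<alpha> h))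
    = (\<integral>P. (\<Sum>e\<in>episodes H. ep_prob \<rho> P H \<pi> e * ep_cost H ?c e) \<partial>mdp_prior H (posterior \<alpha> h))"
  proof (rule integral_cong_AE)
    show "AE P in mdp_prior H (posterior \<alpha> h). (\<Sum>x\<in>UNIV. pmf \<rho> x * Vpi P H \<pi> 0 x) = (\<Sum>e\<in>episodes H. ep_prob \<rho> P H \<pi> e * ep_cost H ?c e)"
      using AE_mdp_prior_valid[OF \<gamma>] by eventually_elim (rule eq)
    have "(\<lambda>P. \<Sum>e\<in>episodes H. ep_prob \<rho> P H \<pi> e * ep_cost H ?c e) \<in> borel_measurable (model_space H)"
      by (intro borel_measurable_sum borel_measurable_times m borel_measurable_const)
    then show "(\<lambda>P. \<Sum>e\<in>episodes H. ep_prob \<rho> P H \<pi> e * ep_cost H ?c e) \<in> borel_measurable (mdp_prior H (posterior \<alpha> h))"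
      by (simp cong: measurable_cong_sets)
  qed measurable
  also have "\<dots> = (\<Sum>e\<in>episodes H. ep_prob \<rho> (post_mean h) H \<pi> e * ep_cost H ?c e)"
    using int by (subst Bochner_Integration.integral_sum) (simp_all add: mean)
  also have "\<dots> = (\<Sum>x\<in>UNIV. pmf \<rho> x * Vpi (post_mean h) H \<pi> 0 x)"
    by (rule eq[OF valid_post_mean, symmetric])
  finally show ?thesis .
qed

text \<open>Given the history the policy is independent of the model. Being a finite mixture, it
  lets the expectation over the model be taken policy by policy.\<close>

lemma integral_mean_gap:
  "(\<integral>P. (\<integral>\<xi>. gap P (pol h \<xi>) \<partial>noise H) \<partial>mdp_prior H (posterior \<alpha> h))
    = (\<Sum>x\<in>UNIV. pmf \<rho> x * (\<integral>P. Vstar P H 0 x \<partial>mdp_prior H (posterior \<alpha> h)))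
      - (\<integral>\<xi>. (\<Sum>x\<in>UNIV. pmf \<rho> x * Vpi (post_mean h) H (pol h \<xi>) 0 x) \<partial>noise H)"
proof -
  let ?\<Pi> = "mdp_prior H (posterior \<alpha> h)"
  have \<gamma>: "valid_param (posterior \<alpha> h)" by (rule valid_posterior[OF \<alpha>])
  define R where "R P \<pi> = (\<Sum>x\<in>UNIV. pmf \<rho> x * Vpi P H \<pi> 0 x)" for P and \<pi> :: "('x, 'a) policy"
  define S where "S P = (\<Sum>x\<in>UNIV. pmf \<rho> x * Vstar P H 0 x)" for P :: "('x, 'a) model"
  define q where "q \<pi> = measure (noise H) {\<xi>\<in>space (noise H). \<forall>t<H. \<forall>x. pol h \<xi> t x = \<pi> t x}" for \<pi>
  have Rr: "R P (restrict \<pi> {..<H}) = R P \<pi>" for P \<pi> by (simp add: R_def Vpi_restrict)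
  have mix: "(\<integral>\<xi>. R P (pol h \<xi>) \<partial>noise H) = (\<Sum>\<pi>\<in>policies H. q \<pi> * R P \<pi>)" for P
    unfolding q_def by (rule policy_mixture(2)) (rule Rr)
  have gap: "gap P \<pi> = S P - R P \<pi>" for P \<pi>
    by (simp add: gap_def S_def R_def right_diff_distrib sum_subtractf)
  have inner: "(\<integral>\<xi>. gap P (pol h \<xi>) \<partial>noise H) = S P - (\<Sum>\<pi>\<in>policies H. q \<pi> * R P \<pi>)" for P
    unfolding gap mix[symmetric]
    by (subst Bochner_Integration.integral_diff) (auto simp: noise.prob_space intro: policy_mixture(1)[of "R P" for P, OF Rr])
  have V: "0 \<le> Vstar P H 0 x" "Vstar P H 0 x \<le> real H" "0 \<le> Vpi P H \<pi> 0 x" "Vpi P H \<pi> 0 x \<le> real H"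
    if "valid_model H P" for P :: "('x, 'a) model" and x \<pi>
  proof -
    show *: "0 \<le> Vpi P H \<pi> 0 x" "Vpi P H \<pi> 0 x \<le> real H" for \<pi>
      using Vrem_bounds[OF that order_refl] by (simp_all add: Vpi_def)
    show "0 \<le> Vstar P H 0 x" using *(1) Vpi_le_Vstar by (rule order_trans)
    show "Vstar P H 0 x \<le> real H" using *(2) by (rule Vstar_le)
  qed
  have intV: "integrable ?\<Pi> (\<lambda>P. Vstar P H 0 x)" for x
    by (rule integrable_mdp_prior[OF \<gamma>, where C="real H"]) (measurable, use V in auto)
  have intV': "integrable ?\<Pi> (\<lambda>P. Vpi P H \<pi> 0 x)" for x \<pi>
    by (rule integrable_mdp_prior[OF \<gamma>, where C="real H"]) (measurable, use V in auto)
  have intS: "integrable ?\<Pi> S" unfolding S_def[abs_def]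
    by (intro Bochner_Integration.integrable_sum integrable_mult_right intV)
  have intR: "integrable ?\<Pi> (\<lambda>P. R P \<pi>)" for \<pi> unfolding R_def
    by (intro Bochner_Integration.integrable_sum integrable_mult_right intV')
  have "(\<integral>P. (\<integral>\<xi>. gap P (pol h \<xi>) \<partial>noise H) \<partial>?\<Pi>) = (\<integral>P. S P \<partial>?\<Pi>) - (\<Sum>\<pi>\<in>policies H. q \<pi> * (\<integral>P. R P \<pi> \<partial>?\<Pi>))"
    unfolding inner using intS intR
    by (subst Bochner_Integration.integral_diff) (auto intro!: Bochner_Integration.integrable_sum simp: Bochner_Integration.integral_sum)
  also have "(\<integral>P. S P \<partial>?\<Pi>) = (\<Sum>x\<in>UNIV. pmf \<rho> x * (\<integral>P. Vstar P H 0 x \<partial>?\<Pi>))"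
    unfolding S_def using intV by (subst Bochner_Integration.integral_sum) auto
  also have "(\<Sum>\<pi>\<in>policies H. q \<pi> * (\<integral>P. R P \<pi> \<partial>?\<Pi>)) = (\<integral>\<xi>. R (post_mean h) (pol h \<xi>) \<partial>noise H)"
    unfolding mix using integral_Vpi by (simp add: R_def)
  finally show ?thesis by (simp only: R_def)
qed

end

section \<open>Bellman errors along the greedy policy\<close>

context rlsvi_tuned
begin

definition bellman_error :: "('x, 'a) episode list \<Rightarrow> (nat \<times> 'x \<times> 'a \<Rightarrow> real) \<Rightarrow> nat \<Rightarrow> 'x \<Rightarrow> 'a \<Rightarrow> real" where
  "bellman_error h \<xi> t x a = Q_rem h \<xi> (H - t) x a
    - (\<Sum>w\<in>UNIV. post_mean h (t, x, a) w * (of_bool (fst w) + Max (range (Q_rem h \<xi> (H - Suc t) (snd w)))))"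

lemma Q_rem_greedy:
  assumes "Suc k \<le> H"
  shows "Q_rem h \<xi> (Suc k) x (pol h \<xi> (H - Suc k) x) = Max (range (Q_rem h \<xi> (Suc k) x))"
proof -
  let ?q = "Q_rem h \<xi> (Suc k) x"
  have pol: "pol h \<xi> (H - Suc k) x = (SOME a. \<forall>a'. ?q a' \<le> ?q a)"
    using assms by (simp add: pol_def rlsvi_policy_def rlsvi_Q_def del: rlsvi_Qrem.simps)
  have "Max (range ?q) \<in> range ?q" by (rule Max_in) auto
  then obtain a where a: "?q a = Max (range ?q)" by (metis rangeE)
  have "\<forall>a'. ?q a' \<le> ?q a" unfolding a by (auto intro: Max_ge)
  then have "\<forall>a'. ?q a' \<le> ?q (pol h \<xi> (H - Suc k) x)" unfolding pol by (rule someI)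
  then show ?thesis by (intro antisym Max_ge) (auto simp: Max_le_iff simp del: rlsvi_Qrem.simps)
qed

text \<open>The greedy action attains the maximum of \<open>Q_rem\<close>, so the difference
  telescopes with equality, the transitions being those of the posterior mean model
  throughout.\<close>

lemma performance_difference:
  assumes "k \<le> H"
  shows "Max (range (Q_rem h \<xi> k x)) - Vrem (post_mean h) (pol h \<xi>) H k x
    = policy_cost (post_mean h) (pol h \<xi>) (\<lambda>t x a w. bellman_error h \<xi> t x a) H k x"
  using assms
proof (induction k arbitrary: x)
  case (Suc k)
  let ?t = "H - Suc k" and ?\<pi> = "pol h \<xi>" and ?P = "post_mean h"
  let ?a = "?\<pi> ?t x" and ?c = "\<lambda>t x a (w :: bool \<times> 'x). bellman_error h \<xi> t x a"
  have t: "?t < H" "H - ?t = Suc k" "H - Suc ?t = k" using Suc.prems by auto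
  have one: "(\<Sum>w\<in>UNIV. ?P (?t, x, ?a) w) = 1" by (rule valid_modelD[OF valid_post_mean t(1)])
  have IH: "policy_cost ?P ?\<pi> ?c H k y = Max (range (Q_rem h \<xi> k y)) - Vrem ?P ?\<pi> H k y" for y
    using Suc by simp
  have "policy_cost ?P ?\<pi> ?c H (Suc k) x
     = bellman_error h \<xi> ?t x ?a * (\<Sum>w\<in>UNIV. ?P (?t, x, ?a) w)
       + (\<Sum>w\<in>UNIV. ?P (?t, x, ?a) w * (of_bool (fst w) + Max (range (Q_rem h \<xi> k (snd w)))))
       - (\<Sum>w\<in>UNIV. ?P (?t, x, ?a) w * (of_bool (fst w) + Vrem ?P ?\<pi> H k (snd w)))"
    unfolding policy_cost.simps Let_def IH sum_distrib_left sum.distrib[symmetric] sum_subtractf[symmetric]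
    by (intro sum.cong refl) (simp add: algebra_simps)
  also have "\<dots> = Q_rem h \<xi> (Suc k) x ?a - Vrem ?P ?\<pi> H (Suc k) x"
    unfolding one bellman_error_def t(2,3) by (simp add: Let_def del: rlsvi_Qrem.simps)
  finally show ?case by (simp only: Q_rem_greedy[OF Suc.prems])
qed simp

text \<open>With \<open>J = coords H\<close> the model is never read, so any valid one may be
  supplied to \<open>hybrid_bound\<close>; the prior mean is at hand.\<close>

lemma Q_rem_bound: "k \<le> H \<Longrightarrow> \<bar>Q_rem h \<xi> k x a\<bar> \<le> real k * noise_bound \<xi>"
  using hybrid_bound[OF valid_mean_model[OF \<alpha>], of k h "coords H" \<xi> x a] by (simp only: hybrid_coords)

lemma integrable_Q_rem:
  assumes "k \<le> H"
  shows "integrable (noise H) (\<lambda>\<xi>. Q_rem h \<xi> k x a)" "integrable (noise H) (\<lambda>\<xi>. Max (range (Q_rem h \<xi> k x)))"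
proof -
  have int: "integrable (noise H) (\<lambda>\<xi>. real k * noise_bound \<xi>)" using integrable_noise_bound by simp
  have m: "(\<lambda>\<xi>. Q_rem h \<xi> k x a) \<in> borel_measurable (noise H)" for a
    using measurable_rlsvi_Qrem[OF assms] by (simp cong: measurable_cong_sets)
  show "integrable (noise H) (\<lambda>\<xi>. Q_rem h \<xi> k x a)"
  proof (rule Bochner_Integration.integrable_bound[OF int])
    show "AE \<xi> in noise H. norm (Q_rem h \<xi> k x a) \<le> norm (real k * noise_bound \<xi>)"
      using Q_rem_bound[OF assms] by (intro AE_I2) (auto intro: order_trans[OF _ abs_ge_self])
  qed (rule m)
  show "integrable (noise H) (\<lambda>\<xi>. Max (range (Q_rem h \<xi> k x)))"
  proof (rule Bochner_Integration.integrable_bound[OF int])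
    show "AE \<xi> in noise H. norm (Max (range (Q_rem h \<xi> k x))) \<le> norm (real k * noise_bound \<xi>)"
    proof (rule AE_I2)
      fix \<xi>
      have "\<bar>Max (range (Q_rem h \<xi> k x))\<bar> \<le> real k * noise_bound \<xi>"
        by (rule abs_Max_le) (rule Q_rem_bound[OF assms])
      then show "norm (Max (range (Q_rem h \<xi> k x))) \<le> norm (real k * noise_bound \<xi>)" by simp
    qed
  qed (rule borel_measurable_Max[OF finite m])
qed

lemma integrable_ep_prob_mult:
  assumes "integrable (noise H) f"
  shows "integrable (noise H) (\<lambda>\<xi>. ep_prob \<rho> (post_mean h) H (pol h \<xi>) e * f \<xi>)"
proof (rule Bochner_Integration.integrable_bound[OF assms])
  show "(\<lambda>\<xi>. ep_prob \<rho> (post_mean h) H (pol h \<xi>) e * f \<xi>) \<in> borel_measurable (noise H)"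
    using integrable_ep_prob assms by (intro borel_measurable_times borel_measurable_integrable)
  show "AE \<xi> in noise H. norm (ep_prob \<rho> (post_mean h) H (pol h \<xi>) e * f \<xi>) \<le> norm (f \<xi>)"
    using ep_prob_bounds[OF valid_post_mean] by (intro AE_I2) (simp add: abs_mult mult_left_le_one_le)
qed

lemma integrable_bellman_error: "integrable (noise H) (\<lambda>\<xi>. bellman_error h \<xi> t x a)"
  unfolding bellman_error_def
  by (intro Bochner_Integration.integrable_diff Bochner_Integration.integrable_sum integrable_mult_right
      Bochner_Integration.integrable_add integrable_Q_rem noise.integrable_const) auto

theorem mean_gap_le_bellman:
  "(\<integral>P. (\<integral>\<xi>. gap P (pol h \<xi>) \<partial>noise H) \<partial>mdp_prior H (posterior \<alpha> h))
    \<le> (\<integral>\<xi>. (\<Sum>e\<in>episodes H. ep_prob \<rho> (post_mean h) H (pol h \<xi>) e * ep_cost H (\<lambda>t x a w. bellman_error h \<xi> t x a) e) \<partial>noise H)"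
proof -
  let ?V = "\<lambda>\<xi>. \<Sum>x\<in>UNIV. pmf \<rho> x * Vpi (post_mean h) H (pol h \<xi>) 0 x"
  have intV: "integrable (noise H) ?V"
    by (rule policy_mixture(1)[where F="\<lambda>\<pi>. \<Sum>x\<in>UNIV. pmf \<rho> x * Vpi (post_mean h) H \<pi> 0 x"]) (simp add: Vpi_restrict)
  have intQ: "integrable (noise H) (\<lambda>\<xi>. \<Sum>x\<in>UNIV. pmf \<rho> x * Max (range (Q_rem h \<xi> H x)))"
    by (intro Bochner_Integration.integrable_sum integrable_mult_right integrable_Q_rem) simp
  have "(\<integral>P. (\<integral>\<xi>. gap P (pol h \<xi>) \<partial>noise H) \<partial>mdp_prior H (posterior \<alpha> h))
    \<le> (\<Sum>x\<in>UNIV. pmf \<rho> x * (\<integral>\<xi>. Max (range (Q_rem h \<xi> H x)) \<partial>noise H)) - (\<integral>\<xi>. ?V \<xi> \<partial>noise H)"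
    unfolding integral_mean_gap by (intro diff_right_mono sum_mono mult_left_mono optimism) auto
  also have "\<dots> = (\<integral>\<xi>. (\<Sum>x\<in>UNIV. pmf \<rho> x * Max (range (Q_rem h \<xi> H x))) - ?V \<xi> \<partial>noise H)"
  proof -
    have "(\<integral>\<xi>. (\<Sum>x\<in>UNIV. pmf \<rho> x * Max (range (Q_rem h \<xi> H x))) \<partial>noise H)
      = (\<Sum>x\<in>UNIV. pmf \<rho> x * (\<integral>\<xi>. Max (range (Q_rem h \<xi> H x)) \<partial>noise H))"
      by (subst Bochner_Integration.integral_sum) (auto intro: integrable_Q_rem(2)[OF order_refl])
    then show ?thesis by (subst Bochner_Integration.integral_diff[OF intQ intV]) (simp only:)
  qed
  also have "\<dots> = (\<integral>\<xi>. (\<Sum>x\<in>UNIV. pmf \<rho> x * policy_cost (post_mean h) (pol h \<xi>) (\<lambda>t x a w. bellman_error h \<xi> t x a) H H x) \<partial>noise H)"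
    unfolding performance_difference[OF order_refl, symmetric]
    by (simp add: Vpi_def right_diff_distrib sum_subtractf)
  finally show ?thesis unfolding sum_ep_cost[OF valid_post_mean] .
qed

end

subsection \<open>Pathwise summation of the Bellman errors\<close>

context rlsvi_run
begin

lemma sum_visits:
  fixes h :: "('x, 'a) episode list"
  assumes "t < H"
  shows "(\<Sum>xa\<in>UNIV. visits h (t, xa)) = length h"
proof (induction h rule: rev_induct)
  case Nil
  then show ?case by (simp add: visits_def data_def split_beta')
next
  case (snoc e h)
  have "(\<Sum>xa\<in>UNIV. visits (h @ [e]) (t, xa)) = (\<Sum>xa\<in>UNIV. visits h (t, xa) + (if (ep_state e t, ep_action e t) = xa then 1 else 0))"
    by (intro sum.cong refl) (auto simp: visits_snoc ep_index_def)
  then show ?case by (simp add: snoc sum.distrib)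
qed

lemma sum_ep_index:
  fixes f :: "nat \<times> 'x \<times> 'a \<Rightarrow> real"
  shows "(\<Sum>i\<in>coords H. of_bool (ep_index e (fst i) = i) * f i) = (\<Sum>t<H. f (ep_index e t))"
proof -
  have "(\<Sum>i\<in>coords H. of_bool (ep_index e (fst i) = i) * f i) = (\<Sum>i\<in>ep_index e ` {..<H}. of_bool (ep_index e (fst i) = i) * f i)"
    by (rule sum.mono_neutral_right) (auto simp: ep_index_def image_iff)
  also have "\<dots> = (\<Sum>t<H. of_bool (ep_index e (fst (ep_index e t)) = ep_index e t) * f (ep_index e t))"
    by (subst sum.reindex) (auto simp: inj_on_def ep_index_def)
  finally show ?thesis by (simp add: ep_index_def)
qed

lemma sum_ep_index_le:
  fixes f :: "nat \<times> 'x \<times> 'a \<Rightarrow> real"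
  assumes "\<And>i. 0 \<le> f i"
  shows "(\<Sum>t<H. f (ep_index e t)) \<le> (\<Sum>i\<in>coords H. f i)"
  unfolding sum_ep_index[symmetric] using assms by (intro sum_mono) (auto simp: of_bool_def)

text \<open>The visit to \<open>i\<close> that finds the count \<open>n\<close> is charged
  \<open>G n\<close>. The potential grows by exactly the charges of each episode, so sums over
  episodes telescope to a function of the final counts.\<close>

definition potential :: "(nat \<Rightarrow> real) \<Rightarrow> ('x, 'a) episode list \<Rightarrow> real" where
  "potential G h = (\<Sum>i\<in>coords H. \<Sum>n<visits h i. G n)"

lemma potential_snoc: "potential G (h @ [e]) = potential G h + (\<Sum>t<H. G (visits h (ep_index e t)))"
proof -
  have "(\<Sum>n<visits (h @ [e]) i. G n) = (\<Sum>n<visits h i. G n) + of_bool (ep_index e (fst i) = i) * G (visits h i)" for i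
    by (simp add: visits_snoc)
  then show ?thesis
    by (simp only: potential_def sum.distrib sum_ep_index[of e "\<lambda>i. G (visits h i)"])
qed

text \<open>The kernel in the hypothesis is the one by which \<open>weight\<close> extends a
  history, so the expected charges of an episode are the expected increment of the
  potential.\<close>

lemma bayes_regret_le_potential:
  assumes gap: "\<And>h. (\<integral>P. (\<integral>\<xi>. gap P (pol h \<xi>) \<partial>noise H) \<partial>mdp_prior H (posterior \<alpha> h))
    \<le> (\<Sum>e\<in>episodes H. kernel (post_mean h) h e * (\<Sum>t<H. G (visits h (ep_index e t)))) + c"
  shows "bayes_regret_rlsvi \<theta> v lam H \<rho> \<alpha> L \<le> (\<Sum>h\<in>hists L. weight h * potential G h) + real L * c"
proof (induction L)
  case 0
  show ?case by (simp add: bayes_regret_eq potential_def visits_def data_def split_beta')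
next
  case (Suc L)
  have "bayes_regret_rlsvi \<theta> v lam H \<rho> \<alpha> (Suc L) = bayes_regret_rlsvi \<theta> v lam H \<rho> \<alpha> L
     + (\<Sum>h\<in>hists L. weight h * (\<integral>P. (\<integral>\<xi>. gap P (pol h \<xi>) \<partial>noise H) \<partial>mdp_prior H (posterior \<alpha> h)))"
    by (simp add: bayes_regret_eq)
  also have "\<dots> \<le> ((\<Sum>h\<in>hists L. weight h * potential G h) + real L * c)
     + (\<Sum>h\<in>hists L. weight h * ((\<Sum>e\<in>episodes H. kernel (post_mean h) h e * (\<Sum>t<H. G (visits h (ep_index e t)))) + c))"
    by (intro add_mono Suc sum_mono mult_left_mono gap weight_nonneg)
  also have "\<dots> = (\<Sum>h\<in>hists L. weight h * (potential G h
       + (\<Sum>e\<in>episodes H. kernel (post_mean h) h e * (\<Sum>t<H. G (visits h (ep_index e t)))))) + c * (\<Sum>h\<in>hists L. weight h) + real L * c"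
    by (simp add: distrib_left sum.distrib sum_distrib_left mult_ac)
  also have "(\<Sum>h\<in>hists L. weight h * (potential G h
       + (\<Sum>e\<in>episodes H. kernel (post_mean h) h e * (\<Sum>t<H. G (visits h (ep_index e t))))))
     = (\<Sum>h\<in>hists (Suc L). weight h * potential G h)"
  proof -
    have "potential G h + (\<Sum>e\<in>episodes H. kernel (post_mean h) h e * (\<Sum>t<H. G (visits h (ep_index e t))))
       = (\<Sum>e\<in>episodes H. kernel (post_mean h) h e * potential G (h @ [e]))" for h
      unfolding potential_snoc distrib_left sum.distrib sum_distrib_right[symmetric] sum_kernel[OF valid_post_mean] by simp
    then show ?thesis unfolding sum_hists_Suc weight_snoc by (simp add: sum_distrib_left mult.assoc)
  qed
  finally show ?case by (simp add: sum_weight algebra_simps)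
qed

lemma bayes_regret_trivial: "bayes_regret_rlsvi \<theta> v lam H \<rho> \<alpha> L \<le> real H * real L"
proof -
  have "bayes_regret_rlsvi \<theta> v lam H \<rho> \<alpha> L \<le> (\<Sum>h\<in>hists L. weight h * potential (\<lambda>_. 0) h) + real L * real H"
  proof (rule bayes_regret_le_potential)
    fix h
    interpret prob_space "mdp_prior H (posterior \<alpha> h)" by (intro prob_space_mdp_prior valid_posterior \<alpha>)
    have "(\<integral>P. (\<integral>\<xi>. gap P (pol h \<xi>) \<partial>noise H) \<partial>mdp_prior H (posterior \<alpha> h)) \<le> real H"
    proof (rule integral_le_const)
      show "integrable (mdp_prior H (posterior \<alpha> h)) (\<lambda>P. \<integral>\<xi>. gap P (pol h \<xi>) \<partial>noise H)"
        by (rule integrable_mdp_prior[OF valid_posterior[OF \<alpha>] measurable_mean_gap mean_gap_bounds])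
      show "AE P in mdp_prior H (posterior \<alpha> h). (\<integral>\<xi>. gap P (pol h \<xi>) \<partial>noise H) \<le> real H"
        using AE_mdp_prior_valid[OF valid_posterior[OF \<alpha>]]
        by eventually_elim (use mean_gap_bounds in \<open>auto simp: abs_le_iff\<close>)
    qed
    then show "(\<integral>P. (\<integral>\<xi>. gap P (pol h \<xi>) \<partial>noise H) \<partial>mdp_prior H (posterior \<alpha> h))
      \<le> (\<Sum>e\<in>episodes H. kernel (post_mean h) h e * (\<Sum>t<H. 0)) + real H" by simp
  qed
  then show ?thesis by (simp add: potential_def mult.commute)
qed

text \<open>A form of Jensen's inequality: the hypothesis is an affine majorant based at the average
  count, and its slope term cancels because the visits within each period sum to \<open>L\<close>.
  Since the caller supplies the majorant, the partial sums of \<open>G\<close> may fail to be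
  concave.\<close>

lemma potential_le:
  assumes h: "h \<in> hists L" and G: "\<And>m. (\<Sum>n<m. G n) \<le> A + B * (real m - real L / (CARD('x) * CARD('a)))"
  shows "potential G h \<le> real H * (CARD('x) * CARD('a)) * A"
proof -
  let ?N = "real CARD('x) * real CARD('a)"
  have N: "0 < ?N" by simp
  have "potential G h \<le> (\<Sum>i\<in>coords H. A + B * (real (visits h i) - real L / ?N))"
    unfolding potential_def using G by (intro sum_mono) auto
  also have "\<dots> = (\<Sum>t<H. \<Sum>xa\<in>UNIV. A + B * (real (visits h (t, xa)) - real L / ?N))"
    by (simp add: sum.cartesian_product split_beta')
  also have "\<dots> = (\<Sum>t<H. ?N * A)"
  proof (rule sum.cong[OF refl])
    fix t assume "t \<in> {..<H}"
    then have "real (\<Sum>xa\<in>UNIV. visits h (t, xa)) = real L"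
      using h sum_visits[of t h] by (simp add: hists_def)
    then have v: "(\<Sum>xa\<in>UNIV. real (visits h (t, xa))) = real L" by simp
    have "(\<Sum>xa\<in>(UNIV :: ('x \<times> 'a) set). A + B * (real (visits h (t, xa)) - real L / ?N))
      = ?N * A + B * ((\<Sum>xa\<in>UNIV. real (visits h (t, xa))) - ?N * (real L / ?N))"
      by (simp add: sum.distrib sum_subtractf right_diff_distrib sum_distrib_left)
    then show "(\<Sum>xa\<in>(UNIV :: ('x \<times> 'a) set). A + B * (real (visits h (t, xa)) - real L / ?N)) = ?N * A"
      using N by (simp add: v)
  qed
  finally show ?thesis by (simp add: mult_ac)
qed

end

section \<open>Thresholds for the noise and the regret in terms of excesses\<close>

context rlsvi_tuned
begin

text \<open>Bounds the largest \<open>- \<xi> i\<close> by a threshold plus all excesses over it.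
  Unlike the maximum, this splits over coordinates in expectation.\<close>

definition shortfall :: "real \<Rightarrow> (nat \<times> 'x \<times> 'a \<Rightarrow> real) \<Rightarrow> real" where
  "shortfall z \<xi> = z + (\<Sum>i\<in>coords H. max 0 (- \<xi> i - z))"

lemma shortfall:
  assumes "0 \<le> z"
  shows "0 \<le> shortfall z \<xi>" "i \<in> coords H \<Longrightarrow> - \<xi> i \<le> shortfall z \<xi>"
proof -
  show "0 \<le> shortfall z \<xi>" using assms by (auto simp: shortfall_def intro!: add_nonneg_nonneg sum_nonneg)
  assume "i \<in> coords H"
  then have "max 0 (- \<xi> i - z) \<le> (\<Sum>i\<in>coords H. max 0 (- \<xi> i - z))" by (intro member_le_sum) auto
  then show "- \<xi> i \<le> shortfall z \<xi>" by (simp add: shortfall_def)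
qed

text \<open>Rewards and the prior value are nonnegative and the data weights sum to at most one, so
  a backup adds only its own noise to the loss, scaled by at most
  \<open>H / sqrt \<beta>\<close>.\<close>

lemma Q_rem_lower:
  assumes z: "0 \<le> z" and "k \<le> H"
  shows "- (real k * (real H / sqrt \<beta> * shortfall z \<xi>)) \<le> Q_rem h \<xi> k x a"
  using assms(2)
proof (induction k arbitrary: x a)
  case (Suc k)
  let ?i = "(H - Suc k, x, a)" and ?Z = "real H / sqrt \<beta> * shortfall z \<xi>"
  let ?b = "mass h ?i"
  let ?V = "\<lambda>w. of_bool (fst w) + Max (range (Q_rem h \<xi> k (snd w))) :: real"
  have b: "0 < ?b" "\<beta> \<le> ?b" by (rule mass)+
  have i: "?i \<in> coords H" using Suc.prems by simp
  have Z: "0 \<le> ?Z" using shortfall(1)[OF z] \<beta> by simp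
  have V: "- (real k * ?Z) \<le> ?V w" for w
  proof -
    have "- (real k * ?Z) \<le> Q_rem h \<xi> k (snd w) undefined" using Suc by simp
    also have "\<dots> \<le> Max (range (Q_rem h \<xi> k (snd w)))" by (rule Max_ge) auto
    finally show ?thesis by (simp add: of_bool_def)
  qed
  have "real H / sqrt ?b * - \<xi> ?i \<le> real H / sqrt ?b * shortfall z \<xi>"
    by (intro mult_left_mono shortfall(2)[OF z i]) (use b in auto)
  also have "\<dots> \<le> ?Z"
    using b \<beta> shortfall(1)[OF z] by (intro mult_right_mono divide_left_mono) auto
  finally have 1: "- ?Z \<le> real H / sqrt ?b * \<xi> ?i" by simp
  have sq: "(\<Sum>w\<in>UNIV. real (counts h ?i w) / ?b) \<le> 1"
  proof -
    have "(\<Sum>w\<in>UNIV. real (counts h ?i w) / ?b) = real (visits h ?i) / ?b"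
      by (simp only: sum_counts[symmetric] of_nat_sum sum_divide_distrib)
    also have "\<dots> \<le> 1" using \<beta> by (simp add: mass_def)
    finally show ?thesis .
  qed
  have "- (real k * ?Z) \<le> (\<Sum>w\<in>UNIV. real (counts h ?i w) / ?b) * - (real k * ?Z)"
  proof -
    have "(\<Sum>w\<in>UNIV. real (counts h ?i w) / ?b) * (real k * ?Z) \<le> 1 * (real k * ?Z)"
      by (intro mult_right_mono sq mult_nonneg_nonneg Z) simp
    then show ?thesis unfolding mult_minus_right mult_1 by (rule le_imp_neg_le)
  qed
  also have "\<dots> \<le> (\<Sum>w\<in>UNIV. real (counts h ?i w) / ?b * ?V w)"
    unfolding sum_distrib_right using b V by (intro sum_mono mult_left_mono) auto
  finally have 2: "- (real k * ?Z) \<le> (\<Sum>w\<in>UNIV. real (counts h ?i w) / ?b * ?V w)" .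
  have 3: "0 \<le> \<beta> * real H / ?b" using b \<beta> by simp
  have 4: "- (real (Suc k) * ?Z) = - (real k * ?Z) - ?Z"
    unfolding of_nat_Suc distrib_right mult_1 by linarith
  show ?case unfolding rlsvi_Qrem.simps rlsvi_F_eq 4 using 1 2 3 by linarith
qed simp

text \<open>Regression and posterior mean give the observed outcomes the same weights, so these
  cancel. What is left is the noise and the prior share, valued at \<open>H\<close> by the
  regression and at the next randomized values by the posterior mean; \<open>Q_rem_lower\<close>
  bounds that difference.\<close>

lemma bellman_error_le:
  assumes z: "0 \<le> z" and t: "t < H"
  shows "bellman_error h \<xi> t x a \<le> \<beta> / mass h (t, x, a) * (real H + real H * (real H / sqrt \<beta>) * shortfall z \<xi>)
    + real H * (\<xi> (t, x, a) / sqrt (mass h (t, x, a)))"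
proof -
  let ?i = "(t, x, a)" and ?k = "H - Suc t" and ?Z = "real H / sqrt \<beta> * shortfall z \<xi>"
  let ?b = "mass h ?i"
  let ?V = "\<lambda>w. of_bool (fst w) + Max (range (Q_rem h \<xi> ?k (snd w))) :: real"
  have k: "H - t = Suc ?k" "H - Suc ?k = t" using t by auto
  have b: "0 < ?b" by (rule mass)
  have Z: "0 \<le> ?Z" using shortfall(1)[OF z] \<beta> by simp
  have V: "real H - ?V w \<le> real H + real H * ?Z" for w
  proof -
    have "- (real H * ?Z) \<le> - (real ?k * ?Z)"
      by (intro le_imp_neg_le mult_right_mono Z) simp
    also have "\<dots> \<le> Q_rem h \<xi> ?k (snd w) undefined" by (rule Q_rem_lower[OF z]) simp
    also have "\<dots> \<le> Max (range (Q_rem h \<xi> ?k (snd w)))" by (rule Max_ge) auto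
    also have "\<dots> \<le> ?V w" by (simp add: of_bool_def)
    finally show ?thesis by linarith
  qed
  have "Q_rem h \<xi> (H - t) x a = (\<beta> * real H / ?b + real H / sqrt ?b * \<xi> ?i) + (\<Sum>w\<in>UNIV. real (counts h ?i w) / ?b * ?V w)"
    unfolding k(1) rlsvi_Qrem.simps k(2) by (rule rlsvi_F_eq)
  moreover have "(\<Sum>w\<in>UNIV. post_mean h ?i w * ?V w) = (\<Sum>w\<in>UNIV. \<alpha> ?i w / ?b * ?V w) + (\<Sum>w\<in>UNIV. real (counts h ?i w) / ?b * ?V w)"
  proof -
    have "post_mean h ?i w = \<alpha> ?i w / ?b + real (counts h ?i w) / ?b" for w
      unfolding post_mean_def mean_model_def mass(1) by (simp add: posterior_def add_divide_distrib)
    then show ?thesis by (simp only: distrib_right sum.distrib)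
  qed
  moreover have "\<beta> * real H / ?b = (\<Sum>w\<in>UNIV. \<alpha> ?i w / ?b * real H)"
    by (simp only: sum_distrib_right[symmetric] sum_divide_distrib[symmetric] sum_\<alpha>) simp
  moreover have "(\<Sum>w\<in>UNIV. \<alpha> ?i w / ?b * real H) - (\<Sum>w\<in>UNIV. \<alpha> ?i w / ?b * ?V w) = (\<Sum>w\<in>UNIV. \<alpha> ?i w / ?b * (real H - ?V w))"
    by (simp only: sum_subtractf[symmetric] right_diff_distrib)
  ultimately have "bellman_error h \<xi> t x a = (\<Sum>w\<in>UNIV. \<alpha> ?i w / ?b * (real H - ?V w)) + real H * (\<xi> ?i / sqrt ?b)"
    unfolding bellman_error_def by simp
  moreover have "(\<Sum>w\<in>UNIV. \<alpha> ?i w / ?b * (real H - ?V w)) \<le> (\<Sum>w\<in>UNIV. \<alpha> ?i w / ?b * (real H + real H * ?Z))"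
    using b \<alpha>_nonneg by (intro sum_mono mult_left_mono V) auto
  moreover have "(\<Sum>w\<in>UNIV. \<alpha> ?i w / ?b * (real H + real H * ?Z)) = \<beta> / ?b * (real H + real H * ?Z)"
    by (simp only: sum_distrib_right[symmetric] sum_divide_distrib[symmetric] sum_\<alpha>)
  ultimately show ?thesis by (simp add: mult.assoc)
qed

text \<open>The predictable part of the Bellman error at the visit that finds the count
  \<open>n\<close>: all noise is replaced by its thresholds, \<open>z\<close> for the depth of the
  values and \<open>g n\<close> for the noise at the visited coordinate.\<close>

definition bonus :: "real \<Rightarrow> (nat \<Rightarrow> real) \<Rightarrow> nat \<Rightarrow> real" where
  "bonus z g n = \<beta> / (\<beta> + real n) * (real H + real H * (real H / sqrt \<beta>) * z) + real H * g n"

lemma integral_excess: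
  assumes i: "i \<in> (coords H :: (nat \<times> 'x \<times> 'a) set)"
  shows "integrable (noise H) (\<lambda>\<xi>. max 0 (c * \<xi> i - d))"
    "(\<integral>\<xi>. max 0 (c * \<xi> i - d) \<partial>noise H) = (\<integral>u. max 0 (c * u - d) \<partial>std_normal)"
proof -
  have "integrable std_normal (\<lambda>u. max 0 (c * u - d))"
    using integrable_std_normal_id by (intro integrable_max Bochner_Integration.integrable_diff integrable_mult_right) auto
  from noise_component[OF i this]
  show "integrable (noise H) (\<lambda>\<xi>. max 0 (c * \<xi> i - d))"
    "(\<integral>\<xi>. max 0 (c * \<xi> i - d) \<partial>noise H) = (\<integral>u. max 0 (c * u - d) \<partial>std_normal)" .
qed

text \<open>The visited coordinates depend on the noise, so the noise met on the path cannot be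
  averaged directly. Excesses over the thresholds are nonnegative and may be summed over all
  coordinates, which removes the dependence on the path; the thresholds themselves depend on it only
  through counts.\<close>

lemma mean_gap_le_bonus:
  assumes z: "0 \<le> z" and \<psi>: "(\<integral>u. max 0 (u - z) \<partial>std_normal) \<le> \<psi>"
    and \<kappa>: "\<And>n. (\<integral>u. max 0 (u / sqrt (\<beta> + real n) - g n) \<partial>std_normal) \<le> \<kappa>"
  shows "(\<integral>P. (\<integral>\<xi>. gap P (pol h \<xi>) \<partial>noise H) \<partial>mdp_prior H (posterior \<alpha> h))
    \<le> (\<Sum>e\<in>episodes H. kernel (post_mean h) h e * (\<Sum>t<H. bonus z g (visits h (ep_index e t))))
      + (real H)\<^sup>2 * (CARD('x) * CARD('a)) * ((real H)\<^sup>2 / sqrt \<beta> * \<psi> + \<kappa>)"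
proof -
  let ?p = "\<lambda>\<xi> e. ep_prob \<rho> (post_mean h) H (pol h \<xi>) e"
  let ?C = "real H * (real H / sqrt \<beta>)"
  \<comment> \<open>The factor \<open>- 1\<close> casts the summand into the shape of
    \<open>integral_excess\<close>.\<close>
  define D where "D \<xi> = (\<Sum>i\<in>coords H. max 0 (- 1 * \<xi> i - z))" for \<xi> :: "nat \<times> 'x \<times> 'a \<Rightarrow> real"
  define X where "X \<xi> i = max 0 (1 / sqrt (mass h i) * \<xi> i - g (visits h i))" for \<xi> and i :: "nat \<times> 'x \<times> 'a"
  define R where "R \<xi> = real H * ?C * D \<xi> + real H * (\<Sum>i\<in>coords H. X \<xi> i)" for \<xi>
  have intD: "integrable (noise H) D" unfolding D_def[abs_def]
    by (intro Bochner_Integration.integrable_sum integral_excess)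
  have intX: "integrable (noise H) (\<lambda>\<xi>. X \<xi> i)" if "i \<in> coords H" for i
    unfolding X_def by (rule integral_excess[OF that])
  have intSX: "integrable (noise H) (\<lambda>\<xi>. \<Sum>i\<in>coords H. X \<xi> i)"
    by (intro Bochner_Integration.integrable_sum intX)
  have intR: "integrable (noise H) R" unfolding R_def[abs_def]
    using intD intSX by (intro Bochner_Integration.integrable_add integrable_mult_right)
  have cost: "ep_cost H (\<lambda>t x a w. bellman_error h \<xi> t x a) e \<le> (\<Sum>t<H. bonus z g (visits h (ep_index e t))) + R \<xi>" for \<xi> e
  proof -
    have D0: "0 \<le> D \<xi>" by (simp add: D_def sum_nonneg)
    have "bellman_error h \<xi> t (ep_state e t) (ep_action e t) \<le> bonus z g (visits h (ep_index e t)) + (?C * D \<xi> + real H * X \<xi> (ep_index e t))"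
      if t: "t < H" for t
    proof -
      let ?i = "ep_index e t"
      have b: "0 < mass h ?i" "\<beta> / mass h ?i \<le> 1" using mass[of h ?i] \<beta> by auto
      have sf: "shortfall z \<xi> = z + D \<xi>" by (simp add: shortfall_def D_def)
      have "bellman_error h \<xi> t (ep_state e t) (ep_action e t)
        \<le> \<beta> / mass h ?i * (real H + ?C * (z + D \<xi>)) + real H * (\<xi> ?i / sqrt (mass h ?i))"
        using bellman_error_le[OF z t, of h \<xi> "ep_state e t" "ep_action e t"] by (simp only: ep_index_def sf)
      also have "\<dots> = \<beta> / mass h ?i * (real H + ?C * z) + \<beta> / mass h ?i * (?C * D \<xi>) + real H * (\<xi> ?i / sqrt (mass h ?i))"
        by (simp only: distrib_left add.assoc)
      \<comment> \<open>Only the random part \<open>D\<close> gives up its decaying weight; its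
        expectation is made small by the choice of \<open>z\<close>.\<close>
      also have "\<dots> \<le> \<beta> / mass h ?i * (real H + ?C * z) + 1 * (?C * D \<xi>) + real H * (g (visits h ?i) + X \<xi> ?i)"
        using b D0 \<beta> by (intro add_mono mult_right_mono mult_left_mono order_refl) (auto simp: X_def)
      also have "\<dots> = bonus z g (visits h ?i) + (?C * D \<xi> + real H * X \<xi> ?i)"
        by (simp add: bonus_def mass_def distrib_left)
      finally show ?thesis .
    qed
    then have "ep_cost H (\<lambda>t x a w. bellman_error h \<xi> t x a) e
      \<le> (\<Sum>t<H. bonus z g (visits h (ep_index e t)) + (?C * D \<xi> + real H * X \<xi> (ep_index e t)))"
      unfolding ep_cost_def by (intro sum_mono) auto
    also have "\<dots> = (\<Sum>t<H. bonus z g (visits h (ep_index e t))) + (real H * ?C * D \<xi> + real H * (\<Sum>t<H. X \<xi> (ep_index e t)))"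
      by (simp add: sum.distrib sum_distrib_left)
    also have "(\<Sum>t<H. X \<xi> (ep_index e t)) \<le> (\<Sum>i\<in>coords H. X \<xi> i)"
      by (rule sum_ep_index_le) (simp add: X_def)
    finally show ?thesis by (simp add: R_def mult_left_mono)
  qed
  have intp: "integrable (noise H) (\<lambda>\<xi>. \<Sum>e\<in>episodes H. ?p \<xi> e * (\<Sum>t<H. bonus z g (visits h (ep_index e t))))"
    by (intro Bochner_Integration.integrable_sum integrable_mult_left integrable_ep_prob)
  have "(\<integral>P. (\<integral>\<xi>. gap P (pol h \<xi>) \<partial>noise H) \<partial>mdp_prior H (posterior \<alpha> h))
    \<le> (\<integral>\<xi>. (\<Sum>e\<in>episodes H. ?p \<xi> e * ep_cost H (\<lambda>t x a w. bellman_error h \<xi> t x a) e) \<partial>noise H)"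
    by (rule mean_gap_le_bellman)
  also have "\<dots> \<le> (\<integral>\<xi>. (\<Sum>e\<in>episodes H. ?p \<xi> e * (\<Sum>t<H. bonus z g (visits h (ep_index e t)))) + R \<xi> \<partial>noise H)"
  proof (rule Bochner_Integration.integral_mono)
    show "integrable (noise H) (\<lambda>\<xi>. \<Sum>e\<in>episodes H. ?p \<xi> e * ep_cost H (\<lambda>t x a w. bellman_error h \<xi> t x a) e)"
      unfolding ep_cost_def
      by (intro Bochner_Integration.integrable_sum integrable_ep_prob_mult integrable_bellman_error)
    show "integrable (noise H) (\<lambda>\<xi>. (\<Sum>e\<in>episodes H. ?p \<xi> e * (\<Sum>t<H. bonus z g (visits h (ep_index e t)))) + R \<xi>)"
      by (intro Bochner_Integration.integrable_add intp intR)
    fix \<xi>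
    have "(\<Sum>e\<in>episodes H. ?p \<xi> e * ep_cost H (\<lambda>t x a w. bellman_error h \<xi> t x a) e)
      \<le> (\<Sum>e\<in>episodes H. ?p \<xi> e * ((\<Sum>t<H. bonus z g (visits h (ep_index e t))) + R \<xi>))"
      by (intro sum_mono mult_left_mono cost ep_prob_bounds valid_post_mean)
    also have "\<dots> = (\<Sum>e\<in>episodes H. ?p \<xi> e * (\<Sum>t<H. bonus z g (visits h (ep_index e t)))) + R \<xi>"
      unfolding distrib_left sum.distrib sum_distrib_right[symmetric] sum_ep_prob_1[OF valid_post_mean] by simp
    finally show "(\<Sum>e\<in>episodes H. ?p \<xi> e * ep_cost H (\<lambda>t x a w. bellman_error h \<xi> t x a) e)
      \<le> (\<Sum>e\<in>episodes H. ?p \<xi> e * (\<Sum>t<H. bonus z g (visits h (ep_index e t)))) + R \<xi>" .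
  qed
  also have "\<dots> = (\<integral>\<xi>. (\<Sum>e\<in>episodes H. ?p \<xi> e * (\<Sum>t<H. bonus z g (visits h (ep_index e t)))) \<partial>noise H) + (\<integral>\<xi>. R \<xi> \<partial>noise H)"
    by (rule Bochner_Integration.integral_add[OF intp intR])
  also have "(\<integral>\<xi>. (\<Sum>e\<in>episodes H. ?p \<xi> e * (\<Sum>t<H. bonus z g (visits h (ep_index e t)))) \<partial>noise H)
    = (\<Sum>e\<in>episodes H. kernel (post_mean h) h e * (\<Sum>t<H. bonus z g (visits h (ep_index e t))))"
    unfolding kernel_def
    by (subst Bochner_Integration.integral_sum) (auto intro: integrable_mult_left integrable_ep_prob)
  also have "(\<integral>\<xi>. R \<xi> \<partial>noise H) \<le> (real H)\<^sup>2 * (CARD('x) * CARD('a)) * ((real H)\<^sup>2 / sqrt \<beta> * \<psi> + \<kappa>)"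
  proof -
    have card: "real (card (coords H :: (nat \<times> 'x \<times> 'a) set)) = real H * (CARD('x) * CARD('a))"
      by (simp add: card_cartesian_product)
    have "(\<integral>\<xi>. D \<xi> \<partial>noise H) = (\<Sum>i\<in>(coords H :: (nat \<times> 'x \<times> 'a) set). \<integral>u. max 0 (- 1 * u - z) \<partial>std_normal)"
      unfolding D_def
      by (subst Bochner_Integration.integral_sum[OF integral_excess(1)], assumption) (intro sum.cong refl integral_excess(2))
    also have "(\<integral>u. max 0 (- 1 * u - z) \<partial>std_normal) = (\<integral>u. max 0 (u - z) \<partial>std_normal)"
      using integral_std_normal_uminus[of "\<lambda>u. max 0 (u - z)"] by simp
    also have "(\<Sum>i\<in>(coords H :: (nat \<times> 'x \<times> 'a) set). \<integral>u. max 0 (u - z) \<partial>std_normal) \<le> real H * (CARD('x) * CARD('a)) * \<psi>"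
      unfolding sum_constant card using \<psi> by (intro mult_left_mono) auto
    finally have 1: "(\<integral>\<xi>. D \<xi> \<partial>noise H) \<le> real H * (CARD('x) * CARD('a)) * \<psi>" .
    have "(\<integral>\<xi>. (\<Sum>i\<in>coords H. X \<xi> i) \<partial>noise H) = (\<Sum>i\<in>coords H. \<integral>u. max 0 (1 / sqrt (mass h i) * u - g (visits h i)) \<partial>std_normal)"
      by (subst Bochner_Integration.integral_sum[OF intX], assumption) (unfold X_def, intro sum.cong refl integral_excess)
    also have "\<dots> \<le> (\<Sum>i\<in>(coords H :: (nat \<times> 'x \<times> 'a) set). \<kappa>)"
      using \<kappa> by (intro sum_mono) (simp add: mass_def)
    also have "\<dots> = real H * (CARD('x) * CARD('a)) * \<kappa>" unfolding sum_constant card ..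
    finally have 2: "(\<integral>\<xi>. (\<Sum>i\<in>coords H. X \<xi> i) \<partial>noise H) \<le> real H * (CARD('x) * CARD('a)) * \<kappa>" .
    have "(\<integral>\<xi>. R \<xi> \<partial>noise H) = real H * ?C * (\<integral>\<xi>. D \<xi> \<partial>noise H) + real H * (\<integral>\<xi>. (\<Sum>i\<in>coords H. X \<xi> i) \<partial>noise H)"
      unfolding R_def using intD intSX by (subst Bochner_Integration.integral_add) (auto intro: integrable_mult_right)
    also have "\<dots> \<le> real H * ?C * (real H * (CARD('x) * CARD('a)) * \<psi>) + real H * (real H * (CARD('x) * CARD('a)) * \<kappa>)"
      using \<beta> by (intro add_mono mult_left_mono 1 2) auto
    finally show ?thesis by (simp add: power2_eq_square algebra_simps)
  qed
  finally show ?thesis by simp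
qed

theorem bayes_regret_le:
  assumes z: "0 \<le> z" and \<psi>: "(\<integral>u. max 0 (u - z) \<partial>std_normal) \<le> \<psi>"
    and \<kappa>: "\<And>n. (\<integral>u. max 0 (u / sqrt (\<beta> + real n) - g n) \<partial>std_normal) \<le> \<kappa>"
    and A: "\<And>m. (\<Sum>n<m. bonus z g n) \<le> A + B * (real m - real L / (CARD('x) * CARD('a)))"
  shows "bayes_regret_rlsvi (\<lambda>_. real H) ((real H)\<^sup>2) ((real H)\<^sup>2 / \<beta>) H \<rho> \<alpha> L
    \<le> real H * (CARD('x) * CARD('a)) * A + real L * ((real H)\<^sup>2 * (CARD('x) * CARD('a)) * ((real H)\<^sup>2 / sqrt \<beta> * \<psi> + \<kappa>))"
proof -
  have "(\<Sum>h\<in>hists L. weight h * potential (bonus z g) h) \<le> real H * (CARD('x) * CARD('a)) * A"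
    by (rule sum_weight_le) (rule potential_le[OF _ A])
  with bayes_regret_le_potential[OF mean_gap_le_bonus[OF z \<psi> \<kappa>], of L] show ?thesis by linarith
qed

end

subsection \<open>Numerical estimates\<close>

text \<open>The tangent bound \<open>u\<^sup>2 / 2 \<ge> l * u - l\<^sup>2 / 2\<close> replaces the
  density by an exponential with an explicit integral. The slope \<open>l\<close> is kept apart from
  \<open>c\<close>: \<open>l = c\<close> gives the usual tail, whereas a fixed \<open>l\<close>
  gives pure exponential decay in \<open>c\<close>, which a logarithmic threshold can
  balance.\<close>

lemma integral_std_normal_excess_le:
  assumes l: "0 < l"
  shows "(\<integral>u. max 0 (u - c) \<partial>std_normal) \<le> exp (l\<^sup>2 / 2 - l * c) / (sqrt (2 * pi) * l\<^sup>2)"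
proof -
  let ?K = "exp (l\<^sup>2 / 2) / sqrt (2 * pi)"
  have int: "integrable std_normal (\<lambda>u. max 0 (u - c))"
    using integrable_std_normal_id by (intro integrable_max Bochner_Integration.integrable_diff) auto
  have le: "std_normal_density u * max 0 (u - c) \<le> ?K * ((u - c) * exp (- (l * u))) * indicator {c..} u" for u
  proof (cases "c \<le> u")
    case True
    have "0 \<le> (u - l)\<^sup>2" by simp
    then have "2 * (l * u) \<le> u\<^sup>2 + l\<^sup>2" by (simp add: power2_diff mult_ac)
    then have "- u\<^sup>2 / 2 \<le> l\<^sup>2 / 2 + - (l * u)" by simp
    then have "exp (- u\<^sup>2 / 2) \<le> exp (l\<^sup>2 / 2) * exp (- (l * u))" unfolding exp_add[symmetric] by simp
    then have "std_normal_density u \<le> ?K * exp (- (l * u))"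
      by (simp add: std_normal_density_def divide_right_mono)
    from mult_right_mono[OF this, of "u - c"] True show ?thesis by (simp add: mult_ac)
  qed simp
  have le': "ennreal (std_normal_density u * max 0 (u - c)) \<le> ennreal (?K * ((u - c) * exp (- (l * u)))) * indicator {c..} u" for u
  proof (cases "c \<le> u")
    case True
    then have "indicator {c..} u = (1 :: real)" "indicator {c..} u = (1 :: ennreal)" by auto
    with le[of u] show ?thesis by (simp only: mult_1_right ennreal_leI)
  qed simp
  have "ennreal (\<integral>u. max 0 (u - c) \<partial>std_normal) = (\<integral>\<^sup>+ u. ennreal (max 0 (u - c)) \<partial>std_normal)"
    by (rule nn_integral_eq_integral[OF int, symmetric]) simp
  also have "\<dots> = (\<integral>\<^sup>+ u. ennreal (std_normal_density u * max 0 (u - c)) \<partial>lborel)"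
    by (subst nn_integral_density) (auto simp: ennreal_mult normal_density_nonneg)
  also have "\<dots> \<le> (\<integral>\<^sup>+ u. ennreal (?K * ((u - c) * exp (- (l * u)))) * indicator {c..} u \<partial>lborel)"
    by (rule nn_integral_mono) (rule le')
  also have "\<dots> = ennreal (0 - (- ?K * ((c - c) / l + 1 / l\<^sup>2) * exp (- (l * c))))"
  proof (rule nn_integral_FTC_atLeast[where F="\<lambda>u. - ?K * ((u - c) / l + 1 / l\<^sup>2) * exp (- (l * u))"])
    show "((\<lambda>u. - ?K * ((u - c) / l + 1 / l\<^sup>2) * exp (- (l * u))) \<longlongrightarrow> 0) at_top"
    proof -
      have "((\<lambda>u. ((u - c) / l + 1 / l\<^sup>2) * exp (- (l * u))) \<longlongrightarrow> 0) at_top"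
        using l by real_asymp
      from tendsto_mult[OF tendsto_const[of "- ?K"] this] show ?thesis by (simp add: mult.assoc)
    qed
    fix u assume "c \<le> u"
    then show "0 \<le> ?K * ((u - c) * exp (- (l * u)))" by simp
    show "((\<lambda>u. - ?K * ((u - c) / l + 1 / l\<^sup>2) * exp (- (l * u))) has_real_derivative ?K * ((u - c) * exp (- (l * u)))) (at u)"
    proof -
      have "((\<lambda>u. ((u - c) / l + 1 / l\<^sup>2) * exp (- (l * u))) has_real_derivative
          1 / l * exp (- (l * u)) + ((u - c) / l + 1 / l\<^sup>2) * (exp (- (l * u)) * - l)) (at u)"
        using l by (auto intro!: derivative_eq_intros)
      moreover have "1 / l * exp (- (l * u)) + ((u - c) / l + 1 / l\<^sup>2) * (exp (- (l * u)) * - l) = - ((u - c) * exp (- (l * u)))"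
        using l by (simp add: field_simps power2_eq_square)
      ultimately have "((\<lambda>u. ((u - c) / l + 1 / l\<^sup>2) * exp (- (l * u))) has_real_derivative - ((u - c) * exp (- (l * u)))) (at u)"
        by (simp only:)
      from DERIV_cmult[OF this, of "- ?K"] show ?thesis by (simp only: minus_mult_minus mult.assoc)
    qed
  qed simp
  finally have "(\<integral>u. max 0 (u - c) \<partial>std_normal) \<le> ?K * (1 / l\<^sup>2) * exp (- (l * c))"
    using l by (simp add: ennreal_le_iff)
  also have "\<dots> = exp (l\<^sup>2 / 2 - l * c) / (sqrt (2 * pi) * l\<^sup>2)"
  proof -
    have "exp (l\<^sup>2 / 2 - l * c) = exp (l\<^sup>2 / 2) * exp (- (l * c))" by (simp flip: exp_add)
    then show ?thesis by simp
  qed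
  finally show ?thesis .
qed

text \<open>Here \<open>2 \<le> \<beta>\<close> enters: it bounds the denominators below by
  \<open>n + 2\<close>, so each term fits under an increment of \<open>ln (1 + n)\<close> and the
  sum has no additive constant.\<close>

lemma sum_inverse_le_ln: "2 \<le> \<beta> \<Longrightarrow> (\<Sum>n<m. \<beta> / (\<beta> + real n)) \<le> \<beta> * ln (1 + real m)"
proof (induction m)
  case (Suc m)
  have "\<beta> / (\<beta> + real m) \<le> \<beta> * (1 / (2 + real m))"
    using Suc.prems by (simp add: frac_le)
  also have "1 / (2 + real m) \<le> ln (1 + real (Suc m)) - ln (1 + real m)"
  proof -
    have "ln ((1 + real m) / (2 + real m)) \<le> (1 + real m) / (2 + real m) - 1"
      by (rule ln_le_minus_one) simp
    also have "\<dots> = - (1 / (2 + real m))" by (simp add: field_simps)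
    finally show ?thesis by (simp add: ln_div)
  qed
  finally show ?case using Suc by (simp add: right_diff_distrib)
qed simp

lemma ln_tangent:
  assumes "0 \<le> (y::real)" "0 \<le> m"
  shows "ln (1 + m) \<le> ln (1 + y) + (m - y) / (1 + y)"
proof -
  have "ln ((1 + m) / (1 + y)) \<le> (1 + m) / (1 + y) - 1"
    using assms by (intro ln_le_minus_one) auto
  also have "\<dots> = (m - y) / (1 + y)" using assms by (simp add: field_simps)
  finally show ?thesis using assms by (simp add: ln_div)
qed

text \<open>\<open>log_rate\<close> is the threshold for noise of variance \<open>1 / x\<close>: its logarithmic term turns the bound
  \<open>exp (- l c)\<close> on the Gaussian excess over \<open>c\<close> into a multiple of \<open>sqrt x\<close>, so that the excess of the scaled
  noise is the same for all \<open>x\<close>.\<close>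
definition log_rate :: "real \<Rightarrow> real \<Rightarrow> real \<Rightarrow> real \<Rightarrow> real" where
  "log_rate E l m0 x = (E - ln (x / m0)) / (2 * l * sqrt x)"

text \<open>The antiderivative of \<open>log_rate\<close> that vanishes at 0.\<close>

definition log_rate_sum :: "real \<Rightarrow> real \<Rightarrow> real \<Rightarrow> real \<Rightarrow> real" where
  "log_rate_sum E l m0 x = sqrt x * (E + 2 - ln (x / m0)) / l"

lemma log_rate_sum_deriv:
  assumes "0 < x" "0 < l" "0 < m0"
  shows "(log_rate_sum E l m0 has_real_derivative log_rate E l m0 x) (at x)"
proof -
  have "((\<lambda>x. sqrt x * (E + 2 - ln (x / m0)) / l) has_real_derivative
      ((inverse (sqrt x) / 2) * (E + 2 - ln (x / m0)) + (0 + 0 - 1 / (x / m0) * (1 / m0)) * sqrt x) / l) (at x)"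
    using assms by (auto intro!: derivative_eq_intros)
  moreover have "((inverse (sqrt x) / 2) * (E + 2 - ln (x / m0)) + (0 + 0 - 1 / (x / m0) * (1 / m0)) * sqrt x) / l = log_rate E l m0 x"
  proof -
    have "1 / (x / m0) * (1 / m0) * sqrt x = inverse (sqrt x)"
      using assms by (simp add: sqrt_divide_self_eq)
    then have "(inverse (sqrt x) / 2) * (E + 2 - ln (x / m0)) + (0 + 0 - 1 / (x / m0) * (1 / m0)) * sqrt x
      = (inverse (sqrt x) / 2) * (E + 2 - ln (x / m0)) - inverse (sqrt x)" by simp
    also have "\<dots> = inverse (sqrt x) / 2 * (E - ln (x / m0))" by (simp add: algebra_simps)
    finally show ?thesis by (simp add: log_rate_def field_simps)
  qed
  ultimately show ?thesis by (simp add: log_rate_sum_def[abs_def])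
qed

text \<open>Comparison of a sum with an integral. While it is positive \<open>log_rate\<close>
  decreases, and \<open>1 \<le> \<beta>\<close> places its argument to the right of the interval
  from \<open>n\<close> to \<open>n + 1\<close>.\<close>

lemma log_rate_step:
  assumes \<beta>: "1 \<le> \<beta>" and l: "0 < l" and m0: "0 < m0" and pos: "ln ((\<beta> + real n) / m0) < E"
  shows "log_rate E l m0 (\<beta> + real n) \<le> log_rate_sum E l m0 (real (Suc n)) - log_rate_sum E l m0 (real n)"
proof -
  have mono: "log_rate E l m0 (\<beta> + real n) \<le> log_rate E l m0 \<zeta>" if "0 < \<zeta>" "\<zeta> \<le> \<beta> + real n" for \<zeta>
  proof -
    have "ln (\<zeta> / m0) \<le> ln ((\<beta> + real n) / m0)" using that m0 by (simp add: divide_right_mono)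
    with pos show ?thesis unfolding log_rate_def using that l by (intro frac_le) auto
  qed
  show ?thesis
  \<comment> \<open>The antiderivative is not differentiable at 0, so the mean value theorem is
    replaced by a direct comparison in the first step.\<close>
  proof (cases "n = 0")
    case True
    have "log_rate E l m0 (\<beta> + real n) \<le> log_rate E l m0 1" using \<beta> True by (intro mono) auto
    also have "\<dots> = (E - ln (1 / m0)) / (2 * l)" by (simp add: log_rate_def)
    also have "\<dots> \<le> (E + 2 - ln (1 / m0)) / l"
    proof -
      have "ln (1 / m0) \<le> ln (\<beta> / m0)" using \<beta> m0 by (simp add: divide_right_mono)
      then have "0 \<le> E - ln (1 / m0)" using pos True by simp
      with l show ?thesis by (intro frac_le) auto
    qed
    finally show ?thesis using True by (simp add: log_rate_sum_def)
  next
    case False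
    then have n: "0 < real n" by simp
    have "\<exists>\<zeta>. real n < \<zeta> \<and> \<zeta> < real (Suc n) \<and> log_rate_sum E l m0 (real (Suc n)) - log_rate_sum E l m0 (real n)
      = (real (Suc n) - real n) * log_rate E l m0 \<zeta>"
      using n l m0 by (intro MVT2 log_rate_sum_deriv) auto
    then obtain \<zeta> where "real n < \<zeta>" "\<zeta> < real (Suc n)"
      "log_rate_sum E l m0 (real (Suc n)) - log_rate_sum E l m0 (real n) = log_rate E l m0 \<zeta>" by auto
    with mono[of \<zeta>] \<beta> n show ?thesis by simp
  qed
qed

text \<open>The right side is the tangent at \<open>m0\<close>, with slope
  \<open>log_rate E l m0 m0\<close>. As the function is concave only up to
  \<open>m0 * exp (E + 2)\<close>, the inequality is checked directly in terms of
  \<open>t = sqrt (x / m0)\<close>.\<close>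

lemma log_rate_sum_tangent:
  assumes E: "0 \<le> E" and l: "0 < l" and m0: "0 < m0" and x: "0 \<le> x"
  shows "log_rate_sum E l m0 x \<le> sqrt m0 * (E + 2) / l + E / (2 * l * sqrt m0) * (x - m0)"
proof -
  define t where "t = sqrt (x / m0)"
  have t: "0 \<le> t" "t\<^sup>2 = x / m0" "sqrt x = sqrt m0 * t" "x = m0 * t\<^sup>2"
    using x m0 by (auto simp: t_def real_sqrt_divide power_divide)
  have "t * (E + 2 - ln (x / m0)) \<le> E + 2 + E / 2 * (t\<^sup>2 - 1)"
  proof (cases "t = 0")
    case True
    then show ?thesis using E by simp
  next
    case False
    with t have t0: "0 < t" by simp
    have ln: "ln (x / m0) = 2 * ln t" using t0 t(2) by (simp add: ln_realpow flip: t(2))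
    have "ln (1 / t) \<le> 1 / t - 1" using t0 by (intro ln_le_minus_one) auto
    then have "t * (- ln t) \<le> t * (1 / t - 1)" using t0 by (intro mult_left_mono) (auto simp: ln_div)
    then have 1: "- (t * ln t) \<le> 1 - t" using t0 by (simp add: right_diff_distrib)
    have "0 \<le> E * (t - 1)\<^sup>2" using E by simp
    then have "E * t \<le> E / 2 * (t\<^sup>2 + 1)" by (simp add: power2_eq_square algebra_simps)
    with 1 show ?thesis unfolding ln by (simp add: algebra_simps)
  qed
  then have "sqrt m0 * (t * (E + 2 - ln (x / m0))) / l \<le> sqrt m0 * (E + 2 + E / 2 * (t\<^sup>2 - 1)) / l"
    using l m0 by (intro divide_right_mono mult_left_mono) auto
  also have "\<dots> = sqrt m0 * (E + 2) / l + E / (2 * l * sqrt m0) * (m0 * t\<^sup>2 - m0)"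
  proof -
    have s: "0 < sqrt m0" "m0 = sqrt m0 * sqrt m0" using m0 by auto
    have "E / (2 * l * sqrt m0) * (m0 * t\<^sup>2 - m0) = E / (2 * l * sqrt m0) * ((sqrt m0 * sqrt m0) * (t\<^sup>2 - 1))"
      using m0 by (simp add: right_diff_distrib)
    also have "\<dots> = sqrt m0 * (E / 2 * (t\<^sup>2 - 1)) / l"
    proof -
      have "E / (2 * l * r) * ((r * r) * X) = r * (E / 2 * X) / l" if "r \<noteq> 0" for r X
        using that l by simp
      from this[of "sqrt m0" "t\<^sup>2 - 1"] s(1) show ?thesis by (simp only: less_imp_neq[symmetric] not_False_eq_True)
    qed
    finally show ?thesis by (simp add: distrib_left add_divide_distrib)
  qed
  finally show ?thesis unfolding log_rate_sum_def t(3) t(4)[symmetric] by (simp only: mult.assoc)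
qed

lemma sum_log_rate_le:
  assumes E: "0 \<le> E" and l: "0 < l" and m0: "0 < m0" and \<beta>: "1 \<le> \<beta>"
  shows "(\<Sum>n<m. max 0 (log_rate E l m0 (\<beta> + real n))) \<le> sqrt m0 * (E + 2) / l + E / (2 * l * sqrt m0) * (real m - m0)"
proof -
  have all_pos: "(\<Sum>n<m. max 0 (log_rate E l m0 (\<beta> + real n))) \<le> log_rate_sum E l m0 (real m)"
    if "\<forall>n<m. ln ((\<beta> + real n) / m0) < E" for m
    using that
  proof (induction m)
    case (Suc m)
    have pos: "ln ((\<beta> + real m) / m0) < E" using Suc.prems by simp
    then have "0 \<le> log_rate E l m0 (\<beta> + real m)" using l \<beta> by (simp add: log_rate_def)
    then show ?case using Suc log_rate_step[OF \<beta> l m0 pos] by simp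
  qed (simp add: log_rate_sum_def)
  \<comment> \<open>The truncated terms vanish once the logarithm reaches \<open>E\<close>, so the
    sum effectively stops at some \<open>m'\<close>; the nonnegative slope of the tangent then
    allows a return from \<open>m'\<close> to \<open>m\<close>.\<close>
  have "\<exists>m'\<le>m. (\<Sum>n<m. max 0 (log_rate E l m0 (\<beta> + real n))) \<le> log_rate_sum E l m0 (real m')"
  proof (induction m)
    case 0
    show ?case by (auto simp: log_rate_sum_def)
  next
    case (Suc m)
    show ?case
    proof (cases "ln ((\<beta> + real m) / m0) < E")
      case True
      have "ln ((\<beta> + real n) / m0) < E" if "n < Suc m" for n
      proof -
        have "ln ((\<beta> + real n) / m0) \<le> ln ((\<beta> + real m) / m0)"
          using that \<beta> m0 by (simp add: divide_right_mono)
        with True show ?thesis by simp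
      qed
      with all_pos[of "Suc m"] show ?thesis by blast
    next
      case False
      then have "log_rate E l m0 (\<beta> + real m) \<le> 0"
        using l \<beta> by (simp add: log_rate_def divide_nonpos_pos)
      with Suc show ?thesis by (auto intro: le_SucI)
    qed
  qed
  then obtain m' where m': "m' \<le> m" "(\<Sum>n<m. max 0 (log_rate E l m0 (\<beta> + real n))) \<le> log_rate_sum E l m0 (real m')"
    by blast
  note m'(2)
  also have "log_rate_sum E l m0 (real m') \<le> sqrt m0 * (E + 2) / l + E / (2 * l * sqrt m0) * (real m' - m0)"
    by (rule log_rate_sum_tangent[OF E l m0]) simp
  also have "\<dots> \<le> sqrt m0 * (E + 2) / l + E / (2 * l * sqrt m0) * (real m - m0)"
    using m'(1) E l m0 by (intro add_left_mono mult_left_mono) auto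
  finally show ?thesis .
qed

text \<open>\<open>E\<close> is solved from the requirement that the exponential bound equal
  \<open>k / sqrt m0\<close>, which leaves \<open>k\<close> as the exchange rate between thresholds
  and excess. Cutting the threshold off at 0 only raises it.\<close>

lemma log_rate_excess:
  fixes l m0 k x :: real
  assumes l: "0 < l" and m0: "0 < m0" and k: "0 < k" and x: "0 < x"
  defines "E \<equiv> 2 * ln (exp (l\<^sup>2 / 2) / (sqrt (2 * pi) * l\<^sup>2) / k)"
  shows "(\<integral>u. max 0 (u / sqrt x - max 0 (log_rate E l m0 x)) \<partial>std_normal) \<le> k / sqrt m0"
proof -
  let ?B = "exp (l\<^sup>2 / 2) / (sqrt (2 * pi) * l\<^sup>2)"
  define c where "c = (E - ln (x / m0)) / (2 * l)"
  have B: "0 < ?B" using l by simp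
  have int: "integrable std_normal (\<lambda>u. max 0 (u - d))" for d
    using integrable_std_normal_id by (intro integrable_max Bochner_Integration.integrable_diff) auto
  have int': "integrable std_normal (\<lambda>u. max 0 (u / sqrt x - d))" for d
    using integrable_std_normal_id by (intro integrable_max Bochner_Integration.integrable_diff) auto
  have "(\<integral>u. max 0 (u / sqrt x - max 0 (log_rate E l m0 x)) \<partial>std_normal) \<le> (\<integral>u. 1 / sqrt x * max 0 (u - c) \<partial>std_normal)"
  proof (rule Bochner_Integration.integral_mono[OF int'])
    fix u
    have "log_rate E l m0 x = c / sqrt x" by (simp add: log_rate_def c_def)
    then have "u / sqrt x - max 0 (log_rate E l m0 x) \<le> 1 / sqrt x * (u - c)" by (simp add: diff_divide_distrib)
    also have "\<dots> \<le> 1 / sqrt x * max 0 (u - c)" using x by (intro mult_left_mono) auto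
    finally show "max 0 (u / sqrt x - max 0 (log_rate E l m0 x)) \<le> 1 / sqrt x * max 0 (u - c)" using x by simp
  qed (intro integrable_mult_right int)
  also have "\<dots> = 1 / sqrt x * (\<integral>u. max 0 (u - c) \<partial>std_normal)" by (rule integral_mult_right_zero)
  also have "\<dots> \<le> 1 / sqrt x * (exp (l\<^sup>2 / 2 - l * c) / (sqrt (2 * pi) * l\<^sup>2))"
    using x by (intro mult_left_mono integral_std_normal_excess_le l) auto
  also have "exp (l\<^sup>2 / 2 - l * c) / (sqrt (2 * pi) * l\<^sup>2) = ?B * exp (- (l * c))"
  proof -
    have "exp (l\<^sup>2 / 2 - l * c) = exp (l\<^sup>2 / 2) * exp (- (l * c))" by (simp flip: exp_add)
    then show ?thesis by (simp only: times_divide_eq_left)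
  qed
  also have "exp (- (l * c)) = k / ?B * sqrt (x / m0)"
  proof -
    have "l * c = (E - ln (x / m0)) / 2" using l by (simp add: c_def)
    moreover have "E / 2 = ln (?B / k)" unfolding E_def by (rule nonzero_mult_div_cancel_left) simp
    moreover have "- p = X / 2 - Y" if "p = (E - X) / 2" "E / 2 = Y" for p X Y using that by (simp add: field_simps)
    ultimately have "- (l * c) = ln (x / m0) / 2 - ln (?B / k)" by blast
    moreover have "exp (ln X / 2 - ln Y) = sqrt X / Y" if "0 < X" "0 < Y" for X Y :: real
      using that by (simp add: exp_diff flip: ln_sqrt)
    ultimately have "exp (- (l * c)) = sqrt (x / m0) / (?B / k)"
      using x m0 B k by (simp only: divide_pos_pos)
    note e = this
    have pk: "p / (b / k) = k / b * p" for p b by simp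
    show ?thesis unfolding e by (rule pk)
  qed
  also have "1 / sqrt x * (?B * (k / ?B * sqrt (x / m0))) = k / sqrt m0"
  proof -
    have "B * (k / B * r) = k * r" if "0 < B" for B r :: real using that by simp
    then have "?B * (k / ?B * sqrt (x / m0)) = k * sqrt (x / m0)" using B by blast
    moreover have "1 / sqrt x * (k * sqrt (x / m0)) = k / sqrt m0" using x by (simp add: real_sqrt_divide)
    ultimately show ?thesis by (simp only:)
  qed
  finally show ?thesis .
qed

text \<open>The exponent \<open>\<lambda>\<^sup>2 = 2 ln N + 9/5\<close> is a near-optimal choice for every \<open>N \<ge> 2\<close>; the margin
  is smallest at \<open>N = 2\<close>.\<close>
lemma log_rate_constants:
  assumes N: "2 \<le> (N::real)"
  defines "l \<equiv> sqrt (2 * ln N + 9 / 5)"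
  defines "E \<equiv> 2 * ln (exp (l\<^sup>2 / 2) / (sqrt (2 * pi) * l\<^sup>2) / (2 / (l * N)))"
  shows "0 < l" "0 \<le> E" "(E + 4) / l \<le> 2 * sqrt (2 * ln N)"
proof -
  define s where "s = 2 * ln N + 9 / 5"
  define M where "M = sqrt (2 * ln N)"
  have ln2: "693 / 1000 \<le> ln (2::real)" "ln (2::real) \<le> 25 / 36"
  proof -
    have "(ln (2::real)) \<ge> 2 * (\<Sum>k<4. 1 / real (2 * k + 1) * (1 / 3) ^ (2 * k + 1))"
      using ln_approx_bounds[of 2 4] by (simp add: eval_nat_numeral)
    then show "693 / 1000 \<le> ln (2::real)" by (simp add: eval_nat_numeral)
    show "ln (2::real) \<le> 25 / 36" by (rule ln2_le_25_over_36)
  qed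
  have lnN: "ln 2 \<le> ln N" using N by simp
  have s: "3186 / 1000 \<le> s" using ln2(1) lnN by (simp add: s_def)
  have l: "l = sqrt s" "l\<^sup>2 = s" using s by (auto simp: l_def s_def)
  show l0: "0 < l" using s by (simp add: l(1))
  have lge: "1784 / 1000 \<le> l"
    unfolding l(1) by (rule real_le_rsqrt) (use s in \<open>simp add: power2_eq_square\<close>)
  have Mge: "1177 / 1000 \<le> M"
    unfolding M_def by (rule real_le_rsqrt) (use lnN ln2(1) in \<open>simp add: power2_eq_square\<close>)
  have M2: "M\<^sup>2 = s - 9 / 5" using lnN ln2(1) by (simp add: M_def s_def)
  have pi: "31415 / 10000 \<le> pi" "pi \<le> 31416 / 10000" using pi_approx by auto
  \<comment> \<open>With \<open>E = 2 * s - 9 / 5 - W\<close> and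
    \<open>2 * M * l = 2 * s - 9 / 5 - (l - M)\<^sup>2\<close>, the last claim amounts to
    \<open>4 + (l - M)\<^sup>2 \<le> W\<close>. The estimates below give 4.37 on the left and 4.376
    on the right.\<close>
  define W where "W = ln (8 * pi * s)"
  have E: "E = 2 * s - 9 / 5 - W"
  proof -
    have "exp (l\<^sup>2 / 2) / (sqrt (2 * pi) * l\<^sup>2) / (2 / (l * N)) = exp (s / 2) * N / (2 * sqrt (2 * pi) * l)"
      using l0 N by (simp add: power2_eq_square l(2)[symmetric])
    then have "E = 2 * (ln (exp (s / 2)) + ln N - ln (2 * sqrt (2 * pi) * l))"
      unfolding E_def using l0 N by (simp only: ln_div ln_mult exp_gt_zero mult_pos_pos) (simp add: ln_div ln_mult)
    also have "\<dots> = s + 2 * ln N - 2 * ln (2 * sqrt (2 * pi) * l)" by simp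
    also have "2 * ln (2 * sqrt (2 * pi) * l) = ln ((2 * sqrt (2 * pi) * l)\<^sup>2)"
      using l0 by (subst ln_realpow) auto
    also have "(2 * sqrt (2 * pi) * l)\<^sup>2 = 8 * pi * s" by (simp add: power_mult_distrib l(2))
    finally show ?thesis by (simp add: W_def s_def)
  qed
  \<comment> \<open>At \<open>N = 2\<close> the argument of \<open>W\<close> is barely above 80, and
    \<open>80 = 2^6 * 5 / 4\<close> reduces its logarithm to that of 2 and a small
    remainder.\<close>
  have ln80: "ln (80::real) = 6 * ln 2 + ln (5 / 4)"
  proof -
    have "ln (64::real) = 6 * ln 2" using ln_realpow[of 2 6] by simp
    moreover have "ln (80::real) = ln 64 + ln (5 / 4)" using ln_mult[of 64 "5 / 4 :: real"] by simp
    ultimately show ?thesis by simp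
  qed
  have W_ge: "4376 / 1000 \<le> W"
  proof -
    have "80 \<le> 8 * pi * s"
    proof -
      have "80 \<le> 8 * (31415 / 10000) * (3186 / 1000 :: real)" by simp
      also have "\<dots> \<le> 8 * pi * s" using pi s by (intro mult_mono) auto
      finally show ?thesis .
    qed
    then have "ln 80 \<le> W" unfolding W_def by (intro ln_mono) auto
    moreover have "22 / 100 \<le> ln (5 / 4 :: real)"
      using ln_approx_bounds[of "5/4" 2] by (simp add: eval_nat_numeral)
    ultimately show ?thesis using ln2(1) ln80 by linarith
  qed
  have W_le: "W \<le> 6 * (25 / 36) + 1 / 4 + (8 * pi * s / 80 - 1)"
  proof -
    have "ln (8 * pi * s / 80) \<le> 8 * pi * s / 80 - 1" using s by (intro ln_le_minus_one) auto
    moreover have "ln (8 * pi * s / 80) = W - ln 80" unfolding W_def using s by (subst ln_div) auto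
    moreover have "ln (5 / 4 :: real) \<le> 5 / 4 - 1" by (rule ln_le_minus_one) simp
    ultimately show ?thesis using ln80 ln2(2) by linarith
  qed
  show "0 \<le> E"
  proof -
    have "8 * pi * s / 80 \<le> 8 * (31416 / 10000) * s / 80"
      using pi s by (intro divide_right_mono mult_right_mono) auto
    with W_le s show ?thesis unfolding E by linarith
  qed
  have sum_pos: "0 < l + M" using lge Mge by simp
  have diff: "l - M = 9 / 5 / (l + M)"
  proof -
    have "(l - M) * (l + M) = 9 / 5" using l(2) M2 by (simp add: algebra_simps power2_eq_square)
    then show ?thesis using sum_pos by (simp add: field_simps)
  qed
  have "(l - M)\<^sup>2 \<le> 37 / 100"
  proof -
    have "l - M \<le> 9 / 5 / (2961 / 1000)" unfolding diff using lge Mge by (intro divide_left_mono) auto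
    moreover have "0 \<le> l - M" unfolding diff using sum_pos by simp
    ultimately have "(l - M)\<^sup>2 \<le> (9 / 5 / (2961 / 1000))\<^sup>2" by (intro power_mono) auto
    also have "\<dots> \<le> 37 / 100" by (simp add: power2_eq_square)
    finally show ?thesis .
  qed
  then have "E + 4 \<le> 2 * M * l"
    using W_ge l(2) M2 unfolding E by (simp add: power2_eq_square algebra_simps)
  then show "(E + 4) / l \<le> 2 * sqrt (2 * ln N)"
    using l0 by (simp add: divide_le_eq M_def)
qed

subsection \<open>The regret bounds\<close>

context rlsvi_tuned
begin

theorem regret_main_bound:
  fixes L :: nat
  assumes L: "0 < L" and N2: "2 \<le> CARD('x) * CARD('a)"
  defines "N \<equiv> real (CARD('x) * CARD('a))"
  shows "bayes_regret_rlsvi (\<lambda>_. real H) ((real H)\<^sup>2) ((real H)\<^sup>2 / \<beta>) H \<rho> \<alpha> L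
    \<le> 4 * \<beta> * (real H)^3 * N * sqrt (log_plus (1 + N * H * L)) * log_plus (1 + real L / N)
      + 2 * (real H)\<^sup>2 * sqrt (2 * N * L * ln N)"
proof -
  have N: "2 \<le> N"
    using of_nat_mono[OF N2, where 'a=real] by (simp only: N_def of_nat_numeral)
  have H1: "1 \<le> real H" using H by simp
  have L1: "1 \<le> real L" using L by simp
  \<comment> \<open>The average number of visits to a coordinate; all tangents are taken there, as
    \<open>potential_le\<close> requires.\<close>
  define m0 where "m0 = real L / N"
  have m0: "0 < m0" using N L1 by (simp add: m0_def)
  define l where "l = sqrt (2 * ln N + 9 / 5)"
  \<comment> \<open>This \<open>k\<close> minimizes \<open>(E + 2) / l + N * k\<close>, in which
    \<open>E\<close> contains \<open>- 2 * ln k\<close>. The minimum is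
    \<open>(E + 4) / l\<close>.\<close>
  define k where "k = 2 / (l * N)"
  define E where "E = 2 * ln (exp (l\<^sup>2 / 2) / (sqrt (2 * pi) * l\<^sup>2) / k)"
  have cst: "0 < l" "0 \<le> E" "(E + 4) / l \<le> 2 * sqrt (2 * ln N)"
    using log_rate_constants[OF N] unfolding E_def k_def l_def by blast+
  have k: "0 < k" using cst(1) N by (simp add: k_def)
  define lp where "lp = log_plus (1 + N * H * L)"
  define ly where "ly = log_plus (1 + m0)"
  have lp: "1 \<le> lp" "1 + N * H * L \<le> exp lp"
  proof -
    show "1 \<le> lp" by (simp add: lp_def log_plus_def)
    have pos: "0 < 1 + N * H * L" using N by (intro add_pos_nonneg) auto
    have "ln (1 + N * H * L) \<le> lp" by (simp add: lp_def log_plus_def)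
    then have "exp (ln (1 + N * H * L)) \<le> exp lp" by simp
    then show "1 + N * H * L \<le> exp lp" using pos by (simp only: exp_ln)
  qed
  have ly: "1 \<le> ly" "ln (1 + m0) \<le> ly" by (simp_all add: ly_def log_plus_def)
  \<comment> \<open>Then the excess over \<open>z\<close> is of order \<open>exp (- lp)\<close>, at
    most \<open>1 / (1 + N * H * L)\<close>, so its total over all coordinates and episodes stays
    bounded.\<close>
  define z where "z = sqrt (2 * lp)"
  have z: "0 < z" "z\<^sup>2 = 2 * lp" using lp by (auto simp: z_def)
  define \<psi> where "\<psi> = 1 / (4 * (1 + N * H * L))"
  define g where "g n = max 0 (log_rate E l m0 (\<beta> + real n))" for n :: nat
  define K where "K = real H + real H * (real H / sqrt \<beta>) * z"
  have K0: "0 \<le> K" using \<beta> z by (simp add: K_def)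
  \<comment> \<open>\<open>A\<close> collects the values and \<open>B\<close> the slopes at
    \<open>m0\<close> of the tangents to the logarithmic and the square root part.\<close>
  define A where "A = K * \<beta> * ln (1 + m0) + real H * (sqrt m0 * (E + 2) / l)"
  define B where "B = K * \<beta> / (1 + m0) + real H * (E / (2 * l * sqrt m0))"
  have tail: "(\<integral>u. max 0 (u - z) \<partial>std_normal) \<le> \<psi>"
  proof -
    have "(\<integral>u. max 0 (u - z) \<partial>std_normal) \<le> exp (z\<^sup>2 / 2 - z * z) / (sqrt (2 * pi) * z\<^sup>2)"
      by (rule integral_std_normal_excess_le[OF z(1)])
    also have "z\<^sup>2 / 2 - z * z = - lp" using z(2) by (simp add: power2_eq_square)
    also have "exp (- lp) / (sqrt (2 * pi) * z\<^sup>2) \<le> (1 / (1 + N * H * L)) / 4"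
    proof (rule frac_le)
      have "2 \<le> sqrt (2 * pi)" by (rule real_le_rsqrt) (use pi_ge_two in simp)
      then have "2 * 2 \<le> sqrt (2 * pi) * z\<^sup>2" unfolding z(2) using lp by (intro mult_mono) auto
      then show "4 \<le> sqrt (2 * pi) * z\<^sup>2" by simp
      show "exp (- lp) \<le> 1 / (1 + N * H * L)"
        using lp(2) N by (simp add: exp_minus inverse_eq_divide frac_le add_pos_nonneg)
      show "0 \<le> 1 / (1 + N * H * L)" using N by simp
    qed simp
    finally show ?thesis unfolding \<psi>_def by (simp only: divide_divide_eq_left mult.commute)
  qed
  have excess: "(\<integral>u. max 0 (u / sqrt (\<beta> + real n) - g n) \<partial>std_normal) \<le> k / sqrt m0" for n
    unfolding g_def E_def using \<beta> by (intro log_rate_excess cst(1) m0 k) auto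
  have path: "(\<Sum>n<m. bonus z g n) \<le> A + B * (real m - real L / (CARD('x) * CARD('a)))" for m
  proof -
    have "(\<Sum>n<m. bonus z g n) = K * (\<Sum>n<m. \<beta> / (\<beta> + real n)) + real H * (\<Sum>n<m. g n)"
    proof -
      have "bonus z g n = K * (\<beta> / (\<beta> + real n)) + real H * g n" for n
        unfolding bonus_def K_def by (simp only: mult.commute)
      then show ?thesis by (simp only: sum.distrib sum_distrib_left)
    qed
    also have "\<dots> \<le> K * (\<beta> * (ln (1 + m0) + (real m - m0) / (1 + m0)))
      + real H * (sqrt m0 * (E + 2) / l + E / (2 * l * sqrt m0) * (real m - m0))"
    proof (intro add_mono mult_left_mono K0)
      have "(\<Sum>n<m. \<beta> / (\<beta> + real n)) \<le> \<beta> * ln (1 + real m)" by (rule sum_inverse_le_ln[OF \<beta>])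
      also have "\<dots> \<le> \<beta> * (ln (1 + m0) + (real m - m0) / (1 + m0))"
        using \<beta> m0 by (intro mult_left_mono ln_tangent) auto
      finally show "(\<Sum>n<m. \<beta> / (\<beta> + real n)) \<le> \<beta> * (ln (1 + m0) + (real m - m0) / (1 + m0))" .
      show "(\<Sum>n<m. g n) \<le> sqrt m0 * (E + 2) / l + E / (2 * l * sqrt m0) * (real m - m0)"
        unfolding g_def using \<beta> by (intro sum_log_rate_le cst m0) auto
    qed simp
    also have "\<dots> = A + B * (real m - m0)" by (simp add: A_def B_def algebra_simps add_divide_distrib diff_divide_distrib)
    finally show ?thesis by (simp add: m0_def N_def)
  qed
  have "bayes_regret_rlsvi (\<lambda>_. real H) ((real H)\<^sup>2) ((real H)\<^sup>2 / \<beta>) H \<rho> \<alpha> L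
    \<le> real H * N * A + real L * ((real H)\<^sup>2 * N * ((real H)\<^sup>2 / sqrt \<beta> * \<psi> + k / sqrt m0))"
    using bayes_regret_le[OF less_imp_le[OF z(1)] tail excess path] by (simp only: N_def of_nat_mult)
  also have "\<dots> = real H * N * (K * \<beta> * ln (1 + m0)) + real L * N * (real H)^4 / sqrt \<beta> * \<psi>
      + (real H)\<^sup>2 * (N * (sqrt m0 * (E + 2) / l) + real L * (N * (k / sqrt m0)))"
    by (simp add: A_def algebra_simps power2_eq_square power4_eq_xxxx)
  also have "N * (sqrt m0 * (E + 2) / l) + real L * (N * (k / sqrt m0)) = sqrt (N * L) * ((E + 4) / l)"
  proof -
    have sN: "0 < sqrt N" "0 < sqrt (real L)" using N L1 by auto
    have "N * sqrt m0 = sqrt (N * L)"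
    proof -
      have "N * sqrt m0 = (sqrt N * sqrt N) * (sqrt (real L) / sqrt N)"
        using N by (simp add: m0_def real_sqrt_divide)
      also have "\<dots> = sqrt N * sqrt (real L)"
      proof -
        have "(r * r) * (q / r) = r * q" if "0 < r" for r q :: real using that by simp
        from this[OF sN(1)] show ?thesis .
      qed
      finally show ?thesis by (simp add: real_sqrt_mult)
    qed
    moreover have "real L / sqrt m0 = sqrt (N * L)"
    proof -
      have "real L / sqrt m0 = (sqrt (real L) * sqrt (real L)) / (sqrt (real L) / sqrt N)"
        using N by (simp add: m0_def real_sqrt_divide)
      also have "\<dots> = sqrt N * sqrt (real L)" using sN by (simp add: field_simps)
      finally show ?thesis by (simp add: real_sqrt_mult)
    qed
    moreover have "N * k = 2 / l" using N by (simp add: k_def)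
    moreover have "N * (r * (E + 2) / l) + M * (N * (k / r)) = (N * r) * ((E + 2) / l) + (M / r) * (N * k)" for r M
      by simp
    ultimately have "N * (sqrt m0 * (E + 2) / l) + real L * (N * (k / sqrt m0)) = sqrt (N * L) * ((E + 2) / l) + sqrt (N * L) * (2 / l)"
      by (simp only:)
    also have "\<dots> = sqrt (N * L) * ((E + 4) / l)" by (simp add: add_divide_distrib algebra_simps)
    finally show ?thesis .
  qed
  also have "(real H)\<^sup>2 * (sqrt (N * L) * ((E + 4) / l)) \<le> (real H)\<^sup>2 * (sqrt (N * L) * (2 * sqrt (2 * ln N)))"
    using N by (intro mult_left_mono cst(3)) auto
  also have "(real H)\<^sup>2 * (sqrt (N * L) * (2 * sqrt (2 * ln N))) = 2 * (real H)\<^sup>2 * sqrt (2 * N * L * ln N)"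
    by (simp add: real_sqrt_mult)
  also have "real H * N * (K * \<beta> * ln (1 + m0)) \<le> 2 * (\<beta> * (real H)^3 * N * sqrt lp * ly)"
  proof -
    have "K \<le> real H * real H * sqrt lp + real H * real H * sqrt lp"
    proof -
      have "1 \<le> real H * sqrt lp" using H1 lp mult_mono[of 1 "real H" 1 "sqrt lp"] by simp
      then have 1: "real H * 1 \<le> real H * (real H * sqrt lp)" by (intro mult_left_mono) auto
      \<comment> \<open>\<open>2 \<le> \<beta>\<close> absorbs the factor 2 under the root in
        \<open>z\<close>.\<close>
      have "z / sqrt \<beta> \<le> sqrt lp"
        using \<beta> lp by (simp add: z_def real_sqrt_mult divide_le_eq mult.commute mult_left_mono)
      then have "real H * real H * (z / sqrt \<beta>) \<le> real H * real H * sqrt lp" by (intro mult_left_mono) auto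
      with 1 show ?thesis by (simp add: K_def mult.assoc)
    qed
    then have "K * (\<beta> * ln (1 + m0)) \<le> (2 * (real H * real H * sqrt lp)) * (\<beta> * ly)"
      using \<beta> ly m0 K0 lp by (intro mult_mono) auto
    then have "real H * N * (K * (\<beta> * ln (1 + m0))) \<le> real H * N * ((2 * (real H * real H * sqrt lp)) * (\<beta> * ly))"
      using N by (intro mult_left_mono) auto
    then show ?thesis by (simp add: power3_eq_cube mult_ac)
  qed
  \<comment> \<open>A generous estimate: the left side is at most a quarter of the cube of
    \<open>H\<close>. Granting it the same budget as the preceding term accounts for the constant
    4.\<close>
  also have "real L * N * (real H)^4 / sqrt \<beta> * \<psi> \<le> 2 * (\<beta> * (real H)^3 * N * sqrt lp * ly)"
  proof -
    have pos: "0 < 1 + N * H * L" using N by (intro add_pos_nonneg) auto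
    have "N * H * L * \<psi> \<le> 1 / 4" using pos by (simp add: \<psi>_def field_simps)
    then have "(real H)^3 * (N * H * L * \<psi>) \<le> (real H)^3 * (1 / 4)" by (intro mult_left_mono) auto
    moreover have "real L * N * (real H)^4 / sqrt \<beta> * \<psi> \<le> real L * N * (real H)^4 / 1 * \<psi>"
      using \<beta> N pos by (intro mult_right_mono divide_left_mono) (auto simp: \<psi>_def)
    moreover have "real L * N * (real H)^4 / 1 * \<psi> = (real H)^3 * (N * H * L * \<psi>)"
      by (simp add: power3_eq_cube power4_eq_xxxx)
    moreover have "(real H)^3 * 1 \<le> (real H)^3 * (\<beta> * N * sqrt lp * ly)"
    proof (intro mult_left_mono)
      have "1 * 1 * 1 * 1 \<le> \<beta> * N * sqrt lp * ly" using \<beta> N lp ly by (intro mult_mono) auto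
      then show "1 \<le> \<beta> * N * sqrt lp * ly" by simp
    qed simp
    moreover have "(real H)^3 * (\<beta> * N * sqrt lp * ly) = \<beta> * (real H)^3 * N * sqrt lp * ly" by simp
    moreover have "0 \<le> (real H)^3" by simp
    ultimately show ?thesis by linarith
  qed
  finally show ?thesis by (simp add: lp_def ly_def m0_def mult_ac)
qed

text \<open>Disposes of \<open>N = 1\<close>, where \<open>ln N = 0\<close> leaves no budget for the
  noise. With a single action there is only one policy, so nothing can be lost.\<close>

lemma regret_single_action:
  assumes "CARD('a) = 1"
  shows "bayes_regret_rlsvi (\<lambda>_. real H) ((real H)\<^sup>2) ((real H)\<^sup>2 / \<beta>) H \<rho> \<alpha> L = 0"
proof -
  obtain a0 :: 'a where a0: "UNIV = {a0}" using assms by (auto simp: card_1_singleton_iff)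
  then have "a = a0" for a :: 'a by (metis UNIV_I singletonD)
  then have eq: "\<pi> = \<pi>'" for \<pi> \<pi>' :: "('x, 'a) policy" by (intro ext) metis
  have "Vstar P H 0 x = Vpi P H \<pi> 0 x" for P :: "('x, 'a) model" and x \<pi>
  proof (rule antisym)
    show "Vstar P H 0 x \<le> Vpi P H \<pi> 0 x" 
    proof (rule Vstar_le)
      fix \<pi>'
      show "Vpi P H \<pi>' 0 x \<le> Vpi P H \<pi> 0 x" unfolding eq[of \<pi>' \<pi>] ..
    qed
  qed (rule Vpi_le_Vstar)
  then have "gap P \<pi> = 0" for P \<pi> by (simp add: gap_def)
  then show ?thesis by (simp add: bayes_regret_eq)
qed

end

theorem mainTheorem1:
  fixes \<rho> :: "'x::finite pmf"
    and \<alpha> :: "nat \<times> 'x \<times> 'a::finite \<Rightarrow> bool \<times> 'x \<Rightarrow> real"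
    and H :: nat and \<beta> :: real and L :: nat
  assumes "0 < H"
    and "2 \<le> \<beta>"
    and "\<forall>t<H. \<forall>x a w. 0 \<le> \<alpha> (t, x, a) w"
    and "\<forall>t<H. \<forall>x a. (\<Sum>w\<in>UNIV. \<alpha> (t, x, a) w) = \<beta>"
  shows "bayes_regret_rlsvi (\<lambda>_. real H) ((real H)\<^sup>2) ((real H)\<^sup>2 / \<beta>) H \<rho> \<alpha> L
           \<le> 4 * (real H)\<^sup>2 * sqrt (\<beta> * CARD('x) * CARD('a) * L
                 * log_plus (1 + CARD('x) * CARD('a) * H * L))
             * log_plus (1 + real L / (CARD('x) * CARD('a)))
       \<and> bayes_regret_rlsvi (\<lambda>_. real H) ((real H)\<^sup>2) ((real H)\<^sup>2 / \<beta>) H \<rho> \<alpha> L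
           \<le> 4 * \<beta> * (real H)^3 * CARD('x) * CARD('a)
                 * sqrt (log_plus (1 + CARD('x) * CARD('a) * H * L))
                 * log_plus (1 + real L / (CARD('x) * CARD('a)))
             + 2 * (real H)\<^sup>2 * sqrt (2 * CARD('x) * CARD('a) * L * ln (CARD('x) * CARD('a)))"
proof -
  \<comment> \<open>Beyond the horizon the parameters are unconstrained, while the locale demands
    mass \<open>\<beta>\<close> at every index. A uniform vector fills the gap, and the prior does
    not see it.\<close>
  define \<alpha>' where "\<alpha>' i w = (if fst i < H then \<alpha> i w else \<beta> / real CARD(bool \<times> 'x))" for i :: "nat \<times> 'x \<times> 'a" and w
  have nonneg: "0 \<le> \<alpha>' i w" for i w
  proof (cases i)
    case (fields t x a)
    then show ?thesis using assms(2) assms(3)[rule_format, of t x a w] by (simp add: \<alpha>'_def)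
  qed
  have total: "sum (\<alpha>' i) UNIV = \<beta>" for i
  proof (cases i)
    case (fields t x a)
    then show ?thesis using assms(4)[rule_format, of t x a] by (cases "t < H") (simp_all add: \<alpha>'_def)
  qed
  interpret rlsvi_tuned H \<beta> \<rho> \<alpha>' using assms(1,2) nonneg total by unfold_locales auto
  have "mdp_prior H \<alpha> = mdp_prior H \<alpha>'"
    unfolding mdp_prior_def by (intro PiM_cong refl arg_cong[where f=dirichlet]) (auto simp: \<alpha>'_def)
  then have "bayes_regret_rlsvi (\<lambda>_. real H) ((real H)\<^sup>2) ((real H)\<^sup>2 / \<beta>) H \<rho> \<alpha> L
    = bayes_regret_rlsvi (\<lambda>_. real H) ((real H)\<^sup>2) ((real H)\<^sup>2 / \<beta>) H \<rho> \<alpha>' L"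
    by (simp add: bayes_regret_rlsvi_def)
  moreover define R where "R = bayes_regret_rlsvi (\<lambda>_. real H) ((real H)\<^sup>2) ((real H)\<^sup>2 / \<beta>) H \<rho> \<alpha>' L"
  ultimately have R: "bayes_regret_rlsvi (\<lambda>_. real H) ((real H)\<^sup>2) ((real H)\<^sup>2 / \<beta>) H \<rho> \<alpha> L = R" by simp
  define N where "N = real (CARD('x) * CARD('a))"
  define lp where "lp = log_plus (1 + N * H * L)"
  define ly where "ly = log_plus (1 + real L / N)"
  have "1 \<le> CARD('x) * CARD('a)" by (simp add: Suc_le_eq)
  from of_nat_mono[OF this, where 'a=real] have N: "1 \<le> N" by (simp only: N_def of_nat_1)
  have lp: "1 \<le> lp" and ly: "1 \<le> ly" by (simp_all add: lp_def ly_def log_plus_def)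
  have H1: "1 \<le> real H" using assms(1) by simp
  define S where "S = sqrt (\<beta> * N * lp)"
  have S: "0 \<le> S" using assms(2) N lp by (simp add: S_def)
  have first: "4 * (real H)\<^sup>2 * sqrt (\<beta> * N * L * lp) * ly = 4 * (real H)\<^sup>2 * (S * sqrt L) * ly"
    by (simp add: S_def real_sqrt_mult)
  have main: "R \<le> 4 * (real H)\<^sup>2 * (S * sqrt L) * ly \<and> R \<le> 4 * \<beta> * (real H)^3 * N * sqrt lp * ly + 2 * (real H)\<^sup>2 * sqrt (2 * N * L * ln N)"
  proof (cases "L = 0 \<or> CARD('a) = 1")
    case True
    then have "R = 0"
    proof
      assume "CARD('a) = 1" then show ?thesis unfolding R_def by (rule regret_single_action)
    qed (simp add: R_def bayes_regret_eq)
    moreover have "0 \<le> 4 * (real H)\<^sup>2 * (S * sqrt L) * ly" using S ly by simp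
    moreover have "0 \<le> 4 * \<beta> * (real H)^3 * N * sqrt lp * ly + 2 * (real H)\<^sup>2 * sqrt (2 * N * L * ln N)"
      using assms(2) N lp ly by simp
    ultimately show ?thesis by simp
  next
    case False
    then have L: "0 < L" "1 \<le> real L" by auto
    have "0 < CARD('a)" "0 < CARD('x)" by simp_all
    then have N2: "2 \<le> CARD('x) * CARD('a)" using False mult_le_mono[of 1 "CARD('x)" 2 "CARD('a)"] by linarith
    have second: "R \<le> 4 * \<beta> * (real H)^3 * N * sqrt lp * ly + 2 * (real H)\<^sup>2 * sqrt (2 * N * L * ln N)"
      using regret_main_bound[OF L(1) N2] by (simp only: R_def N_def lp_def ly_def)
    have "R \<le> 4 * (real H)\<^sup>2 * (S * sqrt L) * ly"
    \<comment> \<open>The crossover is where the trivial bound \<open>H * L\<close> meets the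
      claimed first bound.\<close>
    proof (cases "sqrt L \<le> 4 * real H * S * ly")
      case True
      have "R \<le> real H * real L" unfolding R_def by (rule bayes_regret_trivial)
      also have "\<dots> = real H * sqrt L * sqrt L" by simp
      also have "\<dots> \<le> real H * sqrt L * (4 * real H * S * ly)" using True by (intro mult_left_mono) auto
      finally show ?thesis by (simp add: power2_eq_square mult_ac)
    next
      case False
      have "4 * \<beta> * (real H)^3 * N * sqrt lp * ly \<le> (real H)\<^sup>2 * S * sqrt L"
      proof -
        \<comment> \<open>Weakening \<open>sqrt lp\<close> to \<open>lp\<close> makes this a square
          \<open>S * S\<close>; one of the two factors is then traded for \<open>sqrt L\<close> by
          the case assumption.\<close>
        have "\<beta> * N * sqrt lp \<le> \<beta> * N * lp"
          using assms(2) N lp by (intro mult_left_mono) (auto simp: real_sqrt_le_iff' power2_eq_square intro!: real_le_lsqrt)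
        also have "\<dots> = S * S" using assms(2) N lp by (simp add: S_def)
        finally have "4 * (real H)^3 * ly * (\<beta> * N * sqrt lp) \<le> 4 * (real H)^3 * ly * (S * S)"
          using ly by (intro mult_left_mono) auto
        also have "\<dots> = (real H)\<^sup>2 * S * (4 * real H * S * ly)" by (simp add: power2_eq_square power3_eq_cube)
        also have "\<dots> \<le> (real H)\<^sup>2 * S * sqrt L" using False S by (intro mult_left_mono) auto
        finally show ?thesis by (simp add: mult_ac)
      qed
      moreover have "2 * (real H)\<^sup>2 * sqrt (2 * N * L * ln N) \<le> 2 * (real H)\<^sup>2 * (S * sqrt L)"
      proof -
        have "ln N \<le> ln (1 + N * H * L)"
        proof (rule ln_mono)
          have "N * 1 * 1 \<le> N * real H * real L" using N H1 L by (intro mult_mono) auto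
          then show "N \<le> 1 + N * H * L" by simp
        qed (use N in auto)
        also have "\<dots> \<le> lp" by (simp add: lp_def log_plus_def)
        finally have "2 * N * L * ln N \<le> \<beta> * N * L * lp"
          using assms(2) N by (intro mult_mono) auto
        then have "sqrt (2 * N * L * ln N) \<le> sqrt (\<beta> * N * L * lp)" by (rule real_sqrt_le_mono)
        also have "\<dots> = S * sqrt L" by (simp add: S_def real_sqrt_mult)
        finally show ?thesis by (intro mult_left_mono) auto
      qed
      \<comment> \<open>The two terms of the second bound use up 1 and 2 of the 4 units
        available.\<close>
      moreover have "3 * ((real H)\<^sup>2 * (S * sqrt L)) \<le> 4 * (real H)\<^sup>2 * (S * sqrt L) * ly"
      proof -
        have "3 * ((real H)\<^sup>2 * (S * sqrt L)) * 1 \<le> 4 * ((real H)\<^sup>2 * (S * sqrt L)) * ly"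
          using S ly by (intro mult_mono) auto
        then show ?thesis by (simp add: mult.assoc)
      qed
      ultimately show ?thesis using second by (simp add: mult.assoc)
    qed
    with second show ?thesis by blast
  qed
  show ?thesis
    using main[folded first] unfolding R lp_def ly_def N_def by (simp add: mult.assoc)
qed

end
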